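(* Let $\Omega\subset\mathbb{R}^d$ ($d\ge1$) be a bounded open domain, and let $a\in L^\infty(\Omega)$ satisfy $a\ge\underline{a}$ almost everywhere in $\Omega$ for some constant $\underline{a}>0$. Let $u\in H^1(\Omega)$ be a weak solution of $-\operatorname{div}(a\nabla u)=\operatorname{div}F$ in $\Omega$. Let $\alpha\in(0,1)$ and let $\Omega'\Subset\Omega$ be a $\theta$-smooth subdomain (for some $\theta>0$). Then $$a\in C^{0,\alpha}\big(\overline{\Omega}\big)\ \text{ and }\ F\in C^{0,\alpha}\big(\overline{\Omega}\big)\quad\Longrightarrow\quad\nabla u\in C^{0,\alpha}\big(\overline{\Omega'}\big).$$
   Context: $\Omega'\Subset\Omega$ means that $\Omega'\subset\Omega$ is an open subdomain with $\operatorname{dist}(\Omega',\partial\Omega)>0$. A bounded open set $D\subset\mathbb{R}^d$ is $\theta$-smooth if $|B(x,r)\cap D|\ge\theta v_d r^d$ for all $x\in D$ and all $r\in(0,\operatorname{diam}D)$, where $v_d$ is the volume of the unit ball of $\mathbb{R}^d$. Weak solution: $F$ is a square-integrable vector field on $\Omega$ and $\int_\Omega a\nabla u\cdot\nabla\varphi=-\int_\Omega F\cdot\nabla\varphi$ for all $\varphi\in C_c^\infty(\Omega)$. Membership in $C^{0,\alpha}$ is understood up to almost everywhere equality. *)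

theory Defs
  imports "HOL-Analysis.Analysis"
begin

section \<open>Test functions\<close>

primrec C_k :: "nat \<Rightarrow> ('a::euclidean_space \<Rightarrow> real) \<Rightarrow> bool" where
  "C_k 0 f \<longleftrightarrow> continuous_on UNIV f"
| "C_k (Suc k) f \<longleftrightarrow>
     (\<forall>x. f differentiable (at x)) \<and> (\<forall>b\<in>Basis. C_k k (\<lambda>x. frechet_derivative f (at x) b))"

text \<open>Elements of \<open>C_c\<^sup>\<infinity>(\<Omega>)\<close> are represented by their extension by zero to the whole space.\<close>

definition test_functions :: "'a::euclidean_space set \<Rightarrow> ('a \<Rightarrow> real) set" where
  "test_functions \<Omega> =
     {\<phi>. (\<forall>k. C_k k \<phi>) \<and> compact (closure {x. \<phi> x \<noteq> 0}) \<and> closure {x. \<phi> x \<noteq> 0} \<subseteq> \<Omega>}"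

definition grad :: "('a::euclidean_space \<Rightarrow> real) \<Rightarrow> 'a \<Rightarrow> 'a" where
  "grad f x = (\<Sum>b\<in>Basis. frechet_derivative f (at x) b *\<^sub>R b)"


section \<open>Function spaces\<close>

definition L2 :: "'a::euclidean_space set \<Rightarrow> ('a \<Rightarrow> 'b::euclidean_space) set" where
  "L2 \<Omega> = {f \<in> borel_measurable (lebesgue_on \<Omega>). integrable (lebesgue_on \<Omega>) (\<lambda>x. (norm (f x))\<^sup>2)}"

definition Linfty :: "'a::euclidean_space set \<Rightarrow> ('a \<Rightarrow> 'b::euclidean_space) set" where
  "Linfty \<Omega> = {f \<in> borel_measurable (lebesgue_on \<Omega>). \<exists>C. AE x in lebesgue_on \<Omega>. norm (f x) \<le> C}"

definition has_L2_gradient ::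
    "'a::euclidean_space set \<Rightarrow> ('a \<Rightarrow> real) \<Rightarrow> ('a \<Rightarrow> 'a) \<Rightarrow> bool" where
  "has_L2_gradient \<Omega> u G \<longleftrightarrow> u \<in> L2 \<Omega> \<and> G \<in> L2 \<Omega> \<and>
     (\<forall>\<phi>\<in>test_functions \<Omega>. \<forall>b\<in>Basis.
        (LINT x|lebesgue_on \<Omega>. u x * frechet_derivative \<phi> (at x) b)
        = - (LINT x|lebesgue_on \<Omega>. (G x \<bullet> b) * \<phi> x))"

definition H1 :: "'a::euclidean_space set \<Rightarrow> ('a \<Rightarrow> real) set" where
  "H1 \<Omega> = {u. \<exists>G. has_L2_gradient \<Omega> u G}"

text \<open>
  For open \<open>\<Omega>\<close>, the weak gradient of an \<open>H\<^sup>1\<close> function is determined almost everywhere on \<open>\<Omega>\<close>;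
  one representative is selected.
\<close>

definition weak_grad :: "'a::euclidean_space set \<Rightarrow> ('a \<Rightarrow> real) \<Rightarrow> 'a \<Rightarrow> 'a" where
  "weak_grad \<Omega> u = (SOME G. has_L2_gradient \<Omega> u G)"

definition hoelder_on ::
    "real \<Rightarrow> 'a::euclidean_space set \<Rightarrow> ('a \<Rightarrow> 'b::euclidean_space) \<Rightarrow> bool" where
  "hoelder_on \<alpha> S g \<longleftrightarrow> bounded (g ` S) \<and>
     (\<exists>C. \<forall>x\<in>S. \<forall>y\<in>S. norm (g x - g y) \<le> C * dist x y powr \<alpha>)"

text \<open>
  Membership in \<open>C\<^sup>0\<^sup>,\<^sup>\<alpha>\<close> of the closure of \<open>\<Omega>\<close>, for functions given up to almost everywhere equality
  on \<open>\<Omega>\<close>. The equality is required only on \<open>\<Omega>\<close>, whose boundary may have positive measure.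
\<close>

definition hoelder_closure ::
    "real \<Rightarrow> 'a::euclidean_space set \<Rightarrow> ('a \<Rightarrow> 'b::euclidean_space) set" where
  "hoelder_closure \<alpha> \<Omega> =
     {f. \<exists>g. hoelder_on \<alpha> (closure \<Omega>) g \<and> (AE x in lebesgue_on \<Omega>. f x = g x)}"


section \<open>The equation and the domains\<close>

text \<open>Weak formulation of \<open>- div (a \<nabla>u) = div F\<close> in \<open>\<Omega>\<close>.\<close>

definition weak_solution ::
    "'a::euclidean_space set \<Rightarrow> ('a \<Rightarrow> real) \<Rightarrow> ('a \<Rightarrow> 'a) \<Rightarrow> ('a \<Rightarrow> real) \<Rightarrow> bool" where
  "weak_solution \<Omega> a F u \<longleftrightarrow> F \<in> L2 \<Omega> \<and>
     (\<forall>\<phi>\<in>test_functions \<Omega>.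
        (LINT x|lebesgue_on \<Omega>. a x * (weak_grad \<Omega> u x \<bullet> grad \<phi> x))
        = - (LINT x|lebesgue_on \<Omega>. F x \<bullet> grad \<phi> x))"

text \<open>
  \<^const>\<open>setdist\<close> is 0 if one of its arguments is empty, so the last conjunct makes \<open>\<Omega>'\<close> nonempty;
  the frontier of a nonempty bounded open set is never empty.
\<close>

definition compactly_contained :: "'a::euclidean_space set \<Rightarrow> 'a set \<Rightarrow> bool" where
  "compactly_contained \<Omega>' \<Omega> \<longleftrightarrow> open \<Omega>' \<and> \<Omega>' \<subseteq> \<Omega> \<and> setdist \<Omega>' (frontier \<Omega>) > 0"

definition theta_smooth :: "real \<Rightarrow> 'a::euclidean_space set \<Rightarrow> bool" where
  "theta_smooth \<theta> D \<longleftrightarrow> bounded D \<and> open D \<and>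
     (\<forall>x\<in>D. \<forall>r. 0 < r \<and> r < diameter D \<longrightarrow>
        measure lebesgue (ball x r \<inter> D) \<ge> \<theta> * measure lebesgue (ball (0::'a) 1) * r ^ DIM('a))"

end

theory Submission imports Defs begin

text \<open>
  The proof freezes the coefficients on small cubes, as in Campanato's approach to Schauder estimates, and
  it works with the gradient field \<open>g = \<nabla>u\<close> directly. Of \<open>u\<close> only one thing is used, that \<open>g\<close> is weakly curl-free.

  On a cube of half-width \<open>r\<close> around \<open>x\<^sub>0\<close>, let \<open>p\<close> be the \<open>L\<^sup>2\<close> projection of \<open>g\<close> onto the closure of the
  gradients of test functions (\<open>L2_projection\<close>), and \<open>H = g - p\<close>. The field \<open>H\<close> is curl-free, and it is
  divergence-free because it is orthogonal to gradients; so its components are weakly harmonic. By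
  Weyl's lemma (\<open>Weyl_lemma\<close>) it coincides with its own mollification, and its oscillation over the concentric
  cube of half-width \<open>t r\<close> is of order \<open>t\<close> (\<open>harmonic_field_oscillation\<close>). On the other hand the equation
  shows that \<open>a(x\<^sub>0) p\<close> is the projection of \<open>(a(x\<^sub>0) - a) g + F(x\<^sub>0) - F\<close>, so \<open>p\<close> is of order
  \<open>r\<^sup>\<alpha> (\<bar>g\<bar> + 1)\<close> in the mean (\<open>gradient_projection\<close>).

  Let \<open>e\<^sub>k\<close> be the mean distance of \<open>g\<close> from a constant \<open>c\<^sub>k\<close> on the cube of half-width \<open>t\<^sup>k r\<^sub>0\<close>. For a
  suitable fixed \<open>t\<close> the two estimates combine to a recursion (\<open>decay_one_step\<close>) in which \<open>e\<^sub>k\<close> contracts by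
  the factor \<open>t\<^sup>\<alpha> / 2\<close>, up to a perturbation of order \<open>t\<^sup>k\<^sup>\<alpha> (e\<^sub>k + \<bar>c\<^sub>k\<bar> + 1)\<close>. The factors \<open>t\<^sup>k\<^sup>\<alpha>\<close> are
  summable, so \<open>c\<^sub>k\<close> stays bounded, and \<open>e\<^sub>k\<close> decays like \<open>t\<^sup>k\<^sup>\<alpha>\<close> (\<open>decay_iteration\<close>, \<open>Campanato_decay\<close>). The
  constants converge to a Hoelder continuous function of the centre \<open>x\<^sub>0\<close>, which is \<open>g\<close> almost everywhere
  (\<open>interior_Hoelder_gradient\<close>). All bounds are uniform over centres whose cube of half-width \<open>r\<^sub>0\<close> lies in \<open>\<Omega>\<close>,
  and for small \<open>r\<^sub>0\<close> these include the closure of \<open>\<Omega>'\<close>.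
\<close>


section \<open>Test functions\<close>

abbreviation pd :: "'a::euclidean_space \<Rightarrow> ('a \<Rightarrow> real) \<Rightarrow> 'a \<Rightarrow> real" where
  "pd b f \<equiv> (\<lambda>x. frechet_derivative f (at x) b)"

lemma C_k_continuous: "C_k k f \<Longrightarrow> continuous_on UNIV f"
  by (cases k) (auto intro!: differentiable_imp_continuous_on simp: differentiable_on_def differentiable_at_withinI)

lemma C_k_SucD: "C_k (Suc k) f \<Longrightarrow> C_k k f"
proof (induction k arbitrary: f)
  case 0
  then show ?case using C_k_continuous by fastforce
next
  case (Suc k)
  then show ?case by simp
qed

lemma pd_eqI: "(f has_derivative f') (at x) \<Longrightarrow> pd b f x = f' b"
  using frechet_derivative_at by metis

lemma has_derivative_frechet: "f differentiable (at x) \<Longrightarrow> (f has_derivative (\<lambda>h. pd h f x)) (at x)"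
  by (simp add: frechet_derivative_works)

lemma pd_const: "pd b (\<lambda>x. c) = (\<lambda>x. 0)"
  by (auto simp: pd_eqI[OF has_derivative_const])

lemma C_k_const: "C_k k (\<lambda>x. c)"
  by (induction k arbitrary: c) (auto simp: pd_const)

lemma pd_add:
  assumes "\<And>x. f differentiable (at x)" "\<And>x. g differentiable (at x)"
  shows "pd b (\<lambda>x. f x + g x) = (\<lambda>x. pd b f x + pd b g x)"
  by (intro ext pd_eqI has_derivative_add has_derivative_frechet assms)

lemma C_k_add: "C_k k f \<Longrightarrow> C_k k g \<Longrightarrow> C_k k (\<lambda>x. f x + g x)"
  by (induction k arbitrary: f g) (auto intro: continuous_on_add simp: pd_add)

lemma pd_mult:
  assumes "\<And>x. f differentiable (at x)" "\<And>x. g differentiable (at x)"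
  shows "pd b (\<lambda>x. f x * g x) = (\<lambda>x. f x * pd b g x + pd b f x * g x)"
  by (intro ext pd_eqI has_derivative_mult has_derivative_frechet assms)

lemma C_k_mult: "C_k k f \<Longrightarrow> C_k k g \<Longrightarrow> C_k k (\<lambda>x. f x * g x)"
proof (induction k arbitrary: f g)
  case (Suc k)
  then have "C_k k f" "C_k k g" by (auto intro: C_k_SucD)
  with Suc show ?case by (auto intro!: C_k_add simp: pd_mult)
qed (auto intro: continuous_on_mult)

lemma pd_linear: "pd b (\<lambda>x. (x - y) \<bullet> c) = (\<lambda>x. b \<bullet> c)"
  by (intro ext pd_eqI) (auto intro!: derivative_eq_intros)

lemma C_k_linear: "C_k k (\<lambda>x. (x - y) \<bullet> c)"
proof (cases k)
  case (Suc j)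
  have "(\<lambda>x. (x - y) \<bullet> c) differentiable (at x)" for x
    by (auto intro!: derivative_intros)
  then show ?thesis using Suc by (auto simp: pd_linear C_k_const)
qed (auto intro!: continuous_intros)

lemma test_functions_mono: "D \<subseteq> \<Omega> \<Longrightarrow> test_functions D \<subseteq> test_functions \<Omega>"
  by (auto simp: test_functions_def)

lemma test_functionsI:
  assumes "\<And>k. C_k k \<phi>" "{x. \<phi> x \<noteq> 0} \<subseteq> K" "compact K" "K \<subseteq> D"
  shows "\<phi> \<in> test_functions D"
proof -
  have "closure {x. \<phi> x \<noteq> 0} \<subseteq> K"
    using assms by (meson closure_minimal compact_imp_closed)
  moreover have "bounded {x. \<phi> x \<noteq> 0}"
    using assms(2,3) bounded_subset compact_imp_bounded by blast
  ultimately show ?thesis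
    using assms(1,4) unfolding test_functions_def by (auto simp: compact_closure)
qed

lemma test_functionsD:
  assumes "\<phi> \<in> test_functions D" and that: "b \<in> Basis"
  shows "C_k k \<phi>" "\<phi> differentiable (at x)" "compact (closure {x. \<phi> x \<noteq> 0})"
    "closure {x. \<phi> x \<noteq> 0} \<subseteq> D" "C_k k (pd b \<phi>)"
proof -
  have *: "C_k (Suc k) \<phi>" using assms by (auto simp: test_functions_def simp del: C_k.simps)
  then show "C_k k \<phi>" by (rule C_k_SucD)
  from * show "\<phi> differentiable (at x)" "C_k k (pd b \<phi>)" using that by auto
qed (use assms in \<open>auto simp: test_functions_def\<close>)

lemma test_functions_C_k: "\<phi> \<in> test_functions D \<Longrightarrow> C_k k \<phi>"
  and test_functions_differentiable: "\<phi> \<in> test_functions D \<Longrightarrow> \<phi> differentiable (at x)"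
  using test_functionsD SOME_Basis by blast+

lemma test_functions_zero_outside: "\<phi> \<in> test_functions D \<Longrightarrow> x \<notin> D \<Longrightarrow> \<phi> x = 0"
  using closure_subset[of "{x. \<phi> x \<noteq> 0}"] by (auto simp: test_functions_def)

lemma pd_eq_0_outside_support:
  assumes "x \<notin> closure {x. f x \<noteq> 0}"
  shows "pd b f x = 0"
proof -
  have "((\<lambda>x. 0) has_derivative (\<lambda>x. 0)) (at x)" by simp
  then have "(f has_derivative (\<lambda>x. 0)) (at x)"
    by (rule has_derivative_transform_within_open[where s="- closure {x. f x \<noteq> 0}"])
       (use assms closure_subset[of "{x. f x \<noteq> 0}"] in \<open>auto simp: subset_eq\<close>)
  then show ?thesis by (rule pd_eqI)
qed

lemma test_functions_pd:
  assumes "\<phi> \<in> test_functions D" "b \<in> Basis"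
  shows "pd b \<phi> \<in> test_functions D"
proof (rule test_functionsI)
  show "{x. pd b \<phi> x \<noteq> 0} \<subseteq> closure {x. \<phi> x \<noteq> 0}"
    using pd_eq_0_outside_support by blast
qed (use test_functionsD[OF assms] in auto)

lemma test_functions_add:
  assumes "\<phi> \<in> test_functions D" "\<psi> \<in> test_functions D"
  shows "(\<lambda>x. \<phi> x + \<psi> x) \<in> test_functions D"
proof (rule test_functionsI)
  show "{x. \<phi> x + \<psi> x \<noteq> 0} \<subseteq> closure {x. \<phi> x \<noteq> 0} \<union> closure {x. \<psi> x \<noteq> 0}"
    using closure_subset[of "{x. \<phi> x \<noteq> 0}"] closure_subset[of "{x. \<psi> x \<noteq> 0}"] by (fastforce simp: subset_eq)
qed (use assms in \<open>auto simp: test_functions_def C_k_add simp del: closure_Un\<close>)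

lemma test_functions_mult:
  assumes "\<phi> \<in> test_functions D" "\<And>k. C_k k \<psi>"
  shows "(\<lambda>x. \<psi> x * \<phi> x) \<in> test_functions D"
proof (rule test_functionsI)
  show "{x. \<psi> x * \<phi> x \<noteq> 0} \<subseteq> closure {x. \<phi> x \<noteq> 0}"
    using closure_subset[of "{x. \<phi> x \<noteq> 0}"] by auto
qed (use assms in \<open>auto simp: test_functions_def C_k_mult\<close>)

lemma grad_inner: "b \<in> Basis \<Longrightarrow> grad \<phi> x \<bullet> b = pd b \<phi> x"
  by (simp add: grad_def inner_sum_left_Basis)

lemma grad_add:
  assumes "\<phi> \<in> test_functions D" "\<psi> \<in> test_functions D"
  shows "grad (\<lambda>x. \<phi> x + \<psi> x) = (\<lambda>x. grad \<phi> x + grad \<psi> x)"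
  by (auto simp: grad_def pd_add[OF test_functions_differentiable[OF assms(1)] test_functions_differentiable[OF assms(2)], THEN fun_cong]
      scaleR_left_distrib sum.distrib)

lemma grad_cmult:
  assumes "\<phi> \<in> test_functions D"
  shows "grad (\<lambda>x. c * \<phi> x) = (\<lambda>x. c *\<^sub>R grad \<phi> x)"
  by (auto simp: grad_def pd_mult[OF differentiable_const test_functions_differentiable[OF assms], THEN fun_cong]
      pd_const[THEN fun_cong] scaleR_sum_right)

lemma test_functions_continuous: "\<phi> \<in> test_functions D \<Longrightarrow> continuous_on UNIV \<phi>"
  using test_functions_C_k C_k_continuous by blast

lemma test_functions_measurable: "\<phi> \<in> test_functions D \<Longrightarrow> \<phi> \<in> borel_measurable borel"
  by (simp add: test_functions_continuous borel_measurable_continuous_onI)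

lemma test_functions_bounded:
  assumes "\<phi> \<in> test_functions D"
  obtains B where "B > 0" "\<And>x. \<bar>\<phi> x\<bar> \<le> B"
proof -
  let ?K = "closure {x. \<phi> x \<noteq> 0}"
  have "compact (\<phi> ` ?K)"
    using test_functions_continuous[OF assms] assms
    by (intro compact_continuous_image) (auto simp: test_functions_def intro: continuous_on_subset)
  then obtain B where B: "\<And>x. x \<in> ?K \<Longrightarrow> \<bar>\<phi> x\<bar> \<le> B" "B > 0"
    using compact_imp_bounded bounded_pos by (metis imageI real_norm_def)
  have "\<bar>\<phi> x\<bar> \<le> B" for x
    using B closure_subset[of "{x. \<phi> x \<noteq> 0}"] by (cases "\<phi> x = 0") auto
  then show ?thesis using that B by blast
qed

lemma grad_continuous:
  assumes "\<phi> \<in> test_functions D"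
  shows "continuous_on UNIV (grad \<phi>)"
  unfolding grad_def using test_functions_continuous[OF test_functions_pd[OF assms]]
  by (intro continuous_intros) auto

lemma grad_measurable:
  assumes "\<phi> \<in> test_functions D"
  shows "grad \<phi> \<in> borel_measurable borel"
  using grad_continuous[OF assms] by (simp add: borel_measurable_continuous_onI)

lemma grad_bounded:
  assumes "\<phi> \<in> test_functions D"
  obtains B where "B > 0" "\<And>x. norm (grad \<phi> x) \<le> B"
proof -
  have "\<exists>B. \<forall>x. \<bar>pd b \<phi> x\<bar> \<le> B" if "b \<in> Basis" for b
    using test_functions_bounded[OF test_functions_pd[OF assms that]] by metis
  then obtain B where B: "\<And>b x. b \<in> Basis \<Longrightarrow> \<bar>pd b \<phi> x\<bar> \<le> B b" by metis
  have "norm (grad \<phi> x) \<le> 1 + \<bar>sum B Basis\<bar>" for x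
  proof -
    have "norm (grad \<phi> x) \<le> (\<Sum>b\<in>Basis. B b)"
      unfolding grad_def by (rule sum_norm_le) (use B in auto)
    then show ?thesis by linarith
  qed
  then show ?thesis using that[of "1 + \<bar>sum B Basis\<bar>"] by force
qed

lemma grad_zero_outside: "\<phi> \<in> test_functions D \<Longrightarrow> x \<notin> D \<Longrightarrow> grad \<phi> x = 0"
  by (auto simp: grad_def test_functions_zero_outside[OF test_functions_pd])

lemma has_derivative_along:
  assumes "f differentiable (at (x + t *\<^sub>R b))"
  shows "((\<lambda>t. f (x + t *\<^sub>R b)) has_real_derivative pd b f (x + t *\<^sub>R b)) (at t)"
proof -
  have 1: "((\<lambda>t. x + t *\<^sub>R b) has_derivative (\<lambda>h. h *\<^sub>R b)) (at t)"
    by (auto intro!: derivative_eq_intros)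
  have f: "(f has_derivative (\<lambda>h. pd h f (x + t *\<^sub>R b))) (at (x + t *\<^sub>R b))"
    by (rule has_derivative_frechet[OF assms])
  have "((\<lambda>t. f (x + t *\<^sub>R b)) has_derivative (\<lambda>h. pd (h *\<^sub>R b) f (x + t *\<^sub>R b))) (at t)"
    using has_derivative_compose[OF 1 f] .
  moreover have "pd (h *\<^sub>R b) f (x + t *\<^sub>R b) = pd b f (x + t *\<^sub>R b) * h" for h
    using linear_cmul[OF has_derivative_linear[OF f], of h b] by (simp add: mult.commute)
  ultimately show ?thesis by (simp add: has_field_derivative_def)
qed

text \<open>
  By the mean value theorem, applied first in one direction and then in the other, the second
  difference of \<open>f\<close> over a small parallelogram at \<open>x\<close> is \<open>t\<^sup>2\<close> times the mixed derivative at a nearby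
  point, for either order of differentiation.
\<close>

lemma pd_symmetric:
  assumes f: "\<And>x. f differentiable (at x)" and fb: "\<And>x. pd b f differentiable (at x)" and fc: "\<And>x. pd c f differentiable (at x)"
    and "continuous_on UNIV (pd c (pd b f))" "continuous_on UNIV (pd b (pd c f))"
  shows "pd c (pd b f) x = pd b (pd c f) x"
proof -
  have key: "\<exists>z. norm z \<le> t * (norm b + norm c) \<and>
      f (x + t *\<^sub>R b + t *\<^sub>R c) - f (x + t *\<^sub>R b) - f (x + t *\<^sub>R c) + f x = t * t * pd c (pd b f) (x + z)"
    if f: "\<And>x. f differentiable (at x)" and fb: "\<And>x. pd b f differentiable (at x)" and t: "t > 0"
    for t :: real and f and b c :: 'a
  proof -
    have "\<exists>\<sigma>>0. \<sigma> < t \<and> (\<lambda>s. f (x + t *\<^sub>R c + s *\<^sub>R b) - f (x + s *\<^sub>R b)) t -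
        (\<lambda>s. f (x + t *\<^sub>R c + s *\<^sub>R b) - f (x + s *\<^sub>R b)) 0
       = (t - 0) * (pd b f (x + t *\<^sub>R c + \<sigma> *\<^sub>R b) - pd b f (x + \<sigma> *\<^sub>R b))"
      by (rule MVT2[OF t]) (intro derivative_intros has_derivative_along f)
    then obtain s where s: "0 < s" "s < t"
      and 1: "f (x + t *\<^sub>R c + t *\<^sub>R b) - f (x + t *\<^sub>R b) - (f (x + t *\<^sub>R c) - f x) = t * (pd b f (x + t *\<^sub>R c + s *\<^sub>R b) - pd b f (x + s *\<^sub>R b))"
      by auto
    have "\<exists>\<sigma>>0. \<sigma> < t \<and> (\<lambda>r. pd b f (x + s *\<^sub>R b + r *\<^sub>R c)) t - (\<lambda>r. pd b f (x + s *\<^sub>R b + r *\<^sub>R c)) 0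
       = (t - 0) * pd c (pd b f) (x + s *\<^sub>R b + \<sigma> *\<^sub>R c)"
      by (rule MVT2[OF t]) (intro has_derivative_along fb)
    then obtain r where r: "0 < r" "r < t"
      and 2: "pd b f (x + s *\<^sub>R b + t *\<^sub>R c) - pd b f (x + s *\<^sub>R b) = t * pd c (pd b f) (x + s *\<^sub>R b + r *\<^sub>R c)"
      by auto
    have "norm (s *\<^sub>R b + r *\<^sub>R c) \<le> s * norm b + r * norm c"
      using norm_triangle_ineq[of "s *\<^sub>R b" "r *\<^sub>R c"] s r by simp
    also have "\<dots> \<le> t * (norm b + norm c)"
      using s r by (simp add: distrib_left add_mono mult_right_mono)
    finally show ?thesis using 1 2
      by (intro exI[of _ "s *\<^sub>R b + r *\<^sub>R c"]) (simp add: algebra_simps)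
  qed
  have lim: "(\<lambda>n. g (x + z n)) \<longlonglongrightarrow> g x" if "\<And>n. norm (z n) \<le> (1 / real (Suc n)) * (norm b + norm c)" "continuous_on UNIV g"
    for z and g :: "'a \<Rightarrow> real"
  proof -
    have "(\<lambda>n. (1 / real (Suc n)) * (norm b + norm c)) \<longlonglongrightarrow> 0 * (norm b + norm c)"
      by (intro tendsto_mult tendsto_const LIMSEQ_Suc[OF lim_1_over_n])
    then have "z \<longlonglongrightarrow> 0"
      using Lim_null_comparison[of z "\<lambda>n. (1 / real (Suc n)) * (norm b + norm c)" sequentially] that(1) by auto
    then have "(\<lambda>n. x + z n) \<longlonglongrightarrow> x + 0" by (intro tendsto_intros)
    then show ?thesis using that(2) by (auto simp: continuous_on_eq_continuous_at intro: isCont_tendsto_compose)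
  qed
  define h where "h n = 1 / real (Suc n)" for n
  have h: "h n > 0" for n by (simp add: h_def)
  have "\<forall>n. \<exists>z. norm z \<le> h n * (norm b + norm c) \<and>
      f (x + h n *\<^sub>R b + h n *\<^sub>R c) - f (x + h n *\<^sub>R b) - f (x + h n *\<^sub>R c) + f x = h n * h n * pd c (pd b f) (x + z)"
    by (intro allI key f fb h)
  then obtain z where "\<forall>n. norm (z n) \<le> h n * (norm b + norm c) \<and>
      f (x + h n *\<^sub>R b + h n *\<^sub>R c) - f (x + h n *\<^sub>R b) - f (x + h n *\<^sub>R c) + f x = h n * h n * pd c (pd b f) (x + z n)"
    by (rule choice[THEN exE])
  then have z: "\<And>n. norm (z n) \<le> h n * (norm b + norm c)" and
    z2: "\<And>n. f (x + h n *\<^sub>R b + h n *\<^sub>R c) - f (x + h n *\<^sub>R b) - f (x + h n *\<^sub>R c) + f x = h n * h n * pd c (pd b f) (x + z n)"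
    by blast+
  have "\<forall>n. \<exists>z. norm z \<le> h n * (norm c + norm b) \<and>
      f (x + h n *\<^sub>R c + h n *\<^sub>R b) - f (x + h n *\<^sub>R c) - f (x + h n *\<^sub>R b) + f x = h n * h n * pd b (pd c f) (x + z)"
    by (intro allI key f fc h)
  then obtain w where "\<forall>n. norm (w n) \<le> h n * (norm c + norm b) \<and>
      f (x + h n *\<^sub>R c + h n *\<^sub>R b) - f (x + h n *\<^sub>R c) - f (x + h n *\<^sub>R b) + f x = h n * h n * pd b (pd c f) (x + w n)"
    by (rule choice[THEN exE])
  then have w: "\<And>n. norm (w n) \<le> h n * (norm c + norm b)" and
    w2: "\<And>n. f (x + h n *\<^sub>R c + h n *\<^sub>R b) - f (x + h n *\<^sub>R c) - f (x + h n *\<^sub>R b) + f x = h n * h n * pd b (pd c f) (x + w n)"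
    by blast+
  have "h n * h n * pd c (pd b f) (x + z n) = h n * h n * pd b (pd c f) (x + w n)" for n
    unfolding z2[symmetric] w2[symmetric] by (simp add: algebra_simps)
  then have "pd c (pd b f) (x + z n) = pd b (pd c f) (x + w n)" for n
    using h[of n] by (metis less_irrefl mult_cancel_left mult_pos_pos)
  moreover have "(\<lambda>n. pd c (pd b f) (x + z n)) \<longlonglongrightarrow> pd c (pd b f) x"
    by (rule lim) (use z assms in \<open>auto simp: h_def\<close>)
  moreover have "(\<lambda>n. pd b (pd c f) (x + w n)) \<longlonglongrightarrow> pd b (pd c f) x"
    by (rule lim) (use w assms in \<open>auto simp: h_def add.commute\<close>)
  ultimately show ?thesis using LIMSEQ_unique by auto
qed

lemma test_functions_pd_symmetric:
  assumes "\<phi> \<in> test_functions D" "b \<in> Basis" "c \<in> Basis"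
  shows "pd c (pd b \<phi>) = pd b (pd c \<phi>)"
  by (intro ext pd_symmetric test_functions_differentiable test_functions_continuous)
    (auto intro!: test_functions_pd assms)

lemma test_functions_integrable:
  assumes "\<phi> \<in> test_functions D"
  shows "integrable lborel \<phi>"
proof -
  let ?K = "closure {x. \<phi> x \<noteq> 0}"
  obtain B where B: "B > 0" "\<And>x. \<bar>\<phi> x\<bar> \<le> B" using test_functions_bounded[OF assms] by blast
  have K: "compact ?K" using assms by (auto simp: test_functions_def)
  have "integrable lborel (\<lambda>x. B * indicator ?K x :: real)"
    using emeasure_compact_finite[OF K] compact_imp_closed[OF K]
    by (intro integrable_mult_right integrable_real_indicator) auto
  then show ?thesis
  proof (rule Bochner_Integration.integrable_bound)
    show "\<phi> \<in> borel_measurable lborel" using test_functions_measurable[OF assms] by simp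
    show "AE x in lborel. norm (\<phi> x) \<le> norm (B * indicator ?K x :: real)"
      using B closure_subset[of "{x. \<phi> x \<noteq> 0}"] by (auto intro!: AE_I2 simp: indicator_def)
  qed
qed

text \<open>
  Difference quotients integrate to 0 because Lebesgue measure is translation invariant, and they
  converge dominatedly to the derivative.
\<close>

lemma integral_pd_eq_0:
  assumes "\<phi> \<in> test_functions D" "b \<in> Basis"
  shows "(LINT x|lborel. pd b \<phi> x) = 0"
proof -
  let ?K = "closure {x. \<phi> x \<noteq> 0}"
  \<comment> \<open>a compact set that contains the supports of all difference quotients with step at most 1\<close>
  define K1 where "K1 = (\<lambda>(x,y). x - y) ` (?K \<times> cball 0 1)"
  have "compact ?K" using assms by (auto simp: test_functions_def)
  then have K1: "compact K1" unfolding K1_def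
    by (intro compact_continuous_image compact_Times) (auto simp: case_prod_beta intro!: continuous_intros)
  obtain B where B: "B > 0" "\<And>x. \<bar>pd b \<phi> x\<bar> \<le> B"
    using test_functions_bounded[OF test_functions_pd[OF assms]] by blast
  define h where "h n = 1 / real (Suc n)" for n
  define f where "f n x = (\<phi> (x + h n *\<^sub>R b) - \<phi> x) / h n" for n x
  have h: "h n > 0" "h n \<le> 1" for n by (auto simp: h_def)
  have [measurable]: "\<phi> \<in> borel_measurable borel" "pd b \<phi> \<in> borel_measurable borel"
    using test_functions_measurable assms test_functions_pd by blast+
  have "(\<lambda>n. LINT x|lborel. f n x) \<longlonglongrightarrow> (LINT x|lborel. pd b \<phi> x)"
  proof (rule integral_dominated_convergence[where w="\<lambda>x. B * indicator K1 x"])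
    show "integrable lborel (\<lambda>x. B * indicator K1 x :: real)"
      using emeasure_compact_finite[OF K1] compact_imp_closed[OF K1]
      by (intro integrable_mult_right integrable_real_indicator) auto
    show "AE x in lborel. (\<lambda>n. f n x) \<longlonglongrightarrow> pd b \<phi> x"
    proof (rule AE_I2)
      fix x
      have "((\<lambda>t. \<phi> (x + t *\<^sub>R b)) has_real_derivative pd b \<phi> x) (at 0)"
        using has_derivative_along[of \<phi> x 0 b] test_functions_differentiable[OF assms(1)] by simp
      then have "((\<lambda>t. (\<phi> (x + t *\<^sub>R b) - \<phi> x) / t) \<longlongrightarrow> pd b \<phi> x) (at 0)"
        by (simp add: has_field_derivative_iff)
      moreover have "filterlim h (at 0) sequentially"
        unfolding filterlim_at h_def using LIMSEQ_Suc[OF lim_1_over_n[where ?'a=real]] by auto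
      ultimately show "(\<lambda>n. f n x) \<longlonglongrightarrow> pd b \<phi> x"
        unfolding f_def by (rule filterlim_compose)
    qed
    show "AE x in lborel. norm (f n x) \<le> B * indicator K1 x" for n
    proof (rule AE_I2)
      fix x
      have "\<exists>s>0. s < h n \<and> \<phi> (x + h n *\<^sub>R b) - \<phi> (x + 0 *\<^sub>R b) = (h n - 0) * pd b \<phi> (x + s *\<^sub>R b)"
        by (rule MVT2[OF h(1)]) (intro has_derivative_along test_functions_differentiable[OF assms(1)])
      then obtain s where s: "s > 0" "s < h n" "f n x = pd b \<phi> (x + s *\<^sub>R b)"
        using h[of n] by (auto simp: f_def)
      show "norm (f n x) \<le> B * indicator K1 x"
      proof (cases "pd b \<phi> (x + s *\<^sub>R b) = 0")
        case False
        then have "x + s *\<^sub>R b \<in> ?K" using pd_eq_0_outside_support by blast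
        moreover have "s *\<^sub>R b \<in> cball 0 1" using s h[of n] assms by auto
        ultimately have "x \<in> K1" unfolding K1_def by (auto intro!: image_eqI[of _ _ "(x + s *\<^sub>R b, s *\<^sub>R b)"])
        then show ?thesis using s B by auto
      qed (use s B in \<open>simp add: indicator_def\<close>)
    qed
  qed (auto simp: f_def)
  moreover have "(LINT x|lborel. f n x) = 0" for n
  proof -
    have \<phi>: "integrable lborel \<phi>" by (rule test_functions_integrable[OF assms(1)])
    have "integrable lborel (\<lambda>x. \<phi> (x + h n *\<^sub>R b))" "(LINT x|lborel. \<phi> (x + h n *\<^sub>R b)) = (LINT x|lborel. \<phi> x)"
    proof -
      have d: "distr lborel borel (\<lambda>x. h n *\<^sub>R b + x) = lborel"
        by (rule lborel_distr_plus)
      have "integrable (distr lborel borel (\<lambda>x. h n *\<^sub>R b + x)) \<phi>" unfolding d by (rule \<phi>)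
      then show "integrable lborel (\<lambda>x. \<phi> (x + h n *\<^sub>R b))"
        by (subst (asm) integrable_distr_eq) (auto simp: add.commute)
      have "(LINT x|lborel. \<phi> x) = (LINT x|distr lborel borel (\<lambda>x. h n *\<^sub>R b + x). \<phi> x)" unfolding d ..
      also have "\<dots> = (LINT x|lborel. \<phi> (x + h n *\<^sub>R b))"
        by (subst integral_distr) (auto simp: add.commute)
      finally show "(LINT x|lborel. \<phi> (x + h n *\<^sub>R b)) = (LINT x|lborel. \<phi> x)" ..
    qed
    then show ?thesis unfolding f_def using \<phi> by simp
  qed
  ultimately show ?thesis by (simp add: LIMSEQ_const_iff)
qed

lemma integral_by_parts_test:
  assumes "\<phi> \<in> test_functions D" "\<psi> \<in> test_functions D" "b \<in> Basis"
  shows "(LINT x|lborel. \<phi> x * pd b \<psi> x) = - (LINT x|lborel. pd b \<phi> x * \<psi> x)"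
proof -
  have p: "(\<lambda>x. \<phi> x * \<psi> x) \<in> test_functions D"
    using assms test_functions_mult test_functions_C_k by blast
  have i: "integrable lborel (\<lambda>x. \<phi> x * pd b \<psi> x)" "integrable lborel (\<lambda>x. pd b \<phi> x * \<psi> x)"
    using assms by (auto intro!: test_functions_integrable[OF test_functions_mult, of _ D] intro: test_functions_C_k test_functions_pd)
  have "0 = (LINT x|lborel. pd b (\<lambda>x. \<phi> x * \<psi> x) x)"
    using integral_pd_eq_0[OF p assms(3)] by simp
  also have "\<dots> = (LINT x|lborel. \<phi> x * pd b \<psi> x) + (LINT x|lborel. pd b \<phi> x * \<psi> x)"
    using i pd_mult[OF test_functions_differentiable[OF assms(1)] test_functions_differentiable[OF assms(2)], of b] by simp
  finally show ?thesis by simp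
qed

text \<open>
  Gradients of test functions are weakly curl-free, and this survives passage to \<open>L\<^sup>2\<close> limits.
\<close>

lemma integral_pd_pd_swap:
  assumes "\<phi> \<in> test_functions D" "\<psi> \<in> test_functions D" "b \<in> Basis" "c \<in> Basis"
  shows "(LINT x|lborel. pd b \<phi> x * pd c \<psi> x) = (LINT x|lborel. pd c \<phi> x * pd b \<psi> x)"
proof -
  have "(LINT x|lborel. \<phi> x * pd b (pd c \<psi>) x) = - (LINT x|lborel. pd b \<phi> x * pd c \<psi> x)"
    by (rule integral_by_parts_test[OF assms(1) test_functions_pd[OF assms(2,4)] assms(3)])
  moreover have "(LINT x|lborel. \<phi> x * pd b (pd c \<psi>) x) = - (LINT x|lborel. pd c \<phi> x * pd b \<psi> x)"
    using integral_by_parts_test[OF assms(1) test_functions_pd[OF assms(2,3)] assms(4)]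
    by (simp only: test_functions_pd_symmetric[OF assms(2-4), THEN fun_cong])
  ultimately show ?thesis by linarith
qed

section \<open>Smooth radial bumps\<close>

text \<open>
  The functions \<open>p(1/x) exp(-1/x)\<close>, extended by 0 to \<open>x \<le> 0\<close>. The polynomial factor makes the family closed
  under differentiation, so that smoothness of a single bump becomes an induction over the whole family.
\<close>

definition flat_exp :: "real poly \<Rightarrow> real \<Rightarrow> real" where
  "flat_exp p x = (if x > 0 then poly p (1 / x) * exp (- 1 / x) else 0)"

definition flat_exp_deriv :: "real poly \<Rightarrow> real poly" where
  "flat_exp_deriv p = [:0, 0, 1:] * (p - pderiv p)"

lemma poly_times_exp_tendsto_0: "((\<lambda>y::real. poly p y * exp (- y)) \<longlongrightarrow> 0) at_top"
proof (induction p)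
  case (pCons a p)
  have 1: "((\<lambda>y::real. y ^ k * exp (- y)) \<longlongrightarrow> 0) at_top" for k
    using tendsto_power_div_exp_0[of k] by (simp add: exp_minus divide_inverse)
  have "((\<lambda>y. \<Sum>i\<le>degree (pCons a p). coeff (pCons a p) i * (y ^ i * exp (- y))) \<longlongrightarrow>
      (\<Sum>i\<le>degree (pCons a p). coeff (pCons a p) i * 0)) at_top"
    by (intro tendsto_sum tendsto_mult tendsto_const 1)
  then show ?case by (simp add: poly_altdef sum_distrib_right mult.assoc)
qed simp

lemma flat_exp_has_derivative:
  "(flat_exp p has_real_derivative flat_exp (flat_exp_deriv p) x) (at x)"
proof -
  consider "x > 0" | "x < 0" | "x = 0" by linarith
  then show ?thesis
  proof cases
    case 1
    have "((\<lambda>x. poly p (1 / x) * exp (- 1 / x)) has_real_derivative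
        flat_exp (flat_exp_deriv p) x) (at x)"
      using 1
      by (auto intro!: derivative_eq_intros DERIV_chain'[OF _ poly_DERIV] simp: flat_exp_def flat_exp_deriv_def field_simps power2_eq_square)
    then show ?thesis
      by (rule has_field_derivative_transform_within_open[of _ _ _ "{0<..}"]) (use 1 in \<open>auto simp: flat_exp_def\<close>)
  next
    case 2
    have "((\<lambda>x. 0) has_real_derivative flat_exp (flat_exp_deriv p) x) (at x)"
      using 2 by (auto simp: flat_exp_def)
    then show ?thesis
      by (rule has_field_derivative_transform_within_open[of _ _ _ "{..<0}"]) (use 2 in \<open>auto simp: flat_exp_def\<close>)
  next
    case 3
    have "((\<lambda>y. flat_exp p y / y) \<longlongrightarrow> 0) (at 0)"
    proof (rule filterlim_split_at)
      show "((\<lambda>y. flat_exp p y / y) \<longlongrightarrow> 0) (at_left 0)"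
        by (rule tendsto_eventually) (auto simp: flat_exp_def eventually_at_filter)
      have "((\<lambda>y. poly ([:0,1:] * p) (inverse y) * exp (- inverse y)) \<longlongrightarrow> 0) (at_right (0::real))"
        by (rule filterlim_compose[OF poly_times_exp_tendsto_0 filterlim_inverse_at_top_right])
      then show "((\<lambda>y. flat_exp p y / y) \<longlongrightarrow> 0) (at_right 0)"
        by (rule Lim_transform_eventually) (auto simp: flat_exp_def eventually_at_filter field_simps)
    qed
    then show ?thesis using 3 by (simp add: has_field_derivative_iff flat_exp_def)
  qed
qed

lemma continuous_on_flat_exp [continuous_intros]:
  "continuous_on S f \<Longrightarrow> continuous_on S (\<lambda>x. flat_exp p (f x))"
proof -
  have "continuous_on UNIV (flat_exp p)"
    by (meson DERIV_isCont continuous_at_imp_continuous_on flat_exp_has_derivative)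
  then show "continuous_on S f \<Longrightarrow> continuous_on S (\<lambda>x. flat_exp p (f x))"
    using continuous_on_compose2 by blast
qed

text \<open>
  A smooth bump in the ball of radius \<open>1/s\<close> around \<open>y\<close>.
\<close>

definition radial :: "real poly \<Rightarrow> real \<Rightarrow> 'a::euclidean_space \<Rightarrow> 'a \<Rightarrow> real" where
  "radial p s y x = flat_exp p (1 - s\<^sup>2 * ((x - y) \<bullet> (x - y)))"

lemma radial_has_derivative:
  "(radial p s y has_derivative (\<lambda>h. (- 2 * s\<^sup>2) * ((x - y) \<bullet> h) * radial (flat_exp_deriv p) s y x)) (at x)"
proof -
  have "((\<lambda>x. 1 - s\<^sup>2 * ((x - y) \<bullet> (x - y))) has_derivative (\<lambda>h. - 2 * s\<^sup>2 * ((x - y) \<bullet> h))) (at x)"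
    by (auto intro!: derivative_eq_intros simp: inner_commute algebra_simps)
  from has_derivative_compose[OF this flat_exp_has_derivative[unfolded has_field_derivative_def]]
  show ?thesis unfolding radial_def by (simp add: mult_ac)
qed

lemma pd_radial: "pd b (radial p s y) = (\<lambda>x. (- 2 * s\<^sup>2) * ((x - y) \<bullet> b) * radial (flat_exp_deriv p) s y x)"
  by (intro ext pd_eqI radial_has_derivative)

lemma continuous_on_radial: "continuous_on S (radial p s y)"
  unfolding radial_def by (intro continuous_intros)

lemma C_k_radial: "C_k k (radial p s y)"
proof (induction k arbitrary: p)
  case 0
  show ?case by (simp add: continuous_on_radial)
next
  case (Suc k)
  have "radial p s y differentiable (at x)" for x
    using radial_has_derivative differentiable_def by blast
  moreover have "C_k k (\<lambda>x. (- 2 * s\<^sup>2) * ((x - y) \<bullet> b) * radial (flat_exp_deriv p) s y x)" for b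
    by (intro C_k_mult C_k_const C_k_linear Suc)
  ultimately show ?case by (simp only: C_k.simps pd_radial) simp
qed

lemma radial_eq_0:
  assumes "s > 0" "dist x y \<ge> 1 / s"
  shows "radial p s y x = 0"
proof -
  have "1 \<le> s * dist x y" using assms by (simp add: field_simps)
  then have "1 \<le> (s * dist x y)\<^sup>2" by (simp add: power_mono)
  then show ?thesis by (simp add: radial_def flat_exp_def dist_norm power_mult_distrib power2_norm_eq_inner)
qed

lemma radial_test_function:
  assumes "s > 0" "cball y (1 / s) \<subseteq> D"
  shows "radial p s y \<in> test_functions D"
proof (rule test_functionsI[OF C_k_radial _ _ assms(2)])
  show "{x. radial p s y x \<noteq> 0} \<subseteq> cball y (1 / s)"
    using radial_eq_0[OF assms(1)] by (force simp: dist_commute)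
qed auto

section \<open>Square-integrable fields\<close>

definition L2_space :: "'a measure \<Rightarrow> ('a \<Rightarrow> 'b::euclidean_space) set" where
  "L2_space M = {f \<in> borel_measurable M. integrable M (\<lambda>x. (norm (f x))\<^sup>2)}"

definition L2_norm :: "'a measure \<Rightarrow> ('a \<Rightarrow> 'b::euclidean_space) \<Rightarrow> real" where
  "L2_norm M f = sqrt (LINT x|M. (norm (f x))\<^sup>2)"

lemma L2_norm_nonneg [simp]: "0 \<le> L2_norm M f"
  by (simp add: L2_norm_def)

lemma L2_norm_power2: "(L2_norm M f)\<^sup>2 = (LINT x|M. (norm (f x))\<^sup>2)"
  by (simp add: L2_norm_def)

lemma L2_space_measurable: "f \<in> L2_space M \<Longrightarrow> f \<in> borel_measurable M"
  by (simp add: L2_space_def)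

lemma L2_space_norm_power2: "f \<in> L2_space M \<Longrightarrow> integrable M (\<lambda>x. (norm (f x))\<^sup>2)"
  by (simp add: L2_space_def)

lemma L2_space_bound:
  assumes "f \<in> L2_space M" "g \<in> borel_measurable M" "AE x in M. norm (g x) \<le> C * norm (f x)"
  shows "g \<in> L2_space M"
proof -
  have "integrable M (\<lambda>x. C\<^sup>2 * (norm (f x))\<^sup>2)"
    using assms L2_space_norm_power2 by (intro integrable_mult_right) blast
  then have "integrable M (\<lambda>x. (norm (g x))\<^sup>2)"
  proof (rule Bochner_Integration.integrable_bound)
    show "AE x in M. norm ((norm (g x))\<^sup>2) \<le> norm (C\<^sup>2 * (norm (f x))\<^sup>2)"
      using assms(3)
    proof eventually_elim
      case (elim x)
      then have "(norm (g x))\<^sup>2 \<le> (C * norm (f x))\<^sup>2" by (intro power_mono) auto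
      then show ?case by (simp add: power_mult_distrib)
    qed
  qed (use assms(2) in measurable)
  then show ?thesis using assms(2) by (simp add: L2_space_def)
qed

lemma integrable_norm_mult_norm:
  assumes "f \<in> L2_space M" "g \<in> L2_space M"
  shows "integrable M (\<lambda>x. norm (f x) * norm (g x))"
proof (rule Bochner_Integration.integrable_bound)
  show "integrable M (\<lambda>x. (norm (f x))\<^sup>2 + (norm (g x))\<^sup>2)"
    using assms[THEN L2_space_norm_power2] by (intro Bochner_Integration.integrable_add)
  have [measurable]: "f \<in> borel_measurable M" "g \<in> borel_measurable M"
    using assms L2_space_measurable by auto
  show "(\<lambda>x. norm (f x) * norm (g x)) \<in> borel_measurable M" by measurable
  have "a * b \<le> a\<^sup>2 + b\<^sup>2" if "a \<ge> 0" "b \<ge> 0" for a b :: real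
    using sum_squares_bound[of a b] that mult_nonneg_nonneg[OF that] by linarith
  then show "AE x in M. norm (norm (f x) * norm (g x)) \<le> norm ((norm (f x))\<^sup>2 + (norm (g x))\<^sup>2)"
    by simp
qed

lemma integrable_inner_L2:
  assumes "f \<in> L2_space M" "g \<in> L2_space M"
  shows "integrable M (\<lambda>x. f x \<bullet> g x)"
proof (rule Bochner_Integration.integrable_bound[OF integrable_norm_mult_norm[OF assms]])
  have [measurable]: "f \<in> borel_measurable M" "g \<in> borel_measurable M"
    using assms L2_space_measurable by auto
  show "(\<lambda>x. f x \<bullet> g x) \<in> borel_measurable M" by measurable
qed (auto simp: Cauchy_Schwarz_ineq2)

lemma L2_Cauchy_Schwarz_norm:
  assumes "f \<in> L2_space M" "g \<in> L2_space M"
  shows "(LINT x|M. norm (f x) * norm (g x)) \<le> L2_norm M f * L2_norm M g"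
proof -
  have [measurable]: "f \<in> borel_measurable M" "g \<in> borel_measurable M"
    using assms L2_space_measurable by auto
  let ?C = "LINT x|M. norm (f x) * norm (g x)"
  have "(ennreal ?C)\<^sup>2 = (\<integral>\<^sup>+x. ennreal (norm (f x)) * ennreal (norm (g x)) \<partial>M)\<^sup>2"
    using integrable_norm_mult_norm[OF assms]
    by (simp add: nn_integral_eq_integral ennreal_mult[symmetric])
  also have "\<dots> \<le> (\<integral>\<^sup>+x. (ennreal (norm (f x)))\<^sup>2 \<partial>M) * (\<integral>\<^sup>+x. (ennreal (norm (g x)))\<^sup>2 \<partial>M)"
    by (rule Cauchy_Schwarz_nn_integral) measurable
  also have "\<dots> = ennreal ((L2_norm M f)\<^sup>2) * ennreal ((L2_norm M g)\<^sup>2)"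
    unfolding L2_norm_power2
    using assms[THEN L2_space_norm_power2] by (simp add: nn_integral_eq_integral ennreal_power)
  also have "\<dots> = ennreal ((L2_norm M f * L2_norm M g)\<^sup>2)"
    by (simp add: ennreal_mult power_mult_distrib)
  finally have "?C\<^sup>2 \<le> (L2_norm M f * L2_norm M g)\<^sup>2"
    by (simp add: ennreal_power)
  then show ?thesis by (rule power2_le_imp_le) simp
qed

lemma L2_Cauchy_Schwarz:
  assumes "f \<in> L2_space M" "g \<in> L2_space M"
  shows "\<bar>LINT x|M. f x \<bullet> g x\<bar> \<le> L2_norm M f * L2_norm M g"
proof -
  have "\<bar>LINT x|M. f x \<bullet> g x\<bar> \<le> (LINT x|M. \<bar>f x \<bullet> g x\<bar>)" by (rule integral_abs_bound)
  also have "\<dots> \<le> (LINT x|M. norm (f x) * norm (g x))"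
    using assms by (intro integral_mono integrable_abs integrable_inner_L2 integrable_norm_mult_norm Cauchy_Schwarz_ineq2)
  also have "\<dots> \<le> L2_norm M f * L2_norm M g" by (rule L2_Cauchy_Schwarz_norm[OF assms])
  finally show ?thesis .
qed

lemma L2_space_add:
  assumes "f \<in> L2_space M" "g \<in> L2_space M"
  shows "(\<lambda>x. f x + g x) \<in> L2_space M"
proof -
  have [measurable]: "f \<in> borel_measurable M" "g \<in> borel_measurable M"
    using assms L2_space_measurable by auto
  have "integrable M (\<lambda>x. (norm (f x))\<^sup>2 + 2 * (f x \<bullet> g x) + (norm (g x))\<^sup>2)"
    using assms L2_space_norm_power2 integrable_inner_L2 by (intro Bochner_Integration.integrable_add) auto
  then show ?thesis
    by (simp add: L2_space_def power2_norm_eq_inner inner_add_left inner_add_right inner_commute add_ac)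
qed

lemma L2_space_scaleR:
  assumes "f \<in> L2_space M"
  shows "(\<lambda>x. c *\<^sub>R f x) \<in> L2_space M"
proof (rule L2_space_bound[OF assms, of _ "\<bar>c\<bar>"])
  show "(\<lambda>x. c *\<^sub>R f x) \<in> borel_measurable M"
    using L2_space_measurable[OF assms] by measurable
qed auto

lemma L2_space_diff:
  assumes "f \<in> L2_space M" "g \<in> L2_space M"
  shows "(\<lambda>x. f x - g x) \<in> L2_space M"
  using L2_space_add[OF assms(1) L2_space_scaleR[OF assms(2), of "-1"]] by simp

lemma L2_norm_scaleR: "L2_norm M (\<lambda>x. c *\<^sub>R f x) = \<bar>c\<bar> * L2_norm M f"
  by (simp add: L2_norm_def power_mult_distrib real_sqrt_mult)

lemma L2_norm_expand:
  assumes "f \<in> L2_space M" "g \<in> L2_space M"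
  shows "(L2_norm M (\<lambda>x. f x + t *\<^sub>R g x))\<^sup>2 = (L2_norm M f)\<^sup>2 + 2 * t * (LINT x|M. f x \<bullet> g x) + t\<^sup>2 * (L2_norm M g)\<^sup>2"
proof -
  have "(norm (f x + t *\<^sub>R g x))\<^sup>2 = (norm (f x))\<^sup>2 + 2 * t * (f x \<bullet> g x) + t\<^sup>2 * (norm (g x))\<^sup>2" for x
    unfolding power2_norm_eq_inner by (simp add: inner_add_left inner_add_right inner_commute power2_eq_square)
  then show ?thesis unfolding L2_norm_power2
    using assms[THEN L2_space_norm_power2] integrable_inner_L2[OF assms] by simp
qed

lemma L2_norm_triangle:
  assumes "f \<in> L2_space M" "g \<in> L2_space M"
  shows "L2_norm M (\<lambda>x. f x + g x) \<le> L2_norm M f + L2_norm M g"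
proof (rule power2_le_imp_le)
  show "(L2_norm M (\<lambda>x. f x + g x))\<^sup>2 \<le> (L2_norm M f + L2_norm M g)\<^sup>2"
    using L2_norm_expand[OF assms, of 1] L2_Cauchy_Schwarz[OF assms] by (simp add: power2_sum)
qed simp

lemma L2_norm_triangle_diff:
  assumes "f \<in> L2_space M" "g \<in> L2_space M"
  shows "L2_norm M (\<lambda>x. f x - g x) \<le> L2_norm M f + L2_norm M g"
  using L2_norm_triangle[OF assms(1) L2_space_scaleR[OF assms(2), of "-1"]] L2_norm_scaleR[of M "-1" g] by simp

lemma L2_norm_mono:
  assumes "g \<in> L2_space M" "f \<in> borel_measurable M" "AE x in M. norm (f x) \<le> norm (g x)"
  shows "L2_norm M f \<le> L2_norm M g"
proof -
  have "f \<in> L2_space M" using L2_space_bound[OF assms(1,2), of 1] assms(3) by simp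
  moreover have "AE x in M. (norm (f x))\<^sup>2 \<le> (norm (g x))\<^sup>2"
    using assms(3) by eventually_elim (simp add: power_mono)
  ultimately show ?thesis unfolding L2_norm_def using assms(1)[THEN L2_space_norm_power2]
    by (intro real_sqrt_le_mono integral_mono_AE) (auto intro: L2_space_norm_power2)
qed

context finite_measure
begin

lemma L2_space_const: "(\<lambda>x. c) \<in> L2_space M"
  by (simp add: L2_space_def)

lemma L2_space_bounded:
  assumes "f \<in> borel_measurable M" "\<And>x. x \<in> space M \<Longrightarrow> norm (f x) \<le> B"
  shows "f \<in> L2_space M"
  by (rule L2_space_bound[OF L2_space_const[of "1::real"] assms(1), of B]) (use assms(2) in \<open>auto intro!: AE_I2\<close>)

lemma L2_norm_const: "L2_norm M (\<lambda>x. c) = norm c * sqrt (measure M (space M))"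
  by (simp add: L2_norm_def real_sqrt_mult)

lemma L2_norm_bounded:
  assumes "f \<in> borel_measurable M" "AE x in M. norm (f x) \<le> B" "B \<ge> 0"
  shows "L2_norm M f \<le> B * sqrt (measure M (space M))"
proof -
  have "L2_norm M f \<le> L2_norm M (\<lambda>x. B)"
    using assms by (intro L2_norm_mono L2_space_const) auto
  then show ?thesis using assms by (simp add: L2_norm_const)
qed

lemma L2_space_integrable:
  assumes "f \<in> L2_space M"
  shows "integrable M f" "(LINT x|M. norm (f x)) \<le> sqrt (measure M (space M)) * L2_norm M f"
proof -
  have 1: "integrable M (\<lambda>x. norm (f x))"
    using integrable_norm_mult_norm[OF assms L2_space_const[of "1::real"]] by simp
  then show "integrable M f"
    using assms L2_space_measurable by (subst (asm) integrable_norm_iff) auto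
  show "(LINT x|M. norm (f x)) \<le> sqrt (measure M (space M)) * L2_norm M f"
    using L2_Cauchy_Schwarz_norm[OF assms L2_space_const[of "1::real"]] L2_norm_const[of "1::real"]
    by (simp add: mult.commute)
qed

text \<open>
  On a finite measure space the increments are summable in \<open>L\<^sup>1\<close>, hence the sequence converges almost
  everywhere; Fatou's lemma, applied to \<open>f (n + k) - f n\<close> as \<open>k\<close> grows, shows that this limit is also the
  limit in \<open>L\<^sup>2\<close>.
\<close>

lemma Riesz_Fischer:
  fixes f :: "nat \<Rightarrow> 'a \<Rightarrow> 'b::euclidean_space"
  assumes f: "\<And>n. f n \<in> L2_space M"
    and cauchy: "\<And>n. L2_norm M (\<lambda>x. f (Suc n) x - f n x) \<le> (1/2) ^ n"
  obtains g where "g \<in> L2_space M" "(\<lambda>n. L2_norm M (\<lambda>x. f n x - g x)) \<longlonglongrightarrow> 0"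
proof -
  have [measurable]: "f n \<in> borel_measurable M" for n using f L2_space_measurable by blast
  let ?V = "sqrt (measure M (space M))"
  define d where "d n x = f (Suc n) x - f n x" for n x
  have d: "d n \<in> L2_space M" for n
    unfolding d_def by (intro L2_space_diff f)
  have [measurable]: "d n \<in> borel_measurable M" for n using d L2_space_measurable by blast
  have "(\<integral>\<^sup>+x. (\<Sum>n. ennreal (norm (d n x))) \<partial>M) = (\<Sum>n. \<integral>\<^sup>+x. ennreal (norm (d n x)) \<partial>M)"
    by (rule nn_integral_suminf) measurable
  also have "\<dots> \<le> (\<Sum>n. ennreal (?V * (1/2) ^ n))"
  proof (rule suminf_le)
    fix n
    have "(LINT x|M. norm (d n x)) \<le> ?V * (1/2) ^ n"
      using L2_space_integrable(2)[OF d, of n] mult_left_mono[OF cauchy[of n], of ?V]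
      unfolding d_def by simp
    then show "(\<integral>\<^sup>+x. ennreal (norm (d n x)) \<partial>M) \<le> ennreal (?V * (1/2) ^ n)"
      using L2_space_integrable(1)[OF d, of n] by (simp add: nn_integral_eq_integral ennreal_leI)
  qed auto
  also have "\<dots> = ennreal (\<Sum>n. ?V * (1/2) ^ n)"
    by (intro suminf_ennreal2 summable_mult summable_geometric) auto
  also have "\<dots> < \<infinity>" by simp
  finally have "(\<integral>\<^sup>+x. (\<Sum>n. ennreal (norm (d n x))) \<partial>M) \<noteq> \<infinity>" by simp
  then have "AE x in M. (\<Sum>n. ennreal (norm (d n x))) \<noteq> \<infinity>"
    by (intro nn_integral_PInf_AE) measurable
  then have conv: "AE x in M. convergent (\<lambda>n. f n x)"
  proof eventually_elim
    case (elim x)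
    then have "summable (\<lambda>n. norm (d n x))"
      by (intro summable_suminf_not_top) auto
    then have "summable (\<lambda>n. d n x)" by (rule summable_norm_cancel)
    then have "convergent (\<lambda>n. (\<Sum>i<n. d i x) + f 0 x)"
      by (intro convergent_add convergent_const) (simp add: summable_iff_convergent)
    then show ?case unfolding d_def sum_lessThan_telescope[of "\<lambda>i. f i x"] by simp
  qed
  define g where "g x = lim (\<lambda>n. f n x)" for x
  have [measurable]: "g \<in> borel_measurable M" unfolding g_def by measurable
  have lim: "AE x in M. (\<lambda>n. f n x) \<longlonglongrightarrow> g x"
    using conv by eventually_elim (simp add: g_def convergent_LIMSEQ_iff)
  have tel: "L2_norm M (\<lambda>x. f (n + k) x - f n x) \<le> 2 * (1/2)^n * (1 - (1/2)^k)" for n k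
  proof (induction k)
    case (Suc k)
    have "L2_norm M (\<lambda>x. f (n + Suc k) x - f n x) = L2_norm M (\<lambda>x. (f (n + k) x - f n x) + (f (Suc (n + k)) x - f (n + k) x))"
      by simp
    also have "\<dots> \<le> L2_norm M (\<lambda>x. f (n + k) x - f n x) + L2_norm M (\<lambda>x. f (Suc (n + k)) x - f (n + k) x)"
      by (intro L2_norm_triangle L2_space_diff f)
    also have "\<dots> \<le> 2 * (1/2)^n * (1 - (1/2)^k) + (1/2)^(n + k)"
      by (intro add_mono Suc cauchy)
    also have "\<dots> = 2 * (1/2)^n * (1 - (1/2)^Suc k)"
      by (simp add: power_add algebra_simps)
    finally show ?case .
  qed (simp add: L2_norm_def)
  have bound: "(\<integral>\<^sup>+x. ennreal ((norm (f n x - g x))\<^sup>2) \<partial>M) \<le> ennreal ((2 * (1/2)^n)\<^sup>2)" for n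
  proof -
    have "(\<integral>\<^sup>+x. ennreal ((norm (f n x - g x))\<^sup>2) \<partial>M) = (\<integral>\<^sup>+x. liminf (\<lambda>k. ennreal ((norm (f (n + k) x - f n x))\<^sup>2)) \<partial>M)"
    proof (rule nn_integral_cong_AE)
      show "AE x in M. ennreal ((norm (f n x - g x))\<^sup>2) = liminf (\<lambda>k. ennreal ((norm (f (n + k) x - f n x))\<^sup>2))"
        using lim
      proof eventually_elim
        case (elim x)
        then have "(\<lambda>k. f (n + k) x) \<longlonglongrightarrow> g x"
          using LIMSEQ_ignore_initial_segment[of "\<lambda>n. f n x" "g x" n] by (simp add: add.commute)
        then have "(\<lambda>k. ennreal ((norm (f (n + k) x - f n x))\<^sup>2)) \<longlonglongrightarrow> ennreal ((norm (g x - f n x))\<^sup>2)"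
          by (intro tendsto_intros)
        from lim_imp_Liminf[OF _ this] show ?case by (simp add: norm_minus_commute)
      qed
    qed
    also have "\<dots> \<le> liminf (\<lambda>k. \<integral>\<^sup>+x. ennreal ((norm (f (n + k) x - f n x))\<^sup>2) \<partial>M)"
      by (rule nn_integral_liminf) measurable
    also have "\<dots> \<le> liminf (\<lambda>k. ennreal ((2 * (1/2)^n)\<^sup>2))"
    proof (rule Liminf_mono, rule always_eventually, rule allI)
      fix k
      have "(\<integral>\<^sup>+x. ennreal ((norm (f (n + k) x - f n x))\<^sup>2) \<partial>M) = ennreal ((L2_norm M (\<lambda>x. f (n + k) x - f n x))\<^sup>2)"
        unfolding L2_norm_power2
        by (intro nn_integral_eq_integral L2_space_norm_power2 L2_space_diff f) auto
      also have "\<dots> \<le> ennreal ((2 * (1/2)^n)\<^sup>2)"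
      proof (intro ennreal_leI power_mono)
        have "2 * (1/2)^n * (1 - (1/2)^k) \<le> 2 * (1/2)^n * (1::real)"
          by (intro mult_left_mono) auto
        then show "L2_norm M (\<lambda>x. f (n + k) x - f n x) \<le> 2 * (1/2)^n" using tel[of n k] by linarith
      qed simp
      finally show "(\<integral>\<^sup>+x. ennreal ((norm (f (n + k) x - f n x))\<^sup>2) \<partial>M) \<le> ennreal ((2 * (1/2)^n)\<^sup>2)" .
    qed
    also have "\<dots> = ennreal ((2 * (1/2)^n)\<^sup>2)" by (simp add: Liminf_const)
    finally show ?thesis .
  qed
  have sq: "(\<lambda>x. f n x - g x) \<in> L2_space M" for n
  proof -
    have "integrable M (\<lambda>x. (norm (f n x - g x))\<^sup>2)"
      using bound[of n] by (intro integrableI_nonneg) (auto simp: order_le_less_trans)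
    then show ?thesis by (simp add: L2_space_def)
  qed
  have le: "L2_norm M (\<lambda>x. f n x - g x) \<le> 2 * (1/2)^n" for n
  proof (rule power2_le_imp_le)
    have "ennreal ((L2_norm M (\<lambda>x. f n x - g x))\<^sup>2) = (\<integral>\<^sup>+x. ennreal ((norm (f n x - g x))\<^sup>2) \<partial>M)"
      unfolding L2_norm_power2
      by (intro nn_integral_eq_integral[symmetric] L2_space_norm_power2 sq) auto
    then have "ennreal ((L2_norm M (\<lambda>x. f n x - g x))\<^sup>2) \<le> ennreal ((2 * (1/2)^n)\<^sup>2)" using bound by simp
    then show "(L2_norm M (\<lambda>x. f n x - g x))\<^sup>2 \<le> (2 * (1/2)^n)\<^sup>2" by (subst (asm) ennreal_le_iff) auto
  qed simp
  show ?thesis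
  proof (rule that)
    show "g \<in> L2_space M" using L2_space_diff[OF f[of 0] sq[of 0]] by simp
    have "(\<lambda>n. 2 * (1/2::real)^n) \<longlonglongrightarrow> 2 * 0" by (intro tendsto_mult tendsto_const LIMSEQ_realpow_zero) auto
    then have "(\<lambda>n. 2 * (1/2::real)^n) \<longlonglongrightarrow> 0" by simp
    then show "(\<lambda>n. L2_norm M (\<lambda>x. f n x - g x)) \<longlonglongrightarrow> 0"
      by (rule Lim_null_comparison[rotated]) (auto simp: le)
  qed
qed

lemma L2_tendsto_inner:
  assumes "\<And>n. v n \<in> L2_space M" "p \<in> L2_space M" "g \<in> L2_space M"
    and "(\<lambda>n. L2_norm M (\<lambda>x. v n x - p x)) \<longlonglongrightarrow> 0"
  shows "(\<lambda>n. LINT x|M. v n x \<bullet> g x) \<longlonglongrightarrow> (LINT x|M. p x \<bullet> g x)"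
proof -
  have "(\<lambda>n. (LINT x|M. v n x \<bullet> g x) - (LINT x|M. p x \<bullet> g x)) \<longlonglongrightarrow> 0"
  proof (rule Lim_null_comparison)
    show "\<forall>\<^sub>F n in sequentially. norm ((LINT x|M. v n x \<bullet> g x) - (LINT x|M. p x \<bullet> g x)) \<le> L2_norm M (\<lambda>x. v n x - p x) * L2_norm M g"
    proof (rule always_eventually, rule allI)
      fix n
      have "(LINT x|M. v n x \<bullet> g x) - (LINT x|M. p x \<bullet> g x) = (LINT x|M. (v n x - p x) \<bullet> g x)"
        using assms by (simp add: inner_diff_left integrable_inner_L2)
      then show "norm ((LINT x|M. v n x \<bullet> g x) - (LINT x|M. p x \<bullet> g x)) \<le> L2_norm M (\<lambda>x. v n x - p x) * L2_norm M g"
        using L2_Cauchy_Schwarz[OF L2_space_diff[OF assms(1,2)] assms(3)] by simp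
    qed
    show "(\<lambda>n. L2_norm M (\<lambda>x. v n x - p x) * L2_norm M g) \<longlonglongrightarrow> 0"
      using tendsto_mult_left_zero[OF assms(4)] .
  qed
  then show ?thesis by (simp add: LIM_zero_iff)
qed

text \<open>
  Orthogonal projection onto the closure of a linear space \<open>V\<close>. Since \<open>V\<close> need not be closed, the
  projection is delivered together with a sequence in \<open>V\<close> that converges to it. By the parallelogram
  law a minimising sequence of the distance from \<open>f\<close> to \<open>V\<close> is a Cauchy sequence.
\<close>

lemma L2_projection:
  fixes f :: "'a \<Rightarrow> 'b::euclidean_space"
  assumes f: "f \<in> L2_space M"
    and V: "V \<subseteq> L2_space M" "V \<noteq> {}"
    and add: "\<And>v w. v \<in> V \<Longrightarrow> w \<in> V \<Longrightarrow> (\<lambda>x. v x + w x) \<in> V"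
    and scale: "\<And>c v. v \<in> V \<Longrightarrow> (\<lambda>x. c *\<^sub>R v x) \<in> V"
  obtains p v where "p \<in> L2_space M" "\<And>n. v n \<in> V" "(\<lambda>n. L2_norm M (\<lambda>x. v n x - p x)) \<longlonglongrightarrow> 0"
    "\<And>w. w \<in> V \<Longrightarrow> (LINT x|M. (f x - p x) \<bullet> w x) = 0"
proof -
  define m where "m = (INF v\<in>V. (L2_norm M (\<lambda>x. f x - v x))\<^sup>2)"
  have bdd: "bdd_below ((\<lambda>v. (L2_norm M (\<lambda>x. f x - v x))\<^sup>2) ` V)" by (rule bdd_belowI[of _ 0]) auto
  have m_le: "m \<le> (L2_norm M (\<lambda>x. f x - v x))\<^sup>2" if "v \<in> V" for v
    unfolding m_def using bdd that by (rule cINF_lower)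
  \<comment> \<open>with this error the parallelogram law gives increments of norm at most \<open>(1/2)\<^sup>n\<close>\<close>
  define \<epsilon> where "\<epsilon> n = (1/4)^n / (4::real)" for n :: nat
  have "\<exists>v\<in>V. (L2_norm M (\<lambda>x. f x - v x))\<^sup>2 < m + \<epsilon> n" for n
  proof -
    have "m < m + \<epsilon> n" by (simp add: \<epsilon>_def)
    then show ?thesis unfolding m_def using cINF_less_iff[OF V(2) bdd] by blast
  qed
  then obtain v where v: "\<And>n. v n \<in> V" "\<And>n. (L2_norm M (\<lambda>x. f x - v n x))\<^sup>2 < m + \<epsilon> n" by metis
  have vs: "v n \<in> L2_space M" for n using v V by blast
  have "L2_norm M (\<lambda>x. v (Suc n) x - v n x) \<le> (1/2)^n" for n
  proof (rule power2_le_imp_le)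
    define A where "A x = f x - v (Suc n) x" for x
    define B where "B x = f x - v n x" for x
    have AB: "A \<in> L2_space M" "B \<in> L2_space M"
      unfolding A_def B_def by (intro L2_space_diff f vs)+
    have "(\<lambda>x. (1/2) *\<^sub>R (v n x + v (Suc n) x)) \<in> V" by (intro scale add v)
    from m_le[OF this] have "m \<le> (L2_norm M (\<lambda>x. (1/2) *\<^sub>R (A x + 1 *\<^sub>R B x)))\<^sup>2"
    proof -
      have "(\<lambda>x. (1/2) *\<^sub>R (A x + 1 *\<^sub>R B x)) = (\<lambda>x. f x - (1/2) *\<^sub>R (v n x + v (Suc n) x))"
        unfolding A_def B_def by (auto simp: fun_eq_iff algebra_simps simp flip: scaleR_add_left)
      then show ?thesis using \<open>m \<le> (L2_norm M (\<lambda>x. f x - (1/2) *\<^sub>R (v n x + v (Suc n) x)))\<^sup>2\<close> by simp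
    qed
    also have "\<dots> = (1/4) * (L2_norm M (\<lambda>x. A x + 1 *\<^sub>R B x))\<^sup>2"
      unfolding L2_norm_scaleR by (simp add: power_mult_distrib power2_eq_square)
    also have "(L2_norm M (\<lambda>x. A x + 1 *\<^sub>R B x))\<^sup>2 = 2 * (L2_norm M A)\<^sup>2 + 2 * (L2_norm M B)\<^sup>2 - (L2_norm M (\<lambda>x. B x + (-1) *\<^sub>R A x))\<^sup>2"
      unfolding L2_norm_expand[OF AB] L2_norm_expand[OF AB(2,1)] by (simp add: inner_commute)
    finally have "(L2_norm M (\<lambda>x. B x + (-1) *\<^sub>R A x))\<^sup>2 \<le> 2 * (m + \<epsilon> (Suc n)) + 2 * (m + \<epsilon> n) - 4 * m"
      using v(2)[of n, folded B_def] v(2)[of "Suc n", folded A_def] by argo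
    also have "\<dots> \<le> ((1/2)^n)\<^sup>2"
      by (simp add: \<epsilon>_def power_even_eq[symmetric] power_mult power2_eq_square flip: power_mult_distrib)
    finally show "(L2_norm M (\<lambda>x. v (Suc n) x - v n x))\<^sup>2 \<le> ((1/2)^n)\<^sup>2"
      by (simp add: A_def B_def)
  qed simp
  from Riesz_Fischer[OF vs this] obtain p where p: "p \<in> L2_space M" "(\<lambda>n. L2_norm M (\<lambda>x. v n x - p x)) \<longlonglongrightarrow> 0"
    by blast
  have "(LINT x|M. (f x - p x) \<bullet> w x) = 0" if w: "w \<in> V" for w
  proof -
    have ws: "w \<in> L2_space M" using w V by blast
    let ?B = "(L2_norm M w)\<^sup>2"
    define I where "I = (LINT x|M. (f x - p x) \<bullet> w x)"
    have I: "I = (LINT x|M. f x \<bullet> w x) - (LINT x|M. p x \<bullet> w x)"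
      unfolding I_def using f p ws by (simp add: inner_diff_left integrable_inner_L2)
    have lim: "(\<lambda>n. (LINT x|M. f x \<bullet> w x) - (LINT x|M. v n x \<bullet> w x)) \<longlonglongrightarrow> I"
      unfolding I by (intro tendsto_diff tendsto_const L2_tendsto_inner vs p ws)
    have \<epsilon>0: "\<epsilon> \<longlonglongrightarrow> 0"
      unfolding \<epsilon>_def using tendsto_divide[OF LIMSEQ_realpow_zero[of "1/4"] tendsto_const[of 4]] by simp
    have key: "- 2 * t * I \<le> t\<^sup>2 * ?B" for t
    proof -
      have "- 2 * t * ((LINT x|M. f x \<bullet> w x) - (LINT x|M. v n x \<bullet> w x)) \<le> \<epsilon> n + t\<^sup>2 * ?B" for n
      proof -
        have "(\<lambda>x. v n x + (-t) *\<^sub>R w x) \<in> V" by (intro scale add v w)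
        from m_le[OF this] have "m \<le> (L2_norm M (\<lambda>x. (f x - v n x) + t *\<^sub>R w x))\<^sup>2"
          by (simp add: algebra_simps)
        also have "\<dots> = (L2_norm M (\<lambda>x. f x - v n x))\<^sup>2 + 2 * t * (LINT x|M. (f x - v n x) \<bullet> w x) + t\<^sup>2 * ?B"
          by (intro L2_norm_expand L2_space_diff f vs ws)
        also have "(LINT x|M. (f x - v n x) \<bullet> w x) = (LINT x|M. f x \<bullet> w x) - (LINT x|M. v n x \<bullet> w x)"
          using f vs ws by (simp add: inner_diff_left integrable_inner_L2)
        finally show ?thesis using v(2)[of n] by linarith
      qed
      then have "- 2 * t * I \<le> 0 + t\<^sup>2 * ?B"
        by (intro LIMSEQ_le[OF tendsto_mult[OF tendsto_const lim] tendsto_add[OF \<epsilon>0 tendsto_const]]) auto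
      then show ?thesis by simp
    qed
    have "I = 0"
    proof (rule ccontr)
      assume "I \<noteq> 0"
      \<comment> \<open>close to the minimiser \<open>- I / ?B\<close> of \<open>2 t I + t\<^sup>2 ?B\<close>, but safe when \<open>?B = 0\<close>\<close>
      let ?t = "- I / (?B + 1)"
      have B1: "?B + 1 > 0" by (simp add: add_nonneg_pos)
      have "2 * I\<^sup>2 / (?B + 1) \<le> I\<^sup>2 * ?B / (?B + 1)\<^sup>2"
        using key[of ?t] by (simp add: power2_eq_square power_divide)
      then have "2 * I\<^sup>2 * (?B + 1) \<le> I\<^sup>2 * ?B"
        using B1 by (simp add: divide_simps power2_eq_square split: if_splits)
      then have "I\<^sup>2 * (?B + 2) \<le> 0" by (simp add: algebra_simps)
      moreover have "I\<^sup>2 * (?B + 2) > 0" using \<open>I \<noteq> 0\<close> by (intro mult_pos_pos) (auto simp: add_nonneg_pos)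
      ultimately show False by simp
    qed
    then show ?thesis by (simp add: I_def)
  qed
  then show ?thesis using that p v by blast
qed

end

section \<open>Integrals over Borel sets\<close>

abbreviation borel_on :: "'a::euclidean_space set \<Rightarrow> 'a measure" where
  "borel_on D \<equiv> restrict_space lborel D"

lemma borel_on_measurable: "f \<in> borel_measurable borel \<Longrightarrow> f \<in> borel_measurable (borel_on D)"
  by (intro measurable_restrict_space1) simp

lemma finite_measure_borel_on:
  assumes "bounded D" "D \<in> sets borel"
  shows "finite_measure (borel_on D)"
proof (rule finite_measureI)
  have "emeasure lborel D < \<infinity>" using assms emeasure_bounded_finite by blast
  then show "emeasure (borel_on D) (space (borel_on D)) \<noteq> \<infinity>"
    using assms by (simp add: emeasure_restrict_space)
qed

lemma integral_borel_on:
  fixes f :: "'a::euclidean_space \<Rightarrow> 'b::euclidean_space"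
  assumes "D \<in> sets borel"
  shows "(LINT x|borel_on D. f x) = (LINT x|lborel. indicator D x *\<^sub>R f x)"
  using assms by (simp add: integral_restrict_space)

lemma integrable_borel_on:
  fixes f :: "'a::euclidean_space \<Rightarrow> 'b::euclidean_space"
  assumes "D \<in> sets borel"
  shows "integrable (borel_on D) f \<longleftrightarrow> integrable lborel (\<lambda>x. indicator D x *\<^sub>R f x)"
  using assms by (simp add: integrable_restrict_space)

lemma integrable_borel_on_subset:
  fixes f :: "'a::euclidean_space \<Rightarrow> 'b::euclidean_space"
  assumes "integrable (borel_on E) f" "D \<in> sets borel" "E \<in> sets borel" "D \<subseteq> E"
  shows "integrable (borel_on D) f"
proof -
  have "integrable lborel (\<lambda>x. indicator D x *\<^sub>R (indicator E x *\<^sub>R f x))"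
    by (rule integrable_mult_indicator[OF _ assms(1)[unfolded integrable_borel_on[OF assms(3)]]]) (use assms(2) in simp)
  moreover have "(\<lambda>x. indicator D x *\<^sub>R (indicator E x *\<^sub>R f x)) = (\<lambda>x. indicator D x *\<^sub>R f x)"
    using assms(4) by (auto simp: indicator_def fun_eq_iff)
  ultimately show ?thesis unfolding integrable_borel_on[OF assms(2)] by simp
qed

lemma integral_borel_on_subset:
  fixes f :: "'a::euclidean_space \<Rightarrow> 'b::euclidean_space"
  assumes "D \<in> sets borel" "E \<in> sets borel" "D \<subseteq> E" "\<And>x. x \<in> E - D \<Longrightarrow> f x = 0"
  shows "(LINT x|borel_on D. f x) = (LINT x|borel_on E. f x)"
  unfolding integral_borel_on[OF assms(1)] integral_borel_on[OF assms(2)]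
  using assms by (intro Bochner_Integration.integral_cong refl) (auto simp: indicator_def)

lemma integral_borel_on_UNIV:
  fixes f :: "'a::euclidean_space \<Rightarrow> 'b::euclidean_space"
  assumes "D \<in> sets borel" "\<And>x. x \<notin> D \<Longrightarrow> f x = 0"
  shows "(LINT x|borel_on D. f x) = (LINT x|lborel. f x)"
  unfolding integral_borel_on[OF assms(1)]
  using assms by (intro Bochner_Integration.integral_cong refl) (auto simp: indicator_def)

lemma integrable_mult_bounded:
  fixes f g :: "'a \<Rightarrow> real"
  assumes "integrable M f" "g \<in> borel_measurable M" "\<And>x. x \<in> space M \<Longrightarrow> \<bar>g x\<bar> \<le> B"
  shows "integrable M (\<lambda>x. f x * g x)"
proof (rule Bochner_Integration.integrable_bound)
  show "integrable M (\<lambda>x. B * f x)" using assms by simp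
  have [measurable]: "f \<in> borel_measurable M" "g \<in> borel_measurable M" using assms by auto
  show "(\<lambda>x. f x * g x) \<in> borel_measurable M" by measurable
  show "AE x in M. norm (f x * g x) \<le> norm (B * f x)"
  proof (rule AE_I2)
    fix x assume "x \<in> space M"
    then have "\<bar>f x\<bar> * \<bar>g x\<bar> \<le> \<bar>f x\<bar> * \<bar>B\<bar>" using assms(3)[of x] by (intro mult_left_mono) auto
    then show "norm (f x * g x) \<le> norm (B * f x)" by (simp add: abs_mult mult.commute)
  qed
qed

text \<open>
  By the mean value theorem the difference quotients of \<open>k\<close> inherit the bound \<open>K\<close> of the derivative, so
  dominated convergence applies.
\<close>

lemma integral_has_derivative_dominated:
  fixes f :: "'a \<Rightarrow> real" and k k' :: "real \<Rightarrow> 'a \<Rightarrow> real"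
  assumes f: "integrable M f"
    and deriv: "\<And>x t. x \<in> space M \<Longrightarrow> t \<in> {a<..<b} \<Longrightarrow> ((\<lambda>t. k t x) has_real_derivative k' t x) (at t)"
    and bound: "\<And>x t. x \<in> space M \<Longrightarrow> t \<in> {a<..<b} \<Longrightarrow> \<bar>k' t x\<bar> \<le> K"
    and k: "\<And>t. t \<in> {a<..<b} \<Longrightarrow> k t \<in> borel_measurable M"
    and k': "\<And>t. t \<in> {a<..<b} \<Longrightarrow> k' t \<in> borel_measurable M"
    and int: "\<And>t. t \<in> {a<..<b} \<Longrightarrow> integrable M (\<lambda>x. f x * k t x)"
    and t: "t \<in> {a<..<b}"
  shows "((\<lambda>t. LINT x|M. f x * k t x) has_real_derivative (LINT x|M. f x * k' t x)) (at t)"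
  unfolding has_field_derivative_iff tendsto_at_iff_sequentially
proof (intro allI impI)
  fix X :: "nat \<Rightarrow> real" assume X: "\<forall>i. X i \<in> UNIV - {t}" "X \<longlonglongrightarrow> t"
  have "\<forall>\<^sub>F n in sequentially. X n \<in> {a<..<b}"
    using X(2) t by (intro topological_tendstoD) auto
  then obtain N where N: "\<And>n. n \<ge> N \<Longrightarrow> X n \<in> {a<..<b}" by (auto simp: eventually_sequentially)
  define Y where "Y n = X (n + N)" for n
  have Y: "Y n \<in> {a<..<b}" "Y n \<noteq> t" for n using N[of "n + N"] X(1) by (auto simp: Y_def)
  have Yt: "Y \<longlonglongrightarrow> t" unfolding Y_def using X(2) by (rule LIMSEQ_ignore_initial_segment)
  let ?q = "\<lambda>n x. f x * ((k (Y n) x - k t x) / (Y n - t))"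
  have [measurable]: "f \<in> borel_measurable M" "k (Y n) \<in> borel_measurable M" "k t \<in> borel_measurable M" "k' t \<in> borel_measurable M" for n
    using f k k' Y t by auto
  have "(\<lambda>n. LINT x|M. ?q n x) \<longlonglongrightarrow> (LINT x|M. f x * k' t x)"
  proof (rule integral_dominated_convergence[where w="\<lambda>x. K * norm (f x)"])
    show "integrable M (\<lambda>x. K * norm (f x))" using f by simp
    show "AE x in M. (\<lambda>n. ?q n x) \<longlonglongrightarrow> f x * k' t x"
    proof (intro AE_I2 tendsto_mult tendsto_const)
      fix x assume "x \<in> space M"
      from deriv[OF this t] have "((\<lambda>s. (k s x - k t x) / (s - t)) \<longlongrightarrow> k' t x) (at t)"
        by (simp add: has_field_derivative_iff)
      moreover have "filterlim Y (at t) sequentially"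
        using Yt Y(2) by (auto simp: filterlim_at)
      ultimately show "(\<lambda>n. (k (Y n) x - k t x) / (Y n - t)) \<longlonglongrightarrow> k' t x"
        by (rule filterlim_compose)
    qed
    show "AE x in M. norm (?q n x) \<le> K * norm (f x)" for n
    proof (rule AE_I2)
      fix x assume x: "x \<in> space M"
      have "norm (k (Y n) x - k t x) \<le> K * norm (Y n - t)"
        by (rule field_differentiable_bound[of "{a<..<b}" "\<lambda>t. k t x" "\<lambda>t. k' t x" K])
           (use deriv[OF x] bound[OF x] Y[of n] t in \<open>auto intro: has_field_derivative_at_within\<close>)
      then have "\<bar>(k (Y n) x - k t x) / (Y n - t)\<bar> \<le> K" using Y(2)[of n] by (simp add: field_simps)
      then have "\<bar>f x\<bar> * \<bar>(k (Y n) x - k t x) / (Y n - t)\<bar> \<le> \<bar>f x\<bar> * K" by (intro mult_left_mono) auto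
      then show "norm (?q n x) \<le> K * norm (f x)" by (simp add: abs_mult mult.commute)
    qed
  qed measurable
  moreover have "(LINT x|M. ?q n x) = ((LINT x|M. f x * k (Y n) x) - (LINT x|M. f x * k t x)) / (Y n - t)" for n
    using int[OF Y(1)[of n]] int[OF t] by (simp add: right_diff_distrib diff_divide_distrib)
  ultimately have "(\<lambda>n. ((LINT x|M. f x * k (Y n) x) - (LINT x|M. f x * k t x)) / (Y n - t)) \<longlonglongrightarrow> (LINT x|M. f x * k' t x)"
    by (simp only:)
  then show "((\<lambda>s. ((LINT x|M. f x * k s x) - (LINT x|M. f x * k t x)) / (s - t)) \<circ> X) \<longlonglongrightarrow> (LINT x|M. f x * k' t x)"
    unfolding Y_def o_def by (rule LIMSEQ_offset[where k=N])
qed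

section \<open>Radial mollifiers\<close>

text \<open>
  The profile is the polynomial \<open>X\<^sup>2\<close>, written as a derivative: the mollifier has to be built from the
  derivative of the bump \<open>radial 1\<close>, because then an infinitesimal change of scale adds a multiple of the Laplacian
  of that bump, see \<open>mollifier_ds_laplacian\<close>.
\<close>

abbreviation bump_profile :: "real poly" where "bump_profile \<equiv> flat_exp_deriv 1"

text \<open>
  The factor \<open>s ^ DIM('a)\<close> makes the mass independent of the scale; the mass itself is not normalised to 1.
\<close>

definition mollifier :: "real \<Rightarrow> 'a::euclidean_space \<Rightarrow> 'a \<Rightarrow> real" where
  "mollifier s y x = s ^ DIM('a) * radial bump_profile s y x"

lemma radial_commute: "radial p s y x = radial p s x y"
proof -
  have "(x - y) \<bullet> (x - y) = (y - x) \<bullet> (y - x)" by (simp add: inner_commute inner_diff_left inner_diff_right)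
  then show ?thesis by (simp add: radial_def)
qed

lemma mollifier_commute: "mollifier s y x = mollifier s x y"
  by (simp add: mollifier_def radial_commute)

lemma flat_exp_bump_profile: "flat_exp bump_profile x = (if x > 0 then (1 / x)\<^sup>2 * exp (- 1 / x) else 0)"
  by (simp add: flat_exp_def flat_exp_deriv_def pderiv_1 power2_eq_square)

lemma mollifier_nonneg: "s \<ge> 0 \<Longrightarrow> mollifier s y x \<ge> 0"
  by (simp add: mollifier_def radial_def flat_exp_bump_profile)

lemma mollifier_eq_0: "s > 0 \<Longrightarrow> dist x y \<ge> 1 / s \<Longrightarrow> mollifier s y x = 0"
  by (simp add: mollifier_def radial_eq_0)

lemma continuous_on_mollifier: "continuous_on S (mollifier s y)"
  unfolding mollifier_def by (intro continuous_intros continuous_on_radial)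

lemma mollifier_measurable: "mollifier s y \<in> borel_measurable borel"
  by (intro borel_measurable_continuous_onI continuous_on_mollifier)

lemma mollifier_measurable2 [measurable]: "(\<lambda>(y, x). mollifier s y x) \<in> borel_measurable (borel \<Otimes>\<^sub>M borel)"
  unfolding borel_prod mollifier_def radial_def case_prod_beta
  by (intro borel_measurable_continuous_onI continuous_intros)

lemma flat_exp_bounded:
  obtains K where "K > 0" "\<And>x. x \<le> 1 \<Longrightarrow> \<bar>flat_exp p x\<bar> \<le> K"
proof -
  have "compact (flat_exp p ` {0..1})"
    by (intro compact_continuous_image continuous_intros) auto
  then obtain K where K: "K > 0" "\<And>x. x \<in> {0..1} \<Longrightarrow> \<bar>flat_exp p x\<bar> \<le> K"
    using compact_imp_bounded bounded_pos by (metis imageI real_norm_def)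
  have "\<bar>flat_exp p x\<bar> \<le> K" if "x \<le> 1" for x
    using K that by (cases "x \<ge> 0") (auto simp: flat_exp_def)
  then show ?thesis using K that by blast
qed

lemma radial_bounded:
  obtains K where "K > 0" "\<And>s y x::'a::euclidean_space. \<bar>radial p s y x\<bar> \<le> K"
proof -
  obtain K where K: "K > 0" "\<And>x. x \<le> 1 \<Longrightarrow> \<bar>flat_exp p x\<bar> \<le> K" using flat_exp_bounded by blast
  have "\<bar>radial p s y x\<bar> \<le> K" for s and y x :: 'a
    unfolding radial_def by (rule K) simp
  then show ?thesis using K that by blast
qed

text \<open>
  The gradient of \<open>radial p s y\<close> carries the factor \<open>s\<^sup>2 (x - y)\<close>, which has norm at most \<open>s\<close> on the support.
\<close>

lemma radial_Lipschitz:
  obtains K where "K > 0" "\<And>s x y z::'a::euclidean_space. s > 0 \<Longrightarrow> \<bar>radial p s y x - radial p s z x\<bar> \<le> K * s * dist y z"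
proof -
  obtain K where K: "K > 0" "\<And>s y x::'a. \<bar>radial (flat_exp_deriv p) s y x\<bar> \<le> K" using radial_bounded by blast
  have "\<bar>radial p s y x - radial p s z x\<bar> \<le> (2 * K) * s * dist y z" if s: "s > 0" for s and x y z :: 'a
  proof -
    have "norm (radial p s x y - radial p s x z) \<le> (2 * K * s) * norm (y - z)"
    proof (rule differentiable_bound[of UNIV])
      fix w :: 'a
      show "(radial p s x has_derivative (\<lambda>h. (- 2 * s\<^sup>2) * ((w - x) \<bullet> h) * radial (flat_exp_deriv p) s x w)) (at w within UNIV)"
        using radial_has_derivative by auto
      show "onorm (\<lambda>h. (- 2 * s\<^sup>2) * ((w - x) \<bullet> h) * radial (flat_exp_deriv p) s x w) \<le> 2 * K * s"
      proof (rule onorm_le)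
        fix h
        show "norm ((- 2 * s\<^sup>2) * ((w - x) \<bullet> h) * radial (flat_exp_deriv p) s x w) \<le> 2 * K * s * norm h"
        proof (cases "dist w x \<ge> 1 / s")
          case True
          then show ?thesis using radial_eq_0[OF s True] K s by simp
        next
          case False
          then have "s * norm (w - x) \<le> 1" using s by (simp add: dist_norm field_simps)
          then have 1: "s * (s * norm (w - x)) \<le> s" using s by (simp add: mult_left_le)
          have "norm ((- 2 * s\<^sup>2) * ((w - x) \<bullet> h) * radial (flat_exp_deriv p) s x w) = 2 * s\<^sup>2 * \<bar>(w - x) \<bullet> h\<bar> * \<bar>radial (flat_exp_deriv p) s x w\<bar>"
            by (simp add: abs_mult)
          also have "\<dots> \<le> 2 * s\<^sup>2 * (norm (w - x) * norm h) * K"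
            using K s by (intro mult_mono Cauchy_Schwarz_ineq2 mult_left_mono) auto
          also have "\<dots> = 2 * (s * (s * norm (w - x))) * norm h * K" by (simp add: power2_eq_square)
          also have "\<dots> \<le> 2 * s * norm h * K"
            using 1 K by (intro mult_right_mono mult_left_mono) auto
          finally show ?thesis by (simp add: mult_ac)
        qed
      qed
    qed auto
    then show ?thesis by (simp add: radial_commute[of p s y x] radial_commute[of p s z x] dist_norm)
  qed
  then show ?thesis using that[of "2 * K"] K by auto
qed

lemma mollifier_bounds:
  obtains K where "K > 0" "\<And>s x y::'a::euclidean_space. s > 0 \<Longrightarrow> \<bar>mollifier s y x\<bar> \<le> K * s ^ DIM('a)"
    "\<And>s x y z::'a. s > 0 \<Longrightarrow> \<bar>mollifier s y x - mollifier s z x\<bar> \<le> K * s ^ (DIM('a) + 1) * dist y z"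
proof -
  obtain K0 where K0: "K0 > 0" "\<And>s y x::'a. \<bar>radial bump_profile s y x\<bar> \<le> K0" using radial_bounded by blast
  obtain K1 where K1: "K1 > 0" "\<And>s x y z::'a. s > 0 \<Longrightarrow> \<bar>radial bump_profile s y x - radial bump_profile s z x\<bar> \<le> K1 * s * dist y z"
    using radial_Lipschitz by blast
  show ?thesis
  proof (rule that[of "max K0 K1"])
    fix s :: real and x y z :: 'a assume s: "s > 0"
    have "\<bar>mollifier s y x\<bar> = s ^ DIM('a) * \<bar>radial bump_profile s y x\<bar>" using s by (simp add: mollifier_def abs_mult)
    also have "\<dots> \<le> s ^ DIM('a) * max K0 K1" using s K0(2)[of s y x] by (intro mult_left_mono) auto
    finally show "\<bar>mollifier s y x\<bar> \<le> max K0 K1 * s ^ DIM('a)" by (simp add: mult.commute)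
    have "\<bar>mollifier s y x - mollifier s z x\<bar> = s ^ DIM('a) * \<bar>radial bump_profile s y x - radial bump_profile s z x\<bar>"
      using s by (simp add: mollifier_def abs_mult flip: right_diff_distrib)
    also have "\<dots> \<le> s ^ DIM('a) * (max K0 K1 * s * dist y z)"
      using s K1(2)[OF s, of y x z] by (intro mult_left_mono order.trans[OF K1(2)] mult_right_mono) auto
    finally show "\<bar>mollifier s y x - mollifier s z x\<bar> \<le> max K0 K1 * s ^ (DIM('a) + 1) * dist y z"
      by (simp add: mult_ac)
  qed (use K0 in auto)
qed

definition laplacian :: "('a::euclidean_space \<Rightarrow> real) \<Rightarrow> 'a \<Rightarrow> real" where
  "laplacian f x = (\<Sum>b\<in>Basis. pd b (pd b f) x)"

text \<open>
  The derivative of the mollifier with respect to the scale \<open>s\<close>.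
\<close>

definition mollifier_ds :: "real \<Rightarrow> 'a::euclidean_space \<Rightarrow> 'a \<Rightarrow> real" where
  "mollifier_ds s y x = real DIM('a) * s ^ (DIM('a) - 1) * radial bump_profile s y x
     - 2 * s ^ (DIM('a) + 1) * ((x - y) \<bullet> (x - y)) * radial (flat_exp_deriv bump_profile) s y x"

lemma mollifier_has_derivative:
  "((\<lambda>s. mollifier s y x) has_real_derivative mollifier_ds s y x) (at s)"
proof -
  have "((\<lambda>s. 1 - s\<^sup>2 * ((x - y) \<bullet> (x - y))) has_real_derivative - 2 * s * ((x - y) \<bullet> (x - y))) (at s)"
    by (auto intro!: derivative_eq_intros)
  from DERIV_chain2[OF flat_exp_has_derivative this, of bump_profile]
  have "((\<lambda>s. radial bump_profile s y x) has_real_derivative radial (flat_exp_deriv bump_profile) s y x * (- 2 * s * ((x - y) \<bullet> (x - y)))) (at s)"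
    unfolding radial_def .
  then show ?thesis
    unfolding mollifier_def mollifier_ds_def
    by (auto intro!: derivative_eq_intros)
qed

lemma laplacian_radial:
  "laplacian (radial 1 s y) (x::'a::euclidean_space) = - 2 * s\<^sup>2 * (real DIM('a) * radial bump_profile s y x
     - 2 * s\<^sup>2 * ((x - y) \<bullet> (x - y)) * radial (flat_exp_deriv bump_profile) s y x)"
proof -
  have "pd b (pd b (radial 1 s y)) x = - 2 * s\<^sup>2 * ((b \<bullet> b) * radial bump_profile s y x
      - 2 * s\<^sup>2 * (((x - y) \<bullet> b) * ((x - y) \<bullet> b)) * radial (flat_exp_deriv bump_profile) s y x)" for b :: 'a
    unfolding pd_radial
    by (rule pd_eqI) (auto intro!: derivative_eq_intros radial_has_derivative simp: algebra_simps)
  then have "laplacian (radial 1 s y) x = (\<Sum>b\<in>Basis. - 2 * s\<^sup>2 * (1 * radial bump_profile s y x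
      - 2 * s\<^sup>2 * (((x - y) \<bullet> b) * ((x - y) \<bullet> b)) * radial (flat_exp_deriv bump_profile) s y x))"
    unfolding laplacian_def by (intro sum.cong) auto
  also have "\<dots> = - 2 * s\<^sup>2 * (\<Sum>b\<in>Basis. (radial bump_profile s y x
      - 2 * s\<^sup>2 * (((x - y) \<bullet> b) * ((x - y) \<bullet> b)) * radial (flat_exp_deriv bump_profile) s y x))"
    unfolding sum_distrib_left by simp
  also have "(\<Sum>b\<in>Basis. (radial bump_profile s y x
      - 2 * s\<^sup>2 * (((x - y) \<bullet> b) * ((x - y) \<bullet> b)) * radial (flat_exp_deriv bump_profile) s y x))
    = real DIM('a) * radial bump_profile s y x
     - 2 * s\<^sup>2 * (\<Sum>b\<in>Basis. ((x - y) \<bullet> b) * ((x - y) \<bullet> b)) * radial (flat_exp_deriv bump_profile) s y x"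
    by (simp add: sum_subtractf sum_distrib_left sum_distrib_right)
  also have "(\<Sum>b\<in>Basis. ((x - y) \<bullet> b) * ((x - y) \<bullet> b)) = (x - y) \<bullet> (x - y)"
    by (rule euclidean_inner[symmetric])
  finally show ?thesis .
qed

text \<open>
  The identity behind Weyl's lemma: a change of scale alters the mollifier by the Laplacian of a compactly
  supported bump, to which weakly harmonic functions are blind.
\<close>

lemma mollifier_ds_laplacian:
  "s > 0 \<Longrightarrow> mollifier_ds s y (x::'a::euclidean_space) = - (s ^ DIM('a) / (2 * s ^ 3)) * laplacian (radial 1 s y) x"
proof -
  obtain m where m: "DIM('a) = Suc m" using DIM_positive[where 'a='a] gr0_conv_Suc by blast
  show "s > 0 \<Longrightarrow> ?thesis"
    unfolding mollifier_ds_def laplacian_radial m by (simp add: field_simps power2_eq_square power3_eq_cube)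
qed

lemma mollifier_ds_measurable: "mollifier_ds s y \<in> borel_measurable borel"
  unfolding mollifier_ds_def radial_def
  by (intro borel_measurable_continuous_onI continuous_intros)

lemma mollifier_ds_bounded:
  assumes "bounded D" "b > 0"
  obtains K where "\<And>x s. x \<in> D \<Longrightarrow> s \<in> {0<..<b} \<Longrightarrow> \<bar>mollifier_ds s y (x::'a::euclidean_space)\<bar> \<le> K"
proof -
  obtain R where R: "R > 0" "\<And>x. x \<in> D \<Longrightarrow> dist x y \<le> R"
    using assms(1) bounded_any_center[of D y] by (metis dist_commute less_eq_real_def linorder_le_cases not_le zero_less_one order.trans)
  define g where "g = (\<lambda>(s::real, q). real DIM('a) * s ^ (DIM('a) - 1) * flat_exp bump_profile (1 - s\<^sup>2 * q)
     - 2 * s ^ (DIM('a) + 1) * q * flat_exp (flat_exp_deriv bump_profile) (1 - s\<^sup>2 * q))"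
  have "compact (g ` ({0..b} \<times> {0..R\<^sup>2}))"
    unfolding g_def case_prod_beta
    by (intro compact_continuous_image compact_Times continuous_intros) auto
  then obtain K where K: "\<And>z. z \<in> {0..b} \<times> {0..R\<^sup>2} \<Longrightarrow> \<bar>g z\<bar> \<le> K"
    using compact_imp_bounded bounded_pos by (metis imageI real_norm_def)
  have "\<bar>mollifier_ds s y x\<bar> \<le> K" if "x \<in> D" "s \<in> {0<..<b}" for x s
  proof -
    have "(x - y) \<bullet> (x - y) \<le> R\<^sup>2"
      using R(2)[OF that(1)] by (simp add: dist_norm power_mono flip: power2_norm_eq_inner)
    then show ?thesis using K[of "(s, (x - y) \<bullet> (x - y))"] that by (simp add: g_def mollifier_ds_def radial_def)
  qed
  then show ?thesis using that by blast
qed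

lemma mollified_integral_const:
  fixes f :: "'a::euclidean_space \<Rightarrow> real"
  assumes D: "bounded D" "D \<in> sets borel" and f: "integrable (borel_on D) f"
    and a: "a > 0" and harm: "\<And>s. s > a \<Longrightarrow> (LINT x|borel_on D. f x * laplacian (radial 1 s y) x) = 0"
    and st: "s > a" "t > a"
  shows "(LINT x|borel_on D. f x * mollifier s y x) = (LINT x|borel_on D. f x * mollifier t y x)"
proof -
  define b where "b = max s t + 1"
  have b: "b > 0" "s < b" "t < b" using a st by (auto simp: b_def)
  obtain K where K: "\<And>x s. x \<in> D \<Longrightarrow> s \<in> {0<..<b} \<Longrightarrow> \<bar>mollifier_ds s y x\<bar> \<le> K"
    using mollifier_ds_bounded[OF D(1) b(1)] by blast
  obtain K0 where K0: "K0 > 0" "\<And>s x y::'a. s > 0 \<Longrightarrow> \<bar>mollifier s y x\<bar> \<le> K0 * s ^ DIM('a)"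
    "\<And>s x y z::'a. s > 0 \<Longrightarrow> \<bar>mollifier s y x - mollifier s z x\<bar> \<le> K0 * s ^ (DIM('a) + 1) * dist y z"
    using mollifier_bounds by blast
  let ?J = "\<lambda>s. LINT x|borel_on D. f x * mollifier s y x"
  have "(?J has_real_derivative 0) (at r)" if r: "r \<in> {a<..<b}" for r
  proof -
    have "(?J has_real_derivative (LINT x|borel_on D. f x * mollifier_ds r y x)) (at r)"
    proof (rule integral_has_derivative_dominated[where K=K, OF f _ _ _ _ _ r])
      show "integrable (borel_on D) (\<lambda>x. f x * mollifier s y x)" if "s \<in> {a<..<b}" for s
        using K0(2)[of s y] a that
        by (intro integrable_mult_bounded[OF f borel_on_measurable[OF mollifier_measurable], of _ _ "K0 * s ^ DIM('a)"]) auto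
    qed (use K a in \<open>auto intro!: mollifier_has_derivative borel_on_measurable mollifier_measurable mollifier_ds_measurable simp: space_restrict_space\<close>)
    also have "(LINT x|borel_on D. f x * mollifier_ds r y x) = (LINT x|borel_on D. - (r ^ DIM('a) / (2 * r ^ 3)) * (f x * laplacian (radial 1 r y) x))"
      using a r by (intro Bochner_Integration.integral_cong refl) (simp add: mollifier_ds_laplacian mult_ac)
    also have "\<dots> = - (r ^ DIM('a) / (2 * r ^ 3)) * (LINT x|borel_on D. f x * laplacian (radial 1 r y) x)"
      by (rule integral_mult_right_zero)
    also have "\<dots> = 0" using harm[of r] r by simp
    finally show ?thesis .
  qed
  then show ?thesis
    by (intro DERIV_isconst3[of a b]) (use st b in auto)
qed

lemma mollifier_test_function:
  assumes "s > 0" "cball y (1 / s) \<subseteq> D"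
  shows "mollifier s y \<in> test_functions D"
  unfolding mollifier_def by (intro test_functions_mult radial_test_function assms C_k_const)

definition mollifier_mass :: "'a::euclidean_space itself \<Rightarrow> real" where
  "mollifier_mass _ = (LINT x|lborel. mollifier 1 (0::'a) x)"

lemma mollifier_integrable: "s > 0 \<Longrightarrow> integrable lborel (mollifier s y)"
  by (rule test_functions_integrable[OF mollifier_test_function[of s y UNIV]]) auto

text \<open>
  The constant 1 is weakly harmonic, so the mass is independent of \<open>s\<close> for the same reason that mollified
  values of harmonic functions are.
\<close>

lemma mollifier_integral:
  assumes s: "s > 0"
  shows "(LINT x|lborel. mollifier s (y::'a::euclidean_space) x) = mollifier_mass TYPE('a)"
proof -
  define a where "a = min s 1 / 2"
  have a: "a > 0" "s > a" "1 > a" using s by (auto simp: a_def)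
  define D where "D = cball (0::'a) (1 / a)"
  have D: "bounded D" "D \<in> sets borel" by (auto simp: D_def)
  interpret finite_measure "borel_on D" by (rule finite_measure_borel_on[OF D])
  have sub: "cball 0 (1 / r) \<subseteq> D" if "r > a" for r
    using that a by (auto simp: D_def frac_le intro!: subset_cball)
  have tot: "(LINT x|borel_on D. 1 * mollifier r (0::'a) x) = (LINT x|lborel. mollifier r (0::'a) x)" if "r > a" for r
  proof (subst integral_borel_on_UNIV[OF D(2)])
    fix x assume "x \<notin> D"
    then show "1 * mollifier r 0 x = 0"
      using test_functions_zero_outside[OF mollifier_test_function[of r 0 D]] sub[OF that] a that by simp
  qed simp
  have "(LINT x|borel_on D. 1 * mollifier s (0::'a) x) = (LINT x|borel_on D. 1 * mollifier 1 (0::'a) x)"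
  proof (rule mollified_integral_const[OF D _ a(1) _ a(2,3)])
    fix r assume r: "r > a"
    have t: "radial 1 r (0::'a) \<in> test_functions D"
      by (rule radial_test_function) (use sub[OF r] a r in auto)
    have "(LINT x|borel_on D. 1 * laplacian (radial 1 r (0::'a)) x) = (LINT x|lborel. 1 * laplacian (radial 1 r (0::'a)) x)"
      using test_functions_zero_outside[OF test_functions_pd[OF test_functions_pd[OF t]]]
      by (intro integral_borel_on_UNIV[OF D(2)]) (simp add: laplacian_def)
    also have "\<dots> = (\<Sum>b\<in>Basis. LINT x|lborel. pd b (pd b (radial 1 r (0::'a))) x)"
      unfolding laplacian_def using test_functions_integrable[OF test_functions_pd[OF test_functions_pd[OF t]]]
      by simp
    also have "\<dots> = 0"
      by (intro sum.neutral ballI integral_pd_eq_0[OF test_functions_pd[OF t]])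
    finally show "(LINT x|borel_on D. 1 * laplacian (radial 1 r (0::'a)) x) = 0" .
  qed (auto intro: integrable_const)
  then have 0: "(LINT x|lborel. mollifier s (0::'a) x) = mollifier_mass TYPE('a)"
    unfolding tot[OF a(2)] tot[OF a(3)] mollifier_mass_def .
  have "(LINT x|lborel. mollifier s y x) = (LINT x|distr lborel borel (\<lambda>x. y + x). mollifier s y x)"
    by (simp add: lborel_distr_plus)
  also have "\<dots> = (LINT x|lborel. mollifier s y (y + x))"
    by (subst integral_distr) (auto intro: mollifier_measurable)
  also have "\<dots> = (LINT x|lborel. mollifier s (0::'a) x)"
    by (simp add: mollifier_def radial_def)
  finally show ?thesis using 0 by simp
qed

lemma mollifier_mass_pos: "mollifier_mass TYPE('a::euclidean_space) > 0"
proof -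
  have "mollifier_mass TYPE('a) \<noteq> 0"
  proof
    assume "mollifier_mass TYPE('a) = 0"
    then have "AE x in lborel. mollifier 1 (0::'a) x = 0"
      unfolding mollifier_mass_def
      using integral_nonneg_eq_0_iff_AE[OF mollifier_integrable[of 1 "0::'a"]] by (simp add: mollifier_nonneg)
    then have "AE x in lborel. x \<notin> ball (0::'a) 1"
    proof eventually_elim
      case (elim x)
      show ?case
      proof
        assume "x \<in> ball 0 1"
        then have "x \<bullet> x < 1" by (simp add: norm_lt_square)
        then have "mollifier 1 0 x > 0" by (simp add: mollifier_def radial_def flat_exp_bump_profile)
        then show False using elim by simp
      qed
    qed
    then have "ball (0::'a) 1 \<in> null_sets lborel"
      by (subst (asm) AE_iff_null_sets[symmetric]) auto
    then have "emeasure lborel (ball (0::'a) 1) = 0" by auto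
    moreover have "emeasure lborel (ball (0::'a) 1) > 0"
      by (subst emeasure_ball) (auto simp: unit_ball_vol_pos)
    ultimately show False by simp
  qed
  moreover have "mollifier_mass TYPE('a) \<ge> 0"
    unfolding mollifier_mass_def by (intro integral_nonneg_AE) (auto simp: mollifier_nonneg)
  ultimately show ?thesis by simp
qed

section \<open>Weyl's lemma\<close>

lemma eventually_corner_cbox_subset:
  fixes x :: "'a::euclidean_space"
  assumes "open U" "x \<in> U"
  shows "\<forall>\<^sub>F h in at_right 0. cbox x (x + h *\<^sub>R One) \<subseteq> U"
proof -
  obtain e where e: "e > 0" "ball x e \<subseteq> U" using assms open_contains_ball by blast
  have sub: "cbox x (x + h *\<^sub>R One) \<subseteq> U" if h: "0 < h" "h < e / DIM('a)" for h
  proof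
    fix y assume y: "y \<in> cbox x (x + h *\<^sub>R One)"
    have "norm (y - x) \<le> (\<Sum>b\<in>Basis. \<bar>(y - x) \<bullet> b\<bar>)" by (rule norm_le_l1)
    also have "\<dots> \<le> (\<Sum>b\<in>(Basis::'a set). h)"
      using y by (intro sum_mono) (auto simp: mem_box inner_diff_left inner_add_left)
    also have "\<dots> < e" using h by (simp add: field_simps)
    finally show "y \<in> U" using e(2) by (auto simp: dist_norm norm_minus_commute subset_iff)
  qed
  have "e / DIM('a) > 0" using e(1) by simp
  then show ?thesis using sub unfolding eventually_at_right_field by blast
qed

text \<open>
  Lebesgue's differentiation theorem along boxes that have \<open>x\<close> as their lowest corner.
\<close>

lemma Lebesgue_differentiation_corner:
  fixes f :: "'a::euclidean_space \<Rightarrow> 'b::euclidean_space"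
  assumes U: "open U" and f: "integrable (borel_on U) f"
  shows "AE x in lborel. x \<in> U \<longrightarrow>
    ((\<lambda>h. (LINT y|borel_on (cbox x (x + h *\<^sub>R One)). f y) /\<^sub>R h ^ DIM('a)) \<longlongrightarrow> f x) (at_right 0)"
proof -
  define F where "F x = indicator U x *\<^sub>R f x" for x
  have F: "integrable lborel F"
    using f U unfolding F_def by (subst (asm) integrable_borel_on) auto
  have si: "set_integrable lborel (cbox l u) F" for l u
    unfolding set_integrable_def by (rule integrable_mult_indicator[OF _ F]) auto
  have "F integrable_on cbox l u" for l u
    using set_borel_integral_eq_integral(1)[OF si] .
  then obtain N where N: "negligible N" and
    lim: "\<And>x e. x \<notin> N \<Longrightarrow> 0 < e \<Longrightarrow> \<exists>d>0. \<forall>h. 0 < h \<and> h < d \<longrightarrow>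
        norm (integral (cbox x (x + h *\<^sub>R One)) F /\<^sub>R h ^ DIM('a) - F x) < e"
    by (rule integrable_ccontinuous_explicit) blast
  have conv: "((\<lambda>h. (LINT y|borel_on (cbox x (x + h *\<^sub>R One)). f y) /\<^sub>R h ^ DIM('a)) \<longlongrightarrow> f x) (at_right 0)"
    if x: "x \<in> U" "x \<notin> N" for x
  proof -
    let ?Q = "\<lambda>h. cbox x (x + h *\<^sub>R One)"
    have "((\<lambda>h. integral (?Q h) F /\<^sub>R h ^ DIM('a)) \<longlongrightarrow> F x) (at_right 0)"
      unfolding tendsto_iff dist_norm eventually_at_right_field using lim[OF x(2)] by blast
    moreover have "\<forall>\<^sub>F h in at_right 0. integral (?Q h) F /\<^sub>R h ^ DIM('a) = (LINT y|borel_on (?Q h). f y) /\<^sub>R h ^ DIM('a)"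
      using eventually_corner_cbox_subset[OF U x(1)]
    proof eventually_elim
      case (elim h)
      have "integral (?Q h) F = (LINT y:?Q h|lborel. F y)"
        using set_borel_integral_eq_integral(2)[OF si] by simp
      also have "\<dots> = (LINT y|borel_on (?Q h). f y)"
        unfolding integral_borel_on[OF borel_closed[OF closed_cbox]] set_lebesgue_integral_def F_def
        using elim by (intro Bochner_Integration.integral_cong) (auto simp: indicator_def)
      finally show ?case by simp
    qed
    ultimately have "((\<lambda>h. (LINT y|borel_on (?Q h). f y) /\<^sub>R h ^ DIM('a)) \<longlongrightarrow> F x) (at_right 0)"
      by (rule Lim_transform_eventually)
    then show ?thesis using x(1) by (simp add: F_def)
  qed
  have "N \<in> null_sets lebesgue" using N by (simp add: negligible_iff_null_sets)
  then have "AE x in lebesgue. x \<notin> N" by (rule AE_not_in)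
  then have "AE x in lebesgue. x \<in> U \<longrightarrow>
    ((\<lambda>h. (LINT y|borel_on (cbox x (x + h *\<^sub>R One)). f y) /\<^sub>R h ^ DIM('a)) \<longlongrightarrow> f x) (at_right 0)"
    by eventually_elim (use conv in simp)
  then show ?thesis by (simp only: AE_completion_iff)
qed

lemma AE_zero_if_box_integrals_zero:
  fixes f :: "'a::euclidean_space \<Rightarrow> real"
  assumes U: "open U" and f: "integrable (borel_on U) f"
    and zero: "\<And>l u. cbox l u \<subseteq> U \<Longrightarrow> (LINT x|borel_on (cbox l u). f x) = 0"
  shows "AE x in lborel. x \<in> U \<longrightarrow> f x = 0"
  using Lebesgue_differentiation_corner[OF U f]
proof eventually_elim
  case (elim x)
  show ?case
  proof
    assume x: "x \<in> U"
    have "\<forall>\<^sub>F h in at_right 0. (LINT y|borel_on (cbox x (x + h *\<^sub>R One)). f y) /\<^sub>R h ^ DIM('a) = 0"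
      using eventually_corner_cbox_subset[OF U x] by eventually_elim (simp add: zero)
    then have "((\<lambda>h. (LINT y|borel_on (cbox x (x + h *\<^sub>R One)). f y) /\<^sub>R h ^ DIM('a)) \<longlongrightarrow> 0) (at_right 0)"
      by (rule tendsto_eventually)
    with elim x show "f x = 0" by (intro tendsto_unique[of "at_right (0::real)"]) auto
  qed
qed

lemma mollifier_integral_le:
  assumes "s > 0" "Q \<in> sets borel"
  shows "0 \<le> (LINT y|borel_on Q. mollifier s (x::'a::euclidean_space) y)"
    "(LINT y|borel_on Q. mollifier s x y) \<le> mollifier_mass TYPE('a)"
    "integrable (borel_on Q) (mollifier s x)"
proof -
  have i: "integrable lborel (mollifier s x)" by (rule mollifier_integrable[OF assms(1)])
  show "integrable (borel_on Q) (mollifier s x)"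
    unfolding integrable_borel_on[OF assms(2)] by (rule integrable_mult_indicator[OF _ i]) (use assms in simp)
  show "0 \<le> (LINT y|borel_on Q. mollifier s x y)"
    using assms by (intro integral_nonneg_AE) (auto simp: mollifier_nonneg)
  have "(LINT y|borel_on Q. mollifier s x y) \<le> (LINT y|lborel. mollifier s x y)"
    unfolding integral_borel_on[OF assms(2)] using i assms
    by (intro integral_mono integrable_mult_indicator) (auto simp: indicator_def mollifier_nonneg)
  then show "(LINT y|borel_on Q. mollifier s x y) \<le> mollifier_mass TYPE('a)"
    using mollifier_integral[OF assms(1), of x] by simp
qed

text \<open>
  The mollified indicator function of a box, which is eventually constant at every point off the boundary.
\<close>

lemma mollifier_box_tendsto:
  fixes l u x :: "'a::euclidean_space"
  assumes s: "s > 0" and x: "x \<notin> cbox l u - box l u"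
  shows "(\<lambda>k. LINT y|borel_on (cbox l u). mollifier (s + real k) x y) \<longlonglongrightarrow> mollifier_mass TYPE('a) * indicator (cbox l u) x"
proof -
  obtain e where e: "e > 0" "ball x e \<subseteq> box l u \<or> ball x e \<inter> cbox l u = {}"
  proof (cases "x \<in> box l u")
    case True
    then show ?thesis using that open_contains_ball open_box by metis
  next
    case False
    then have "x \<in> - cbox l u" using x by auto
    then show ?thesis using that open_contains_ball[of "- cbox l u"] by (metis closed_cbox disjoint_eq_subset_Compl open_Compl)
  qed
  obtain k0 :: nat where k0: "1 / e < real k0" using reals_Archimedean2 by blast
  have "(LINT y|borel_on (cbox l u). mollifier (s + real k) x y) = mollifier_mass TYPE('a) * indicator (cbox l u) x" if "k \<ge> k0" for k
  proof -
    let ?t = "s + real k"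
    have t: "?t > 0" "1 / ?t < e"
    proof -
      have "1 / e < ?t" using s k0 that of_nat_mono[OF that, where 'a=real] by linarith
      then show "?t > 0" "1 / ?t < e" using s e(1) by (simp_all add: field_simps add_pos_nonneg)
    qed
    have z: "mollifier ?t x y = 0" if "y \<notin> ball x e" for y
      using that t by (intro mollifier_eq_0) (auto simp: dist_commute)
    from e(2) show ?thesis
    proof
      assume b: "ball x e \<subseteq> box l u"
      then have "x \<in> cbox l u" using e(1) box_subset_cbox by fastforce
      moreover have "(LINT y|borel_on (cbox l u). mollifier ?t x y) = (LINT y|lborel. mollifier ?t x y)"
      proof (rule integral_borel_on_UNIV)
        show "mollifier ?t x y = 0" if "y \<notin> cbox l u" for y
        proof -
          have "y \<notin> ball x e" using b box_subset_cbox[of l u] that by blast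
          then show ?thesis by (rule z)
        qed
      qed auto
      ultimately show ?thesis using mollifier_integral[OF t(1)] by simp
    next
      assume b: "ball x e \<inter> cbox l u = {}"
      then have "x \<notin> cbox l u" using e(1) centre_in_ball[of x e] by blast
      moreover have "(LINT y|borel_on (cbox l u). mollifier ?t x y) = (LINT y|borel_on (cbox l u). 0)"
      proof (intro Bochner_Integration.integral_cong refl)
        fix y assume "y \<in> space (borel_on (cbox l u))"
        then have "y \<notin> ball x e" using b by (auto simp: space_restrict_space simp del: mem_ball)
        then show "mollifier ?t x y = 0" by (rule z)
      qed
      ultimately show ?thesis by simp
    qed
  qed
  then show ?thesis by (intro tendsto_eventually) (auto simp: eventually_sequentially)
qed

text \<open>
  The mollification \<open>g\<close> of a weakly harmonic function is the same for all \<open>s > a\<close>. Integrate it over a box in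
  \<open>U\<close> and move the mollification to the indicator function of the box: in the limit of large \<open>s\<close> this gives
  the integral of \<open>f\<close> over the box, up to the mass. Hence \<open>g\<close> and the multiple of \<open>f\<close> have the same integral
  over every box in \<open>U\<close>, and they agree almost everywhere.
\<close>

lemma Weyl_lemma:
  fixes f :: "'a::euclidean_space \<Rightarrow> real"
  assumes D: "bounded D" "D \<in> sets borel" and f: "integrable (borel_on D) f"
    and U: "open U" "U \<subseteq> D" and a: "a > 0"
    and harm: "\<And>y s. y \<in> U \<Longrightarrow> s > a \<Longrightarrow> (LINT x|borel_on D. f x * laplacian (radial 1 s y) x) = 0"
    and s: "s > a"
  shows "AE y in lborel. y \<in> U \<longrightarrow> (LINT x|borel_on D. f x * mollifier s y x) = mollifier_mass TYPE('a) * f y"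
proof -
  let ?m = "mollifier_mass TYPE('a)"
  define g where "g y = (LINT x|borel_on D. f x * mollifier s y x)" for y
  have s0: "s > 0" using a s by simp
  interpret D: finite_measure "borel_on D" by (rule finite_measure_borel_on[OF D])
  have Ub: "bounded U" "U \<in> sets borel" using U D bounded_subset by auto
  interpret U: finite_measure "borel_on U" by (rule finite_measure_borel_on[OF Ub])
  obtain K where K: "K > 0" "\<And>s x y::'a. s > 0 \<Longrightarrow> \<bar>mollifier s y x\<bar> \<le> K * s ^ DIM('a)"
    "\<And>s x y z::'a. s > 0 \<Longrightarrow> \<bar>mollifier s y x - mollifier s z x\<bar> \<le> K * s ^ (DIM('a) + 1) * dist y z"
    using mollifier_bounds by blast
  have [measurable]: "f \<in> borel_measurable (borel_on D)" using f by auto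
  have id1: "(\<lambda>x. x) \<in> measurable (borel_on E) borel" for E :: "'a set"
    by (intro borel_on_measurable) simp
  have meas2: "(\<lambda>(y, x). mollifier t y x) \<in> borel_measurable (borel_on E \<Otimes>\<^sub>M borel_on E')" for t and E E' :: "'a set"
  proof -
    have "(\<lambda>p. (fst p, snd p)) \<in> borel_on E \<Otimes>\<^sub>M borel_on E' \<rightarrow>\<^sub>M borel \<Otimes>\<^sub>M (borel :: 'a measure)"
      by (intro measurable_Pair measurable_compose[OF measurable_fst id1] measurable_compose[OF measurable_snd id1])
    from measurable_compose[OF this mollifier_measurable2[of t]] show ?thesis by (simp add: case_prod_beta)
  qed
  have fint: "integrable (borel_on D) (\<lambda>x. f x * mollifier t y x)" if "t > 0" for t y
    by (rule integrable_mult_bounded[OF f borel_on_measurable[OF mollifier_measurable] K(2)[OF that]])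
  have gm: "g \<in> borel_measurable (borel_on U)"
    unfolding g_def
  proof (rule D.borel_measurable_lebesgue_integral)
    have "(\<lambda>p. f (snd p)) \<in> borel_measurable (borel_on U \<Otimes>\<^sub>M borel_on D)" by measurable
    moreover have "(\<lambda>p. mollifier s (fst p) (snd p)) \<in> borel_measurable (borel_on U \<Otimes>\<^sub>M borel_on D)"
      using meas2 by (simp add: case_prod_beta)
    ultimately show "(\<lambda>(y, x). f x * mollifier s y x) \<in> borel_measurable (borel_on U \<Otimes>\<^sub>M borel_on D)"
      unfolding case_prod_beta by (rule borel_measurable_times)
  qed
  have g_bound: "\<bar>g y\<bar> \<le> K * s ^ DIM('a) * (LINT x|borel_on D. \<bar>f x\<bar>)" for y
  proof -
    have "\<bar>g y\<bar> \<le> (LINT x|borel_on D. \<bar>f x * mollifier s y x\<bar>)" unfolding g_def by (rule integral_abs_bound)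
    also have "\<dots> \<le> (LINT x|borel_on D. (K * s ^ DIM('a)) * \<bar>f x\<bar>)"
    proof (intro integral_mono integrable_abs fint[OF s0] integrable_mult_right f)
      show "\<bar>f x * mollifier s y x\<bar> \<le> K * s ^ DIM('a) * \<bar>f x\<bar>" for x
        using mult_right_mono[OF K(2)[OF s0, of y x], of "\<bar>f x\<bar>"] by (simp add: abs_mult mult.commute)
    qed
    finally show ?thesis by simp
  qed
  have fU: "integrable (borel_on U) f"
    by (rule integrable_borel_on_subset[OF f Ub(2) D(2) U(2)])
  have gU: "integrable (borel_on U) g"
    by (rule U.integrable_const_bound[OF _ gm]) (use g_bound in auto)
  have "AE y in lborel. y \<in> U \<longrightarrow> g y - ?m * f y = 0"
  proof (rule AE_zero_if_box_integrals_zero[OF U(1)])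
    show "integrable (borel_on U) (\<lambda>y. g y - ?m * f y)" using gU fU by auto
    fix l u :: 'a assume Q: "cbox l u \<subseteq> U"
    let ?Q = "cbox l u"
    have Qb: "bounded ?Q" "?Q \<in> sets borel" by (auto simp: bounded_cbox)
    interpret Q: finite_measure "borel_on ?Q" by (rule finite_measure_borel_on[OF Qb])
    interpret DQ: pair_sigma_finite "borel_on D" "borel_on ?Q" ..
    \<comment> \<open>scales that tend to infinity and lie in the range where the mollification is constant\<close>
    define t where "t k = s + real k" for k
    have t: "t k > 0" "t k > a" for k using s a by (auto simp: t_def)
    \<comment> \<open>the mollified indicator function of the box\<close>
    define w where "w k x = (LINT y|borel_on ?Q. mollifier (t k) x y)" for k x
    have w: "0 \<le> w k x" "w k x \<le> ?m" for k x
      unfolding w_def using mollifier_integral_le[OF t(1) Qb(2)] by auto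
    have wm: "w k \<in> borel_measurable (borel_on D)" for k
      unfolding w_def by (rule Q.borel_measurable_lebesgue_integral) (use meas2 in auto)
    have fub: "(LINT y|borel_on ?Q. g y) = (LINT x|borel_on D. f x * w k x)" for k
    proof -
      have int2: "integrable (borel_on D \<Otimes>\<^sub>M borel_on ?Q) (\<lambda>(x, y). f x * mollifier (t k) x y)"
      proof (rule DQ.Fubini_integrable)
        have "(\<lambda>p. f (fst p)) \<in> borel_measurable (borel_on D \<Otimes>\<^sub>M borel_on ?Q)" by measurable
        moreover have "(\<lambda>p. mollifier (t k) (fst p) (snd p)) \<in> borel_measurable (borel_on D \<Otimes>\<^sub>M borel_on ?Q)"
          using meas2 by (simp add: case_prod_beta)
        ultimately show "(\<lambda>(x, y). f x * mollifier (t k) x y) \<in> borel_measurable (borel_on D \<Otimes>\<^sub>M borel_on ?Q)"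
          unfolding case_prod_beta by (rule borel_measurable_times)
        have "(LINT y|borel_on ?Q. norm (f x * mollifier (t k) x y)) = \<bar>f x\<bar> * w k x" for x
        proof -
          have "\<bar>mollifier (t k) x y\<bar> = mollifier (t k) x y" for y
            using mollifier_nonneg[of "t k" x y] t(1)[of k] by simp
          then show ?thesis by (simp add: abs_mult w_def)
        qed
        then show "integrable (borel_on D) (\<lambda>x. LINT y|borel_on ?Q. norm (case (x, y) of (x, y) \<Rightarrow> f x * mollifier (t k) x y))"
          using integrable_mult_bounded[OF integrable_abs[OF f] wm, of k ?m] w[of k] by simp
        show "AE x in borel_on D. integrable (borel_on ?Q) (\<lambda>y. case (x, y) of (x, y) \<Rightarrow> f x * mollifier (t k) x y)"
          using mollifier_integral_le(3)[OF t(1) Qb(2)] by auto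
      qed
      have "(LINT y|borel_on ?Q. g y) = (LINT y|borel_on ?Q. LINT x|borel_on D. f x * mollifier (t k) x y)"
      proof (rule Bochner_Integration.integral_cong[OF refl])
        fix y assume "y \<in> space (borel_on ?Q)"
        then have "y \<in> U" using Q by (auto simp: space_restrict_space)
        from mollified_integral_const[OF D f a harm[OF this] s t(2)[of k]]
        show "g y = (LINT x|borel_on D. f x * mollifier (t k) x y)"
          unfolding g_def mollifier_commute[of "t k" _ y] by simp
      qed
      also have "\<dots> = (LINT x|borel_on D. LINT y|borel_on ?Q. f x * mollifier (t k) x y)"
        by (rule DQ.Fubini_integral[OF int2])
      also have "\<dots> = (LINT x|borel_on D. f x * w k x)" by (simp add: w_def)
      finally show ?thesis .
    qed
    have "(\<lambda>k. LINT x|borel_on D. f x * w k x) \<longlonglongrightarrow> (LINT x|borel_on D. f x * (?m * indicator ?Q x))"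
    proof (rule integral_dominated_convergence[where w="\<lambda>x. ?m * \<bar>f x\<bar>"])
      have "?Q - box l u \<in> null_sets lebesgue"
        using negligible_frontier_interval by (simp add: negligible_iff_null_sets)
      then have "AE x in lebesgue. x \<notin> ?Q - box l u" by (rule AE_not_in)
      then have "AE x in lborel. x \<notin> ?Q - box l u" by (simp only: AE_completion_iff)
      then have "AE x in borel_on D. x \<notin> ?Q - box l u"
        using D(2) by (subst AE_restrict_space_iff) (auto elim: eventually_mono)
      then show "AE x in borel_on D. (\<lambda>k. f x * w k x) \<longlonglongrightarrow> f x * (?m * indicator ?Q x)"
        unfolding w_def t_def
        by eventually_elim (intro tendsto_mult tendsto_const mollifier_box_tendsto s0)
      show "AE x in borel_on D. norm (f x * w k x) \<le> ?m * \<bar>f x\<bar>" for k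
      proof (rule AE_I2)
        fix x
        have "w k x * \<bar>f x\<bar> \<le> ?m * \<bar>f x\<bar>" by (rule mult_right_mono[OF w(2)]) simp
        then show "norm (f x * w k x) \<le> ?m * \<bar>f x\<bar>" using w(1)[of k x] by (simp add: abs_mult mult.commute)
      qed
      show "integrable (borel_on D) (\<lambda>x. ?m * \<bar>f x\<bar>)" using f by auto
      have "indicator ?Q \<in> borel_measurable (borel_on D)" using Qb by (intro borel_on_measurable) auto
      then show "(\<lambda>x. f x * (?m * indicator ?Q x)) \<in> borel_measurable (borel_on D)" by measurable
      show "(\<lambda>x. f x * w k x) \<in> borel_measurable (borel_on D)" for k using wm[of k] by measurable
    qed
    then have "(LINT y|borel_on ?Q. g y) = (LINT x|borel_on D. f x * (?m * indicator ?Q x))"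
      unfolding fub[symmetric] by (simp add: LIMSEQ_const_iff)
    also have "\<dots> = ?m * (LINT x|borel_on D. f x * indicator ?Q x)"
      by (subst integral_mult_right_zero[symmetric]) (simp add: mult_ac)
    also have "(LINT x|borel_on D. f x * indicator ?Q x) = (LINT x|borel_on ?Q. f x)"
      unfolding integral_borel_on[OF D(2)] integral_borel_on[OF Qb(2)]
      using Q U(2) by (intro Bochner_Integration.integral_cong) (auto simp: indicator_def)
    finally have "(LINT y|borel_on ?Q. g y) = ?m * (LINT x|borel_on ?Q. f x)" .
    moreover have "integrable (borel_on ?Q) g" "integrable (borel_on ?Q) f"
      using integrable_borel_on_subset[OF _ Qb(2) Ub(2) Q] gU fU by auto
    ultimately show "(LINT y|borel_on ?Q. g y - ?m * f y) = 0" by simp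
  qed
  then show ?thesis by (auto elim!: eventually_mono simp: g_def)
qed

section \<open>Normalised norms on cubes\<close>

definition cube :: "'a::euclidean_space \<Rightarrow> real \<Rightarrow> 'a set" where
  "cube x r = cbox (x - r *\<^sub>R One) (x + r *\<^sub>R One)"

lemma mem_cube: "y \<in> cube x r \<longleftrightarrow> (\<forall>b\<in>Basis. \<bar>(y - x) \<bullet> b\<bar> \<le> r)"
  by (auto simp: cube_def mem_box inner_diff_left inner_add_left abs_le_iff)

lemma bounded_cube [simp]: "bounded (cube x r)"
  and borel_cube [simp]: "cube x r \<in> sets borel"
  by (auto simp: cube_def bounded_cbox)

lemma cube_mono: "r \<le> s \<Longrightarrow> cube x r \<subseteq> cube x s"
  by (force simp: mem_cube)

lemma norm_le_cube: "y \<in> cube x r \<Longrightarrow> norm (y - x) \<le> real DIM('a) * r" for x y :: "'a::euclidean_space"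
proof -
  assume y: "y \<in> cube x r"
  have "norm (y - x) \<le> (\<Sum>b\<in>Basis. \<bar>(y - x) \<bullet> b\<bar>)" by (rule norm_le_l1)
  also have "\<dots> \<le> (\<Sum>b\<in>(Basis::'a set). r)" using y by (intro sum_mono) (auto simp: mem_cube)
  finally show ?thesis by simp
qed

lemma cball_subset_cube:
  assumes "x \<in> cube x0 r" "r + e \<le> s"
  shows "cball x e \<subseteq> cube x0 s"
proof
  fix y assume y: "y \<in> cball x e"
  show "y \<in> cube x0 s" unfolding mem_cube
  proof
    fix b :: 'a assume b: "b \<in> Basis"
    have "\<bar>(y - x) \<bullet> b\<bar> \<le> norm (y - x)" by (rule Basis_le_norm[OF b])
    moreover have "(y - x0) \<bullet> b = (y - x) \<bullet> b + (x - x0) \<bullet> b" by (simp add: inner_diff_left)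
    moreover have "\<bar>(x - x0) \<bullet> b\<bar> \<le> r" using assms b by (auto simp: mem_cube)
    ultimately show "\<bar>(y - x0) \<bullet> b\<bar> \<le> s" using y assms by (auto simp: dist_norm norm_minus_commute)
  qed
qed

lemma measure_cube:
  assumes "r \<ge> 0"
  shows "measure (borel_on (cube x r)) (cube (x::'a::euclidean_space) r) = (2 * r) ^ DIM('a)"
proof -
  have "measure (borel_on (cube x r)) (cube x r) = measure lborel (cube x r)"
    by (simp add: measure_restrict_space)
  also have "\<dots> = (\<Prod>b\<in>(Basis::'a set). ((x + r *\<^sub>R One) - (x - r *\<^sub>R One)) \<bullet> b)"
    unfolding cube_def using assms by (intro measure_lborel_cbox) (simp add: inner_diff_left inner_add_left)
  also have "\<dots> = (\<Prod>b\<in>(Basis::'a set). 2 * r)"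
    by (intro prod.cong) (auto simp: inner_diff_left inner_add_left)
  finally show ?thesis by simp
qed

lemma finite_measure_cube: "finite_measure (borel_on (cube x r))"
  by (rule finite_measure_borel_on) auto

lemma L2_space_subset:
  fixes f :: "'a::euclidean_space \<Rightarrow> 'b::euclidean_space"
  assumes f: "f \<in> L2_space (borel_on E)" and sets: "D \<in> sets borel" "E \<in> sets borel" and "D \<subseteq> E"
  shows "f \<in> L2_space (borel_on D)" "L2_norm (borel_on D) f \<le> L2_norm (borel_on E) f"
proof -
  have r: "restrict_space (borel_on E) D = borel_on D"
    using assms by (subst restrict_restrict_space) (auto simp: Int_absorb1 inf.absorb2)
  have m: "f \<in> borel_measurable (borel_on D)"
    using measurable_restrict_space1[OF L2_space_measurable[OF f], of D] unfolding r .
  have iE: "integrable (borel_on E) (\<lambda>x. (norm (f x))\<^sup>2)" by (rule L2_space_norm_power2[OF f])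
  have iD: "integrable (borel_on D) (\<lambda>x. (norm (f x))\<^sup>2)"
    by (rule integrable_borel_on_subset[OF iE sets assms(4)])
  show "f \<in> L2_space (borel_on D)"
    using m iD by (simp add: L2_space_def)
  show "L2_norm (borel_on D) f \<le> L2_norm (borel_on E) f"
    unfolding L2_norm_def integral_borel_on[OF sets(1)] integral_borel_on[OF sets(2)]
    using iD iE assms(4) unfolding integrable_borel_on[OF sets(1)] integrable_borel_on[OF sets(2)]
    by (intro real_sqrt_le_mono integral_mono) (auto simp: indicator_def)
qed

text \<open>
  Dividing by the root of the volume makes the norm of a constant independent of the cube, so that
  oscillations at different scales can be compared.
\<close>

definition cube_norm :: "'a::euclidean_space \<Rightarrow> real \<Rightarrow> ('a \<Rightarrow> 'b::euclidean_space) \<Rightarrow> real" where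
  "cube_norm x r f = L2_norm (borel_on (cube x r)) f / sqrt ((2 * r) ^ DIM('a))"

lemma cube_norm_nonneg [simp]: "r \<ge> 0 \<Longrightarrow> cube_norm x r f \<ge> 0"
  by (simp add: cube_norm_def)

lemma L2_norm_cube: "r > 0 \<Longrightarrow> L2_norm (borel_on (cube x r)) f = sqrt ((2 * r) ^ DIM('a)) * cube_norm (x::'a::euclidean_space) r f"
  by (simp add: cube_norm_def)

lemma cube_norm_add:
  assumes "r > 0" "f \<in> L2_space (borel_on (cube x r))" "g \<in> L2_space (borel_on (cube x r))"
  shows "cube_norm x r (\<lambda>x. f x + g x) \<le> cube_norm x r f + cube_norm x r g"
  using L2_norm_triangle[OF assms(2,3)] assms(1) by (simp add: cube_norm_def divide_right_mono flip: add_divide_distrib)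

lemma cube_norm_diff:
  assumes "r > 0" "f \<in> L2_space (borel_on (cube x r))" "g \<in> L2_space (borel_on (cube x r))"
  shows "cube_norm x r (\<lambda>x. f x - g x) \<le> cube_norm x r f + cube_norm x r g"
  using L2_norm_triangle_diff[OF assms(2,3)] assms(1) by (simp add: cube_norm_def divide_right_mono flip: add_divide_distrib)

lemma cube_norm_const: "r > 0 \<Longrightarrow> cube_norm x r (\<lambda>x. c) = norm c"
  using finite_measure.L2_norm_const[OF finite_measure_cube, of x r c] by (simp add: cube_norm_def measure_cube)

lemma cube_norm_bounded:
  assumes "r > 0" "f \<in> borel_measurable (borel_on (cube x r))" "AE y in borel_on (cube x r). norm (f y) \<le> B" "B \<ge> 0"
  shows "cube_norm x r f \<le> B"
  using finite_measure.L2_norm_bounded[OF finite_measure_cube assms(2-4)] assms(1)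
  by (simp add: cube_norm_def measure_cube field_simps)

lemma cube_norm_subset:
  fixes f :: "'a::euclidean_space \<Rightarrow> 'b::euclidean_space"
  assumes "r > 0" "0 < t" "t \<le> 1" "f \<in> L2_space (borel_on (cube x r))" "cube y (t * r) \<subseteq> cube x r"
  shows "cube_norm y (t * r) f \<le> cube_norm x r f / t ^ DIM('a)"
proof -
  let ?n = "DIM('a)"
  have "L2_norm (borel_on (cube y (t * r))) f \<le> sqrt ((2 * r) ^ ?n) * cube_norm x r f"
    using L2_space_subset(2)[OF assms(4) _ _ assms(5)] L2_norm_cube[OF assms(1), of x f] by simp
  then have "cube_norm y (t * r) f \<le> sqrt ((2 * r) ^ ?n) * cube_norm x r f / sqrt ((2 * (t * r)) ^ ?n)"
    using assms unfolding cube_norm_def[of y] by (intro divide_right_mono) auto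
  also have "\<dots> = cube_norm x r f / sqrt (t ^ ?n)"
  proof -
    have "sqrt ((2 * (t * r)) ^ ?n) = sqrt (t ^ ?n) * sqrt ((2 * r) ^ ?n)"
      by (simp add: power_mult_distrib real_sqrt_mult)
    then show ?thesis using assms by simp
  qed
  also have "\<dots> \<le> cube_norm x r f / t ^ ?n"
  proof (rule divide_left_mono)
    have "t ^ ?n \<le> 1" using assms by (simp add: power_le_one)
    then have "t ^ ?n * t ^ ?n \<le> t ^ ?n" using assms by (simp add: mult_left_le)
    then show "t ^ ?n \<le> sqrt (t ^ ?n)" by (intro real_le_rsqrt) (simp add: power2_eq_square)
  qed (use assms in auto)
  finally show ?thesis .
qed

section \<open>Harmonic fields\<close>

text \<open>
  The weak form of \<open>div H = 0\<close> and \<open>curl H = 0\<close>.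
\<close>

definition harmonic_field :: "'a::euclidean_space set \<Rightarrow> ('a \<Rightarrow> 'a) \<Rightarrow> bool" where
  "harmonic_field D H \<longleftrightarrow> H \<in> L2_space (borel_on D) \<and>
    (\<forall>\<phi>\<in>test_functions D. (LINT x|borel_on D. H x \<bullet> grad \<phi> x) = 0) \<and>
    (\<forall>\<phi>\<in>test_functions D. \<forall>b\<in>Basis. \<forall>c\<in>Basis.
       (LINT x|borel_on D. (H x \<bullet> b) * pd c \<phi> x) = (LINT x|borel_on D. (H x \<bullet> c) * pd b \<phi> x))"

lemma integrable_inner_test:
  fixes H :: "'a::euclidean_space \<Rightarrow> 'a"
  assumes "integrable (borel_on D) H" "\<phi> \<in> test_functions E"
  shows "integrable (borel_on D) (\<lambda>x. (H x \<bullet> b) * \<phi> x)"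
proof -
  obtain B where B: "\<And>x. \<bar>\<phi> x\<bar> \<le> B" using test_functions_bounded[OF assms(2)] by metis
  show ?thesis
    using assms B by (intro integrable_mult_bounded[where B=B]) (auto intro: borel_on_measurable test_functions_measurable)
qed

text \<open>
  Each component of \<open>H\<close> is weakly harmonic. Formally, summing over \<open>c\<close>,
  \<open>\<partial>\<^sub>c \<partial>\<^sub>c H\<^sub>b = \<partial>\<^sub>c \<partial>\<^sub>b H\<^sub>c = \<partial>\<^sub>b div H = 0\<close>; the proof is this computation with all derivatives on the test
  function.
\<close>

lemma harmonic_field_laplacian:
  assumes H: "harmonic_field D H" and D: "bounded D" "D \<in> sets borel" and \<psi>: "\<psi> \<in> test_functions D" and b: "b \<in> Basis"
  shows "(LINT x|borel_on D. (H x \<bullet> b) * laplacian \<psi> x) = 0"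
proof -
  interpret finite_measure "borel_on D" by (rule finite_measure_borel_on[OF D])
  have Hi: "integrable (borel_on D) H" using H L2_space_integrable(1) by (auto simp: harmonic_field_def)
  have t: "pd c (pd d \<psi>) \<in> test_functions D" if "c \<in> Basis" "d \<in> Basis" for c d
    using \<psi> that by (intro test_functions_pd)
  have "(LINT x|borel_on D. (H x \<bullet> b) * laplacian \<psi> x) = (\<Sum>c\<in>Basis. LINT x|borel_on D. (H x \<bullet> b) * pd c (pd c \<psi>) x)"
    unfolding laplacian_def sum_distrib_left using integrable_inner_test[OF Hi t]
    by (intro Bochner_Integration.integral_sum) auto
  also have "\<dots> = (\<Sum>c\<in>Basis. LINT x|borel_on D. (H x \<bullet> c) * pd b (pd c \<psi>) x)"
    using H test_functions_pd[OF \<psi>] b unfolding harmonic_field_def by (intro sum.cong refl) blast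
  also have "\<dots> = (\<Sum>c\<in>Basis. LINT x|borel_on D. (H x \<bullet> c) * pd c (pd b \<psi>) x)"
    using b by (intro sum.cong refl) (simp add: test_functions_pd_symmetric[OF \<psi>, THEN fun_cong])
  also have "\<dots> = (LINT x|borel_on D. (\<Sum>c\<in>Basis. (H x \<bullet> c) * pd c (pd b \<psi>) x))"
    using integrable_inner_test[OF Hi t] b
    by (intro Bochner_Integration.integral_sum[symmetric]) auto
  also have "\<dots> = (LINT x|borel_on D. H x \<bullet> grad (pd b \<psi>) x)"
    unfolding grad_def inner_sum_right by (simp add: mult.commute)
  also have "\<dots> = 0" using H test_functions_pd[OF \<psi> b] by (auto simp: harmonic_field_def)
  finally show ?thesis .
qed

lemma integrable_scaleR_bounded:
  fixes f :: "'a \<Rightarrow> 'b::euclidean_space" and g :: "'a \<Rightarrow> real"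
  assumes "integrable M f" "g \<in> borel_measurable M" "\<And>x. x \<in> space M \<Longrightarrow> \<bar>g x\<bar> \<le> B"
  shows "integrable M (\<lambda>x. g x *\<^sub>R f x)" "norm (LINT x|M. g x *\<^sub>R f x) \<le> B * (LINT x|M. norm (f x))"
proof -
  have [measurable]: "f \<in> borel_measurable M" "g \<in> borel_measurable M" using assms by auto
  have "integrable M (\<lambda>x. norm (f x) * g x)"
    using assms by (intro integrable_mult_bounded) auto
  then have "integrable M (\<lambda>x. norm (g x *\<^sub>R f x))"
    by (drule_tac integrable_abs) (simp add: abs_mult mult.commute)
  then show i: "integrable M (\<lambda>x. g x *\<^sub>R f x)"
    by (subst (asm) integrable_norm_iff) auto
  have "norm (LINT x|M. g x *\<^sub>R f x) \<le> (LINT x|M. norm (g x *\<^sub>R f x))" by (rule integral_norm_bound)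
  also have "\<dots> \<le> (LINT x|M. B * norm (f x))"
    using i assms by (intro integral_mono integrable_norm integrable_mult_right) (auto intro: mult_right_mono)
  finally show "norm (LINT x|M. g x *\<^sub>R f x) \<le> B * (LINT x|M. norm (f x))" by simp
qed

text \<open>
  By Weyl's lemma \<open>H\<close> agrees on the inner part of the cube with its mollification \<open>h\<close> at a scale comparable
  to \<open>r\<close>. The mollifier is Lipschitz with constant of order \<open>r\<close> to the power \<open>- DIM('a) - 1\<close>, so \<open>h\<close> is
  Lipschitz with a constant controlled by the \<open>L\<^sup>1\<close> norm of \<open>H - c\<close>, for any constant \<open>c\<close>. The new constant
  is \<open>c' = h x0\<close>.
\<close>

lemma harmonic_field_oscillation:
  obtains C where "C > 0" "\<And>x0 r H c. r > 0 \<Longrightarrow> harmonic_field (cube x0 r) H \<Longrightarrow>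
    \<exists>c'. norm (c' - c) \<le> C * cube_norm x0 r (\<lambda>x::'a::euclidean_space. H x - c) \<and>
      (\<forall>t. 0 < t \<and> t \<le> 1/2 \<longrightarrow> cube_norm x0 (t * r) (\<lambda>x. H x - c') \<le> C * t * cube_norm x0 r (\<lambda>x. H x - c))"
proof -
  let ?n = "DIM('a)"
  let ?m = "mollifier_mass TYPE('a)"
  have m: "?m > 0" by (rule mollifier_mass_pos)
  obtain K where K: "K > 0" "\<And>s x y::'a. s > 0 \<Longrightarrow> \<bar>mollifier s y x\<bar> \<le> K * s ^ DIM('a)"
    "\<And>s x y z::'a. s > 0 \<Longrightarrow> \<bar>mollifier s y x - mollifier s z x\<bar> \<le> K * s ^ (DIM('a) + 1) * dist y z"
    using mollifier_bounds by blast
  define C where "C = K / ?m * 8 * 16 ^ ?n * ?n"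
  have C: "C > 0" using K m by (simp add: C_def)
  have "\<exists>c'. norm (c' - c) \<le> C * cube_norm x0 r (\<lambda>x. H x - c) \<and>
      (\<forall>t. 0 < t \<and> t \<le> 1/2 \<longrightarrow> cube_norm x0 (t * r) (\<lambda>x. H x - c') \<le> C * t * cube_norm x0 r (\<lambda>x. H x - c))"
    if r: "r > 0" and H: "harmonic_field (cube x0 r) H" for x0 :: 'a and r H c
  proof -
    let ?D = "cube x0 r"
    interpret finite_measure "borel_on ?D" by (rule finite_measure_cube)
    have Hs: "H \<in> L2_space (borel_on ?D)" using H by (simp add: harmonic_field_def)
    have Hcs: "(\<lambda>x. H x - c) \<in> L2_space (borel_on ?D)"
      by (intro L2_space_diff Hs L2_space_const)
    have Hi: "integrable (borel_on ?D) H" using Hs by (rule L2_space_integrable)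
    have Hci: "integrable (borel_on ?D) (\<lambda>x. H x - c)" using Hcs by (rule L2_space_integrable)
    define N where "N = cube_norm x0 r (\<lambda>x. H x - c)"
    have N: "N \<ge> 0" using r by (simp add: N_def)
    define V where "V = (2 * r) ^ ?n"
    have V: "V > 0" using r by (simp add: V_def)
    have int1: "(LINT x|borel_on ?D. norm (H x - c)) \<le> V * N"
    proof -
      have "(LINT x|borel_on ?D. norm (H x - c)) \<le> sqrt V * L2_norm (borel_on ?D) (\<lambda>x. H x - c)"
        using L2_space_integrable(2)[OF Hcs] r by (simp add: measure_cube V_def)
      also have "\<dots> = sqrt V * (sqrt V * N)" using L2_norm_cube[OF r, of x0 "\<lambda>x. H x - c"] by (simp add: V_def N_def)
      also have "\<dots> = V * N" using V by (simp flip: mult.assoc)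
      finally show ?thesis .
    qed
    \<comment> \<open>Mollifiers of scale above \<open>a\<close> have radius below \<open>r / 4\<close> and fit into the cube around any point of \<open>U\<close>; \<open>s\<close> is one such scale.\<close>
    define s where "s = 8 / r"
    define a where "a = 4 / r"
    have s: "s > 0" "a > 0" "s > a" using r by (auto simp: s_def a_def divide_strict_right_mono)
    define U where "U = box (x0 - (3/4 * r) *\<^sub>R One) (x0 + (3/4 * r) *\<^sub>R One)"
    have Uc: "U \<subseteq> cube x0 (3/4 * r)" unfolding U_def cube_def by (rule box_subset_cbox)
    have UD: "U \<subseteq> ?D" using Uc cube_mono[of "3/4 * r" r x0] r by auto
    have subU: "cube x0 (r / 2) \<subseteq> U"
    proof
      fix y assume y: "y \<in> cube x0 (r / 2)"
      show "y \<in> U" unfolding U_def mem_box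
      proof
        fix b :: 'a assume b: "b \<in> Basis"
        with y have "\<bar>y \<bullet> b - x0 \<bullet> b\<bar> \<le> r / 2" by (auto simp: mem_cube inner_diff_left)
        then show "(x0 - (3/4 * r) *\<^sub>R One) \<bullet> b < y \<bullet> b \<and> y \<bullet> b < (x0 + (3/4 * r) *\<^sub>R One) \<bullet> b"
          using b r by (simp add: inner_diff_left inner_add_left abs_le_iff) argo
      qed
    qed
    have ball: "cball y (1 / q) \<subseteq> ?D" if "y \<in> U" "q > a" for y q
    proof (rule cball_subset_cube[of y _ "3/4 * r"])
      show "y \<in> cube x0 (3/4 * r)" using that Uc by auto
      have "q > 0" using that(2) s(2) by linarith
      then have "1 / q \<le> r / 4" using that(2) r by (simp add: a_def field_simps)
      then show "3/4 * r + 1 / q \<le> r" by simp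
    qed
    define h where "h y = (1 / ?m) *\<^sub>R (LINT x|borel_on ?D. mollifier s y x *\<^sub>R H x)" for y
    have mm: "mollifier s y \<in> borel_measurable (borel_on ?D)" for y
      by (intro borel_on_measurable mollifier_measurable)
    have mi: "integrable (borel_on ?D) (\<lambda>x. mollifier s y x *\<^sub>R H x)" for y
      by (rule integrable_scaleR_bounded(1)[OF Hi mm K(2)[OF s(1)]])
    have mc: "integrable (borel_on ?D) (\<lambda>x. mollifier s y x *\<^sub>R c)" for y
      by (rule integrable_scaleR_bounded(1)[OF integrable_const mm K(2)[OF s(1)]])
    have "AE y in lborel. y \<in> U \<longrightarrow> h y \<bullet> b = H y \<bullet> b" if b: "b \<in> Basis" for b
    proof -
      have "AE y in lborel. y \<in> U \<longrightarrow> (LINT x|borel_on ?D. (H x \<bullet> b) * mollifier s y x) = ?m * (H y \<bullet> b)"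
      proof (rule Weyl_lemma[OF _ _ _ _ UD s(2) _ s(3)])
        fix y q assume yq: "y \<in> U" "q > a"
        have "radial 1 q y \<in> test_functions ?D"
          using yq s(2) ball[OF yq] by (intro radial_test_function) auto
        then show "(LINT x|borel_on ?D. (H x \<bullet> b) * laplacian (radial 1 q y) x) = 0"
          by (intro harmonic_field_laplacian[OF H _ _ _ b]) auto
      qed (use Hi in \<open>auto simp: U_def\<close>)
      moreover have "h y \<bullet> b = (1 / ?m) * (LINT x|borel_on ?D. (H x \<bullet> b) * mollifier s y x)" for y
        unfolding h_def using integral_inner_left[OF mi[of y], of b] by (simp add: mult.commute)
      ultimately show ?thesis using m by (auto elim!: eventually_mono)
    qed
    then have "AE y in lborel. \<forall>b\<in>Basis. y \<in> U \<longrightarrow> h y \<bullet> b = H y \<bullet> b"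
      by (intro AE_finite_allI) auto
    then have hH: "AE y in lborel. y \<in> U \<longrightarrow> h y = H y"
      by eventually_elim (auto intro: euclidean_eqI)
    have mass: "(LINT x|borel_on ?D. mollifier s y x) = ?m" if "y \<in> U" for y
    proof -
      have "mollifier s y \<in> test_functions ?D"
        using s ball[OF that s(3)] by (intro mollifier_test_function) auto
      then have "(LINT x|borel_on ?D. mollifier s y x) = (LINT x|lborel. mollifier s y x)"
        by (intro integral_borel_on_UNIV) (auto dest: test_functions_zero_outside)
      then show ?thesis using mollifier_integral[OF s(1), of y] by simp
    qed
    have hc: "h y - c = (1 / ?m) *\<^sub>R (LINT x|borel_on ?D. mollifier s y x *\<^sub>R (H x - c))" if "y \<in> U" for y
    proof -
      have "(LINT x|borel_on ?D. mollifier s y x *\<^sub>R (H x - c)) = (LINT x|borel_on ?D. mollifier s y x *\<^sub>R H x) - (LINT x|borel_on ?D. mollifier s y x *\<^sub>R c)"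
        using mi mc by (simp add: scaleR_diff_right)
      also have "(LINT x|borel_on ?D. mollifier s y x *\<^sub>R c) = (LINT x|borel_on ?D. mollifier s y x) *\<^sub>R c"
        using integrable_mult_bounded[of "borel_on ?D" "\<lambda>x. 1" "mollifier s y", OF integrable_const mm K(2)[OF s(1)]]
        by (intro integral_scaleR_left) simp
      finally show ?thesis using m mass[OF that] by (simp add: h_def scaleR_diff_right)
    qed
    have x0U: "x0 \<in> U" using subU r by (auto simp: mem_cube)
    have sV: "s ^ ?n * V = 16 ^ ?n"
    proof -
      have "s ^ ?n * V = (s * (2 * r)) ^ ?n" by (simp only: V_def power_mult_distrib)
      also have "s * (2 * r) = 16" using r by (simp add: s_def)
      finally show ?thesis .
    qed
    have 1: "norm (h x0 - c) \<le> C * N"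
    proof -
      have "norm (h x0 - c) \<le> (1 / ?m) * (K * s ^ ?n * (LINT x|borel_on ?D. norm (H x - c)))"
        unfolding hc[OF x0U] using integrable_scaleR_bounded(2)[OF Hci mm K(2)[OF s(1)], of x0] m
        by (simp add: divide_right_mono)
      also have "\<dots> \<le> (1 / ?m) * (K * s ^ ?n * (V * N))"
        using m K s int1 by (intro mult_left_mono) auto
      also have "\<dots> = K / ?m * (s ^ ?n * V) * N" by simp
      also have "\<dots> \<le> C * N"
      proof (rule mult_right_mono[OF _ N])
        have "1 \<le> 8 * real ?n" using DIM_positive[where 'a='a] by linarith
        then have "K / ?m * 16 ^ ?n * 1 \<le> K / ?m * 16 ^ ?n * (8 * real ?n)"
          using K m by (intro mult_left_mono) auto
        then show "K / ?m * (s ^ ?n * V) \<le> C" unfolding sV C_def by (simp add: mult_ac)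
      qed
      finally show ?thesis .
    qed
    have 2: "cube_norm x0 (t * r) (\<lambda>x. H x - h x0) \<le> C * t * N" if t: "0 < t" "t \<le> 1/2" for t
    proof -
      have sub: "cube x0 (t * r) \<subseteq> U" using subU cube_mono[of "t * r" "r / 2" x0] t r by (auto simp: field_simps)
      have dist: "norm (h y - h x0) \<le> C * t * N" if y: "y \<in> cube x0 (t * r)" for y
      proof -
        have yU: "y \<in> U" using y sub by auto
        have mH: "integrable (borel_on ?D) (\<lambda>x. mollifier s z x *\<^sub>R (H x - c))" for z
          by (rule integrable_scaleR_bounded(1)[OF Hci mm K(2)[OF s(1)]])
        have "h y - h x0 = (h y - c) - (h x0 - c)" by simp
        also have "\<dots> = (1 / ?m) *\<^sub>R (LINT x|borel_on ?D. (mollifier s y x - mollifier s x0 x) *\<^sub>R (H x - c))"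
          unfolding hc[OF yU] hc[OF x0U] using mH by (simp add: scaleR_diff_left flip: scaleR_diff_right)
        finally have "norm (h y - h x0) = (1 / ?m) * norm (LINT x|borel_on ?D. (mollifier s y x - mollifier s x0 x) *\<^sub>R (H x - c))"
          using m by simp
        also have "\<dots> \<le> (1 / ?m) * ((K * s ^ (?n + 1) * dist y x0) * (LINT x|borel_on ?D. norm (H x - c)))"
          using m mm by (intro mult_left_mono integrable_scaleR_bounded(2)[OF Hci _ K(3)[OF s(1)]]) auto
        also have "\<dots> \<le> (1 / ?m) * ((K * s ^ (?n + 1) * (real ?n * (t * r))) * (V * N))"
          using m K(1) s int1 norm_le_cube[OF y] V N t r
          by (intro mult_left_mono mult_mono) (auto simp: dist_norm)
        also have "\<dots> = K / ?m * (s ^ ?n * V) * (s * r) * real ?n * t * N" by (simp add: mult_ac)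
        also have "\<dots> = C * t * N" unfolding sV C_def using r by (simp add: s_def)
        finally show ?thesis .
      qed
      show ?thesis
      proof (rule cube_norm_bounded)
        show "(\<lambda>x. H x - h x0) \<in> borel_measurable (borel_on (cube x0 (t * r)))"
          using L2_space_subset(1)[OF L2_space_diff[OF Hs L2_space_const]] sub UD
          by (intro L2_space_measurable) auto
        have "AE y in lborel. y \<in> cube x0 (t * r) \<longrightarrow> norm (H y - h x0) \<le> C * t * N"
          using hH
        proof eventually_elim
          case (elim y)
          show ?case
          proof
            assume y: "y \<in> cube x0 (t * r)"
            then have "h y = H y" using elim sub by blast
            with dist[OF y] show "norm (H y - h x0) \<le> C * t * N" by simp
          qed
        qed
        then show "AE y in borel_on (cube x0 (t * r)). norm (H y - h x0) \<le> C * t * N"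
          by (subst AE_restrict_space_iff) auto
      qed (use t r C N in auto)
    qed
    show ?thesis using 1 2 unfolding N_def by blast
  qed
  then show ?thesis using that[OF C] by blast
qed

section \<open>Freezing the coefficients\<close>

lemma continuous_on_if_Hoelder:
  fixes f :: "'a::metric_space \<Rightarrow> 'b::real_normed_vector"
  assumes "0 < \<alpha>" "\<And>x y. x \<in> S \<Longrightarrow> y \<in> S \<Longrightarrow> norm (f x - f y) \<le> L * dist x y powr \<alpha>"
  shows "continuous_on S f"
  unfolding continuous_on_def
proof
  fix x assume x: "x \<in> S"
  have "((\<lambda>y. L * dist y x powr \<alpha>) \<longlongrightarrow> L * 0) (at x within S)"
    using assms(1) by (intro tendsto_mult tendsto_const tendsto_zero_powrI[of "\<lambda>y. dist y x" _ "\<lambda>y. \<alpha>" \<alpha>]) (auto intro!: tendsto_eq_intros)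
  then have "((\<lambda>y. f y - f x) \<longlongrightarrow> 0) (at x within S)"
    using assms(2) x by (intro Lim_null_comparison[of "\<lambda>y. f y - f x" "\<lambda>y. L * dist y x powr \<alpha>"]) (auto simp: eventually_at_filter)
  then show "(f \<longlongrightarrow> f x) (at x within S)" by (simp add: LIM_zero_iff)
qed

lemma borel_on_measurable_continuous_on:
  fixes f :: "'a::euclidean_space \<Rightarrow> 'b::euclidean_space"
  assumes "continuous_on D f"
  shows "f \<in> borel_measurable (borel_on D)"
  using borel_measurable_continuous_on_restrict[OF assms] measurable_cong_sets[OF sets_restrict_space_cong[OF sets_lborel]] by blast

text \<open>
  The equation for the gradient field \<open>g\<close> alone: the potential has been eliminated, and all that is kept of
  it is that \<open>g\<close> is weakly curl-free. Representatives have been chosen so that \<open>g\<close> is Borel measurable and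
  the bounds on the coefficients hold at every point.
\<close>

locale divergence_form_equation =
  fixes \<Omega> :: "'a::euclidean_space set" and g :: "'a \<Rightarrow> 'a" and a :: "'a \<Rightarrow> real" and F :: "'a \<Rightarrow> 'a"
    and a_low L \<alpha> :: real
  assumes \<Omega>: "open \<Omega>" "bounded \<Omega>"
    and g: "g \<in> L2_space (borel_on \<Omega>)"
    and curl_free: "\<And>\<phi> b c. \<phi> \<in> test_functions \<Omega> \<Longrightarrow> b \<in> Basis \<Longrightarrow> c \<in> Basis \<Longrightarrow>
       (LINT x|borel_on \<Omega>. (g x \<bullet> b) * pd c \<phi> x) = (LINT x|borel_on \<Omega>. (g x \<bullet> c) * pd b \<phi> x)"
    and equation: "\<And>\<phi>. \<phi> \<in> test_functions \<Omega> \<Longrightarrow> (LINT x|borel_on \<Omega>. (a x *\<^sub>R g x + F x) \<bullet> grad \<phi> x) = 0"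
    and elliptic: "a_low > 0" "\<And>x. x \<in> \<Omega> \<Longrightarrow> a_low \<le> a x"
    and \<alpha>: "0 < \<alpha>" "\<alpha> < 1" and L: "L \<ge> 0"
    and a_Hoelder: "\<And>x y. x \<in> \<Omega> \<Longrightarrow> y \<in> \<Omega> \<Longrightarrow> \<bar>a x - a y\<bar> \<le> L * dist x y powr \<alpha>"
    and F_Hoelder: "\<And>x y. x \<in> \<Omega> \<Longrightarrow> y \<in> \<Omega> \<Longrightarrow> norm (F x - F y) \<le> L * dist x y powr \<alpha>"
begin

lemma Borel_coefficients:
  assumes "D \<in> sets borel" "D \<subseteq> \<Omega>"
  shows "a \<in> borel_measurable (borel_on D)" "F \<in> borel_measurable (borel_on D)"
proof -
  show "a \<in> borel_measurable (borel_on D)"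
    using a_Hoelder assms(2) \<alpha>(1) by (intro borel_on_measurable_continuous_on continuous_on_if_Hoelder[of \<alpha> _ _ L]) auto
  show "F \<in> borel_measurable (borel_on D)"
    using F_Hoelder assms(2) \<alpha>(1) by (intro borel_on_measurable_continuous_on continuous_on_if_Hoelder[of \<alpha> _ _ L]) auto
qed

lemma oscillation_on_cube:
  assumes "cube x0 r \<subseteq> \<Omega>" "r > 0" "x \<in> cube x0 r"
  shows "\<bar>a x0 - a x\<bar> \<le> L * (real DIM('a) * r) powr \<alpha>" "norm (F x0 - F x) \<le> L * (real DIM('a) * r) powr \<alpha>"
proof -
  have x: "x0 \<in> \<Omega>" "x \<in> \<Omega>" using assms by (auto simp: mem_cube subset_iff)
  have "dist x0 x powr \<alpha> \<le> (real DIM('a) * r) powr \<alpha>"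
    using norm_le_cube[OF assms(3)] \<alpha> by (intro powr_mono2) (auto simp: dist_norm norm_minus_commute)
  then have "L * dist x0 x powr \<alpha> \<le> L * (real DIM('a) * r) powr \<alpha>" using L by (rule mult_left_mono)
  then show "\<bar>a x0 - a x\<bar> \<le> L * (real DIM('a) * r) powr \<alpha>" "norm (F x0 - F x) \<le> L * (real DIM('a) * r) powr \<alpha>"
    using a_Hoelder[OF x] F_Hoelder[OF x] by linarith+
qed

text \<open>
  Here \<open>p\<close> is the projection of \<open>g\<close> onto the closure of the gradients of test functions of the cube. Then
  \<open>g - p\<close> is orthogonal to those gradients, that is, divergence-free, and it is curl-free because \<open>g\<close> is and
  \<open>p\<close> is a limit of gradients. It is the harmonic replacement of \<open>g\<close>, found without solving a boundary
  value problem.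

  Gradients of test functions are orthogonal to \<open>a g + F\<close>, by the equation, and to the constant \<open>F x0\<close>.
  So their inner product with \<open>a x0 g\<close> is that with \<open>(a x0 - a) g + (F x0 - F)\<close>. Testing with \<open>p\<close> itself
  bounds \<open>p\<close> by this field, which is small on small cubes.
\<close>

lemma gradient_projection:
  assumes r: "r > 0" and sub: "cube x0 r \<subseteq> \<Omega>"
  obtains p where "p \<in> L2_space (borel_on (cube x0 r))" "harmonic_field (cube x0 r) (\<lambda>x. g x - p x)"
    "a_low * L2_norm (borel_on (cube x0 r)) p \<le> L2_norm (borel_on (cube x0 r)) (\<lambda>x. (a x0 - a x) *\<^sub>R g x + (F x0 - F x))"
    "(\<lambda>x. (a x0 - a x) *\<^sub>R g x + (F x0 - F x)) \<in> L2_space (borel_on (cube x0 r))"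
proof -
  let ?D = "cube x0 r"
  let ?M = "borel_on ?D"
  interpret finite_measure ?M by (rule finite_measure_cube)
  have x0: "x0 \<in> \<Omega>" using sub r by (auto simp: mem_cube subset_iff)
  have \<Omega>b: "\<Omega> \<in> sets borel" using \<Omega> by auto
  have gs: "g \<in> L2_space ?M"
    using L2_space_subset(1)[OF g _ \<Omega>b sub] by simp
  have [measurable]: "a \<in> borel_measurable ?M" "F \<in> borel_measurable ?M" "g \<in> borel_measurable ?M"
    using Borel_coefficients[OF _ sub] L2_space_measurable[OF gs] by auto
  define R where "R x = (a x0 - a x) *\<^sub>R g x + (F x0 - F x)" for x
  define Q where "Q = L * (real DIM('a) * r) powr \<alpha>"
  note Q = oscillation_on_cube[OF sub r, folded Q_def]
  have ags: "(\<lambda>x. (a x0 - a x) *\<^sub>R g x) \<in> L2_space ?M"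
    using Q(1) by (intro L2_space_bound[OF gs, of _ Q] AE_I2) (auto simp: mult_right_mono)
  have Fs: "(\<lambda>x. F x0 - F x) \<in> L2_space ?M"
    using Q(2) by (intro L2_space_bounded[of _ Q]) auto
  have Rs: "R \<in> L2_space ?M" unfolding R_def by (intro L2_space_add ags Fs)
  have grad_s: "grad \<phi> \<in> L2_space ?M" if \<phi>: "\<phi> \<in> test_functions ?D" for \<phi>
  proof -
    obtain B where "\<And>x. norm (grad \<phi> x) \<le> B" using grad_bounded[OF \<phi>] by metis
    then show ?thesis
      using grad_measurable[OF \<phi>] by (intro L2_space_bounded[of _ B]) (auto intro: borel_on_measurable)
  qed
  define V where "V = grad ` test_functions ?D"
  obtain p v where p: "p \<in> L2_space ?M" and v: "\<And>n. v n \<in> V"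
    and lim: "(\<lambda>n. L2_norm ?M (\<lambda>x. v n x - p x)) \<longlonglongrightarrow> 0"
    and orth: "\<And>w. w \<in> V \<Longrightarrow> (LINT x|?M. (g x - p x) \<bullet> w x) = 0"
  proof (rule L2_projection[OF gs, of V])
    show "V \<subseteq> L2_space ?M" using grad_s by (auto simp: V_def)
    have "(\<lambda>x. 0) \<in> test_functions ?D" by (rule test_functionsI[of _ "{}"]) (auto simp: C_k_const)
    then show "V \<noteq> {}" by (auto simp: V_def)
    show "(\<lambda>x. v x + w x) \<in> V" if vw: "v \<in> V" "w \<in> V" for v w
    proof -
      obtain \<phi> \<psi> where *: "\<phi> \<in> test_functions ?D" "\<psi> \<in> test_functions ?D" "v = grad \<phi>" "w = grad \<psi>"
        using vw unfolding V_def by blast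
      show ?thesis unfolding V_def *(3,4) grad_add[OF *(1,2), symmetric] by (intro imageI test_functions_add *(1,2))
    qed
    show "(\<lambda>x. c *\<^sub>R v x) \<in> V" if v: "v \<in> V" for v c
    proof -
      obtain \<phi> where *: "\<phi> \<in> test_functions ?D" "v = grad \<phi>" using v unfolding V_def by blast
      show ?thesis unfolding V_def *(2) grad_cmult[OF *(1), symmetric] by (intro imageI test_functions_mult C_k_const *(1))
    qed
  next
    fix p v assume pv: "p \<in> L2_space ?M" "\<And>n. v n \<in> V" "(\<lambda>n. L2_norm ?M (\<lambda>x. v n x - p x)) \<longlonglongrightarrow> 0"
      "\<And>w. w \<in> V \<Longrightarrow> (LINT x|?M. (g x - p x) \<bullet> w x) = 0"
    show thesis by (rule that[OF pv])
  qed
  have "\<forall>n. \<exists>\<phi>. \<phi> \<in> test_functions ?D \<and> v n = grad \<phi>" using v unfolding V_def by blast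
  then obtain \<phi> where \<phi>: "\<And>n. \<phi> n \<in> test_functions ?D" "\<And>n. v n = grad (\<phi> n)"
    using choice[of "\<lambda>n \<phi>. \<phi> \<in> test_functions ?D \<and> v n = grad \<phi>"] by blast
  have vs: "v n \<in> L2_space ?M" for n using grad_s \<phi> by simp
  have D_to_\<Omega>: "(LINT x|?M. f x) = (LINT x|borel_on \<Omega>. f x)" if "\<And>x. x \<notin> ?D \<Longrightarrow> f x = 0" for f :: "'a \<Rightarrow> real"
    by (rule integral_borel_on_subset[OF borel_cube \<Omega>b sub]) (use that in auto)
  have testD: "\<psi> \<in> test_functions \<Omega>" if "\<psi> \<in> test_functions ?D" for \<psi>
    using test_functions_mono[OF sub] that by auto
  have H: "harmonic_field ?D (\<lambda>x. g x - p x)"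
    unfolding harmonic_field_def
  proof (intro conjI ballI)
    show "(\<lambda>x. g x - p x) \<in> L2_space ?M" by (intro L2_space_diff gs p)
    show "(LINT x|?M. (g x - p x) \<bullet> grad \<psi> x) = 0" if "\<psi> \<in> test_functions ?D" for \<psi>
      using orth that by (auto simp: V_def)
    fix \<psi> and b c :: 'a assume \<psi>: "\<psi> \<in> test_functions ?D" and bc: "b \<in> Basis" "c \<in> Basis"
    have ts: "(\<lambda>x. pd d \<psi> x *\<^sub>R e) \<in> L2_space ?M" if d: "d \<in> Basis" for d e :: 'a
    proof -
      obtain B where "\<And>x. \<bar>pd d \<psi> x\<bar> \<le> B" using test_functions_bounded[OF test_functions_pd[OF \<psi> d]] by metis
      then show ?thesis
        using test_functions_measurable[OF test_functions_pd[OF \<psi> d]]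
        by (intro L2_space_bounded[of _ "B * norm e"] borel_on_measurable) (auto intro: mult_right_mono)
    qed
    have eq: "(LINT x|?M. (f x \<bullet> d) * pd e \<psi> x) = (LINT x|?M. f x \<bullet> (pd e \<psi> x *\<^sub>R d))" for f d e
      by (simp add: mult.commute)
    have pp: "(LINT x|?M. (p x \<bullet> b) * pd c \<psi> x) = (LINT x|?M. (p x \<bullet> c) * pd b \<psi> x)"
    proof (rule LIMSEQ_unique)
      show "(\<lambda>n. LINT x|?M. (v n x \<bullet> b) * pd c \<psi> x) \<longlonglongrightarrow> (LINT x|?M. (p x \<bullet> b) * pd c \<psi> x)"
        unfolding eq by (intro L2_tendsto_inner vs p ts bc lim)
      have "(LINT x|?M. (v n x \<bullet> b) * pd c \<psi> x) = (LINT x|?M. (v n x \<bullet> c) * pd b \<psi> x)" for n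
      proof -
        have z: "pd d \<psi> x = 0" if "d \<in> Basis" "x \<notin> ?D" for d x
          using test_functions_zero_outside[OF test_functions_pd[OF \<psi>]] that by blast
        have "(LINT x|?M. (v n x \<bullet> b) * pd c \<psi> x) = (LINT x|lborel. pd b (\<phi> n) x * pd c \<psi> x)"
          unfolding \<phi>(2) using bc z by (subst integral_borel_on_UNIV) (auto simp: grad_inner)
        also have "\<dots> = (LINT x|lborel. pd c (\<phi> n) x * pd b \<psi> x)"
          by (rule integral_pd_pd_swap[OF \<phi>(1) \<psi> bc])
        also have "\<dots> = (LINT x|?M. (v n x \<bullet> c) * pd b \<psi> x)"
          unfolding \<phi>(2) using bc z by (subst integral_borel_on_UNIV) (auto simp: grad_inner)
        finally show ?thesis .
      qed
      then show "(\<lambda>n. LINT x|?M. (v n x \<bullet> b) * pd c \<psi> x) \<longlonglongrightarrow> (LINT x|?M. (p x \<bullet> c) * pd b \<psi> x)"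
        unfolding eq by (simp only:) (intro L2_tendsto_inner vs p ts bc lim)
    qed
    have gg: "(LINT x|?M. (g x \<bullet> b) * pd c \<psi> x) = (LINT x|?M. (g x \<bullet> c) * pd b \<psi> x)"
      using curl_free[OF testD[OF \<psi>] bc] test_functions_zero_outside[OF test_functions_pd[OF \<psi>]] bc
      by (subst (1 2) D_to_\<Omega>) auto
    have split: "(LINT x|?M. ((g x - p x) \<bullet> d) * pd e \<psi> x) = (LINT x|?M. (g x \<bullet> d) * pd e \<psi> x) - (LINT x|?M. (p x \<bullet> d) * pd e \<psi> x)"
      if "e \<in> Basis" for d e
      unfolding eq using integrable_inner_L2[OF gs ts[OF that]] integrable_inner_L2[OF p ts[OF that]]
      by (simp add: inner_diff_left del: inner_scaleR_right)
    show "(LINT x|?M. ((g x - p x) \<bullet> b) * pd c \<psi> x) = (LINT x|?M. ((g x - p x) \<bullet> c) * pd b \<psi> x)"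
      unfolding split[OF bc(1)] split[OF bc(2)] gg pp ..
  qed
  have Rgrad: "(LINT x|?M. v n x \<bullet> R x) = a x0 * (LINT x|?M. v n x \<bullet> g x)" for n
  proof -
    let ?\<phi> = "\<phi> n"
    have \<phi>n: "?\<phi> \<in> test_functions ?D" by (rule \<phi>)
    have "(LINT x|?M. grad ?\<phi> x \<bullet> F x0) = (\<Sum>b\<in>Basis. (LINT x|?M. pd b ?\<phi> x) * (F x0 \<bullet> b))"
    proof -
      have "integrable ?M (\<lambda>x. pd b ?\<phi> x)" if "b \<in> Basis" for b
        using integrable_inner_L2[OF grad_s[OF \<phi>n] L2_space_const[of b]] that by (simp add: grad_inner)
      then have "(LINT x|?M. (\<Sum>b\<in>Basis. pd b ?\<phi> x * (F x0 \<bullet> b))) = (\<Sum>b\<in>Basis. (LINT x|?M. pd b ?\<phi> x) * (F x0 \<bullet> b))"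
        by (subst Bochner_Integration.integral_sum) auto
      then show ?thesis by (subst euclidean_inner) (simp add: grad_inner)
    qed
    also have "\<dots> = 0"
    proof (intro sum.neutral ballI)
      fix b :: 'a assume b: "b \<in> Basis"
      have "(LINT x|?M. pd b ?\<phi> x) = (LINT x|lborel. pd b ?\<phi> x)"
        using test_functions_zero_outside[OF test_functions_pd[OF \<phi>n b]] by (intro integral_borel_on_UNIV) auto
      then show "(LINT x|?M. pd b ?\<phi> x) * (F x0 \<bullet> b) = 0" using integral_pd_eq_0[OF \<phi>n b] by simp
    qed
    finally have F0: "(LINT x|?M. grad ?\<phi> x \<bullet> F x0) = 0" .
    have eqn: "(LINT x|?M. grad ?\<phi> x \<bullet> (a x *\<^sub>R g x + F x)) = 0"
      using equation[OF testD[OF \<phi>n]] grad_zero_outside[OF \<phi>n] by (subst D_to_\<Omega>) (auto simp: inner_commute)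
    have i1: "integrable ?M (\<lambda>x. grad ?\<phi> x \<bullet> R x)" "integrable ?M (\<lambda>x. grad ?\<phi> x \<bullet> g x)" "integrable ?M (\<lambda>x. grad ?\<phi> x \<bullet> F x0)"
      by (intro integrable_inner_L2 grad_s \<phi>n Rs gs L2_space_const)+
    have "grad ?\<phi> x \<bullet> (a x *\<^sub>R g x + F x) = a x0 * (grad ?\<phi> x \<bullet> g x) + grad ?\<phi> x \<bullet> F x0 - grad ?\<phi> x \<bullet> R x" for x
      by (simp add: R_def inner_add_right inner_diff_right algebra_simps)
    then have "0 = (LINT x|?M. a x0 * (grad ?\<phi> x \<bullet> g x) + grad ?\<phi> x \<bullet> F x0 - grad ?\<phi> x \<bullet> R x)"
      using eqn by simp
    also have "\<dots> = a x0 * (LINT x|?M. grad ?\<phi> x \<bullet> g x) + 0 - (LINT x|?M. grad ?\<phi> x \<bullet> R x)"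
      using i1 F0 by simp
    finally show ?thesis unfolding \<phi>(2) by simp
  qed
  have "(\<lambda>n. LINT x|?M. v n x \<bullet> R x) \<longlonglongrightarrow> a x0 * (LINT x|?M. p x \<bullet> g x)"
    unfolding Rgrad by (intro tendsto_mult tendsto_const L2_tendsto_inner vs p gs lim)
  moreover have "(\<lambda>n. LINT x|?M. v n x \<bullet> R x) \<longlonglongrightarrow> (LINT x|?M. p x \<bullet> R x)"
    by (intro L2_tendsto_inner vs p Rs lim)
  ultimately have pR: "(LINT x|?M. p x \<bullet> R x) = a x0 * (LINT x|?M. p x \<bullet> g x)"
    using LIMSEQ_unique by blast
  have hs: "(\<lambda>x. g x - p x) \<in> L2_space ?M" by (intro L2_space_diff gs p)
  have "(\<lambda>n. LINT x|?M. v n x \<bullet> (g x - p x)) \<longlonglongrightarrow> (LINT x|?M. p x \<bullet> (g x - p x))"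
    by (intro L2_tendsto_inner vs p hs lim)
  moreover have "(LINT x|?M. v n x \<bullet> (g x - p x)) = 0" for n using orth[OF v] by (simp add: inner_commute)
  ultimately have "(LINT x|?M. p x \<bullet> (g x - p x)) = 0" by (simp add: LIMSEQ_const_iff)
  then have pg: "(LINT x|?M. p x \<bullet> g x) = (L2_norm ?M p)\<^sup>2"
    unfolding L2_norm_power2 power2_norm_eq_inner
    using integrable_inner_L2[OF p gs] integrable_inner_L2[OF p p]
    by (simp add: inner_diff_right)
  have "a_low * (L2_norm ?M p)\<^sup>2 \<le> a x0 * (L2_norm ?M p)\<^sup>2"
    using elliptic(2)[OF x0] by (intro mult_right_mono) auto
  also have "\<dots> = (LINT x|?M. p x \<bullet> R x)" unfolding pR pg ..
  also have "\<dots> \<le> L2_norm ?M p * L2_norm ?M R" using L2_Cauchy_Schwarz[OF p Rs] by simp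
  finally have "L2_norm ?M p * (a_low * L2_norm ?M p) \<le> L2_norm ?M p * L2_norm ?M R"
    by (simp add: power2_eq_square mult_ac)
  then have "a_low * L2_norm ?M p \<le> L2_norm ?M R"
    using L2_norm_nonneg[of ?M p] L2_norm_nonneg[of ?M R] by (cases "L2_norm ?M p = 0") (auto simp: mult_le_cancel_left)
  then show ?thesis using that[OF p H] Rs unfolding R_def by blast
qed

text \<open>
  \<open>P\<close> is the size of the perturbation caused by freezing the coefficients; it contains \<open>norm c\<close>
  because the variation of \<open>a\<close> is multiplied by \<open>g\<close> and not by \<open>g - c\<close>.
\<close>

definition decay_step :: "real \<Rightarrow> 'a \<Rightarrow> real \<Rightarrow> 'a \<Rightarrow> 'a \<Rightarrow> bool" where
  "decay_step C x r c c' \<longleftrightarrow>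
     (let e = cube_norm x r (\<lambda>y. g y - c); P = r powr \<alpha> * (e + norm c + 1) in
      norm (c' - c) \<le> C * (e + P) \<and>
      (\<forall>t. 0 < t \<and> t \<le> 1/2 \<longrightarrow> cube_norm x (t * r) (\<lambda>y. g y - c') \<le> C * t * e + C / t ^ DIM('a) * P))"

text \<open>
  Split \<open>g\<close> by \<open>gradient_projection\<close>. The harmonic part gains the factor \<open>t\<close> by
  \<open>harmonic_field_oscillation\<close>, while the small part \<open>p\<close> loses a power of \<open>t\<close> when it is restricted to the
  smaller cube.
\<close>

lemma decay_one_step:
  obtains C where "C > 0" "\<And>x0 r c. r > 0 \<Longrightarrow> cube x0 r \<subseteq> \<Omega> \<Longrightarrow> \<exists>c'. decay_step C x0 r c c'"
proof -
  let ?n = "DIM('a)"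
  obtain C1 where C1: "C1 > 0" "\<And>x0 r H c. r > 0 \<Longrightarrow> harmonic_field (cube x0 r) H \<Longrightarrow>
    \<exists>c'. norm (c' - c) \<le> C1 * cube_norm x0 r (\<lambda>x::'a::euclidean_space. H x - c) \<and>
      (\<forall>t. 0 < t \<and> t \<le> 1/2 \<longrightarrow> cube_norm x0 (t * r) (\<lambda>x. H x - c') \<le> C1 * t * cube_norm x0 r (\<lambda>x. H x - c))"
    using harmonic_field_oscillation by blast
  define C2 where "C2 = L * real ?n powr \<alpha> / a_low"
  have C2: "C2 \<ge> 0" using L elliptic by (simp add: C2_def)
  define C where "C = C1 + C1 * C2 + C2"
  have C: "C > 0" "C1 \<le> C" "C1 * C2 \<le> C" "C2 + C1 * C2 \<le> C" using C1(1) C2 by (auto simp: C_def add_pos_nonneg)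
  have "\<exists>c'. decay_step C x0 r c c'"
    if r: "r > 0" and sub: "cube x0 r \<subseteq> \<Omega>" for x0 r c
  proof -
    let ?D = "cube x0 r"
    let ?M = "borel_on ?D"
    interpret finite_measure ?M by (rule finite_measure_cube)
    have gs: "g \<in> L2_space ?M"
      using L2_space_subset(1)[OF g _ _ sub] \<Omega> by simp
    have gcs: "(\<lambda>x. g x - c) \<in> L2_space ?M"
      by (intro L2_space_diff gs L2_space_const)
    define R where "R = (\<lambda>x. (a x0 - a x) *\<^sub>R g x + (F x0 - F x))"
    obtain p where p: "p \<in> L2_space ?M" and H: "harmonic_field ?D (\<lambda>x. g x - p x)"
      and pR: "a_low * L2_norm ?M p \<le> L2_norm ?M R" and Rs: "R \<in> L2_space ?M"
      unfolding R_def by (rule gradient_projection[OF r sub])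
    define e where "e = cube_norm x0 r (\<lambda>x. g x - c)"
    define P where "P = r powr \<alpha> * (e + norm c + 1)"
    have e: "e \<ge> 0" "P \<ge> 0" using r by (auto simp: e_def P_def)
    define Q where "Q = L * (real ?n * r) powr \<alpha>"
    have Q0: "Q \<ge> 0" using L by (simp add: Q_def)
    have Rb: "norm (R x) \<le> norm (Q * (norm (g x) + 1))" if "x \<in> ?D" for x
    proof -
      note * = oscillation_on_cube[OF sub r that, folded Q_def]
      have "norm (R x) \<le> \<bar>a x0 - a x\<bar> * norm (g x) + norm (F x0 - F x)"
        unfolding R_def by (rule order.trans[OF norm_triangle_ineq]) simp
      also have "\<dots> \<le> Q * norm (g x) + Q" using * by (intro add_mono mult_right_mono) auto
      finally show ?thesis using Q0 by (simp add: distrib_left abs_mult)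
    qed
    have ns: "(\<lambda>x. norm (g x) + 1) \<in> L2_space ?M"
      using L2_space_measurable[OF gs]
      by (intro L2_space_add L2_space_const L2_space_bound[OF gs, of _ 1]) auto
    have "L2_norm ?M R \<le> L2_norm ?M (\<lambda>x. Q *\<^sub>R (norm (g x) + 1))"
      using Rb by (intro L2_norm_mono L2_space_scaleR ns L2_space_measurable[OF Rs] AE_I2) auto
    also have "\<dots> = Q * L2_norm ?M (\<lambda>x. norm (g x) + 1)" unfolding L2_norm_scaleR using Q0 by simp
    finally have LR: "L2_norm ?M R \<le> Q * L2_norm ?M (\<lambda>x. norm (g x) + 1)" .
    have "cube_norm x0 r (\<lambda>x. norm (g x) + 1) \<le> cube_norm x0 r (\<lambda>x. norm (g x)) + cube_norm x0 r (\<lambda>x. 1::real)"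
      using L2_space_measurable[OF gs]
      by (intro cube_norm_add r L2_space_const L2_space_bound[OF gs, of _ 1]) auto
    also have "\<dots> = cube_norm x0 r g + 1"
    proof -
      have "cube_norm x0 r (\<lambda>x. norm (g x)) = cube_norm x0 r g" by (simp add: cube_norm_def L2_norm_def)
      then show ?thesis using cube_norm_const[OF r, of x0 "1::real"] by simp
    qed
    also have "cube_norm x0 r g \<le> e + norm c"
      using cube_norm_add[OF r gcs L2_space_const, of c] cube_norm_const[OF r, of x0 c] by (simp add: e_def)
    finally have gn: "cube_norm x0 r (\<lambda>x. norm (g x) + 1) \<le> e + norm c + 1" by simp
    have "a_low * cube_norm x0 r p \<le> Q * cube_norm x0 r (\<lambda>x. norm (g x) + 1)"
      using divide_right_mono[OF order.trans[OF pR LR], of "sqrt ((2 * r) ^ ?n)"] r by (simp add: cube_norm_def)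
    also have "\<dots> \<le> Q * (e + norm c + 1)" using gn Q0 by (rule mult_left_mono)
    finally have pP: "cube_norm x0 r p \<le> C2 * P"
      using elliptic r by (simp add: C2_def P_def Q_def powr_mult field_simps)
    define N where "N = cube_norm x0 r (\<lambda>x. (g x - p x) - c)"
    have "N \<le> e + cube_norm x0 r p"
    proof -
      have "(\<lambda>x. (g x - p x) - c) = (\<lambda>x. (g x - c) - p x)" by (simp add: fun_eq_iff)
      then show ?thesis using cube_norm_diff[OF r gcs p] unfolding N_def e_def by simp
    qed
    then have N: "N \<le> e + C2 * P" using pP by simp
    from C1(2)[OF r H, of c] obtain c' where c': "norm (c' - c) \<le> C1 * N"
      and osc: "\<And>t. 0 < t \<Longrightarrow> t \<le> 1/2 \<Longrightarrow> cube_norm x0 (t * r) (\<lambda>x. g x - p x - c') \<le> C1 * t * N"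
      unfolding N_def by blast
    have "C1 * N \<le> C1 * (e + C2 * P)" using N C1(1) by simp
    also have "\<dots> = C1 * e + (C1 * C2) * P" by (simp add: algebra_simps)
    also have "\<dots> \<le> C * e + C * P" using C e by (intro add_mono mult_right_mono) auto
    finally have 1: "norm (c' - c) \<le> C * (e + P)" using c' by (simp add: distrib_left)
    have 2: "cube_norm x0 (t * r) (\<lambda>x. g x - c') \<le> C * t * e + C / t ^ ?n * P" if t: "0 < t" "t \<le> 1/2" for t
    proof -
      have s: "cube x0 (t * r) \<subseteq> ?D" using t r by (intro cube_mono) (auto simp: field_simps)
      interpret S: finite_measure "borel_on (cube x0 (t * r))" by (rule finite_measure_cube)
      have tr: "t * r > 0" using t r by simp
      have ps: "p \<in> L2_space (borel_on (cube x0 (t * r)))" "g \<in> L2_space (borel_on (cube x0 (t * r)))"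
        using L2_space_subset(1)[OF _ _ _ s] p gs by auto
      have "cube_norm x0 (t * r) (\<lambda>x. g x - c') = cube_norm x0 (t * r) (\<lambda>x. p x + (g x - p x - c'))" by simp
      also have "\<dots> \<le> cube_norm x0 (t * r) p + cube_norm x0 (t * r) (\<lambda>x. g x - p x - c')"
        by (intro cube_norm_add tr ps L2_space_diff S.L2_space_const)
      also have "\<dots> \<le> cube_norm x0 r p / t ^ ?n + C1 * t * N"
        using t by (intro add_mono cube_norm_subset[OF r _ _ p s] osc) auto
      also have "\<dots> \<le> C2 * P / t ^ ?n + C1 * t * (e + C2 * P)"
        using t pP N C1(1) by (intro add_mono divide_right_mono mult_left_mono) auto
      also have "\<dots> = C1 * (t * e) + (C2 * (P / t ^ ?n) + C1 * C2 * (t * P))" by (simp add: algebra_simps)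
      also have "\<dots> \<le> C * (t * e) + C * (P / t ^ ?n)"
      proof (rule add_mono)
        show "C1 * (t * e) \<le> C * (t * e)" using C e t by (intro mult_right_mono) auto
        have "t * P \<le> P / t ^ ?n"
        proof -
          have "t * t ^ ?n \<le> 1" using t power_le_one[of t "Suc ?n"] by simp
          then have "t * t ^ ?n * P \<le> 1 * P" using e(2) by (rule mult_right_mono)
          then show ?thesis using t by (simp add: field_simps)
        qed
        then have "C2 * (P / t ^ ?n) + C1 * C2 * (t * P) \<le> C2 * (P / t ^ ?n) + C1 * C2 * (P / t ^ ?n)"
          using C1 C2 by (intro add_left_mono mult_left_mono) auto
        also have "\<dots> = (C2 + C1 * C2) * (P / t ^ ?n)" by (simp only: distrib_right)
        also have "\<dots> \<le> C * (P / t ^ ?n)" using C e t by (intro mult_right_mono) auto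
        finally show "C2 * (P / t ^ ?n) + C1 * C2 * (t * P) \<le> C * (P / t ^ ?n)" .
      qed
      finally show ?thesis by (simp add: mult_ac)
    qed
    show ?thesis unfolding decay_step_def Let_def using 1 2 unfolding P_def e_def by blast
  qed
  then show ?thesis using that[OF C(1)] by blast
qed

end

section \<open>Campanato iteration\<close>

text \<open>
  In \<open>m k + 1 + B * e k\<close>, with \<open>B = 2 * C + 1\<close>, the contraction of \<open>e\<close> pays for the term \<open>C * e k\<close> by which \<open>m\<close> may
  grow. This quantity therefore grows by a factor of at most \<open>1 + D * q ^ k\<close> per step, and the product of these
  factors converges. So \<open>m\<close> is bounded, and the recursion for \<open>e\<close> then gives decay at the full rate \<open>q\<close>.
\<close>

lemma decay_iteration:
  fixes q C A \<rho> E0 :: real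
  assumes q: "0 < q" "q < 1" and pos: "C \<ge> 0" "A \<ge> 0" "\<rho> \<ge> 0" "E0 \<ge> 0"
  obtains K where "K \<ge> 0" "\<And>(e::nat \<Rightarrow> real) m. \<forall>k. 0 \<le> e k \<Longrightarrow> \<forall>k. 0 \<le> m k \<Longrightarrow> e 0 \<le> E0 \<Longrightarrow> m 0 \<le> E0 \<Longrightarrow>
    \<forall>k. e (Suc k) \<le> q / 2 * e k + A * (\<rho> * q ^ k * (e k + m k + 1)) \<Longrightarrow>
    \<forall>k. m (Suc k) \<le> m k + C * (e k + \<rho> * q ^ k * (e k + m k + 1)) \<Longrightarrow>
    \<forall>k. e k \<le> K * q ^ k \<and> m k \<le> K"
proof -
  define B where "B = 2 * C + 1"
  define D where "D = (C + B * A) * \<rho>"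
  define T where "T = (E0 + 1 + B * E0) * exp (D * (1 / (1 - q)))"
  define X where "X = E0 + 2 * A * \<rho> * T / q"
  have B: "B \<ge> 1" using pos by (simp add: B_def)
  have D: "D \<ge> 0" using pos B by (simp add: D_def)
  have T: "T \<ge> 0" using pos B by (simp add: T_def)
  have X: "X \<ge> E0" "X \<ge> 0" using pos T q by (simp_all add: X_def)
  have sum: "(\<Sum>j<k. q ^ j) \<le> 1 / (1 - q)" for k
    using q by (simp add: sum_gp_strict divide_right_mono)
  have main: "e k \<le> (X + T) * q ^ k \<and> m k \<le> X + T"
    if e: "\<And>k. 0 \<le> e k" and m: "\<And>k. 0 \<le> m k" and "e 0 \<le> E0" "m 0 \<le> E0"
      and e_step: "\<And>k. e (Suc k) \<le> q / 2 * e k + A * (\<rho> * q ^ k * (e k + m k + 1))"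
      and m_step: "\<And>k. m (Suc k) \<le> m k + C * (e k + \<rho> * q ^ k * (e k + m k + 1))"
    for e m :: "nat \<Rightarrow> real" and k
  proof -
    define t where "t k = m k + 1 + B * e k" for k
    have t0: "t k \<ge> 0" for k using e[of k] m[of k] B by (simp add: t_def)
    have S: "e k + m k + 1 \<le> t k" for k using mult_right_mono[OF B e[of k]] by (simp add: t_def)
    have t_step: "t (Suc k) \<le> t k * exp (D * q ^ k)" for k
    proof -
      have "B * e (Suc k) \<le> B * (q / 2 * e k + A * (\<rho> * q ^ k * (e k + m k + 1)))"
        using e_step[of k] B by (intro mult_left_mono) auto
      moreover have "q / 2 * e k \<le> 1 / 2 * e k" using q e[of k] by (intro mult_right_mono) auto
      then have "B * (q / 2 * e k) \<le> B * (1 / 2 * e k)" using B by (intro mult_left_mono) auto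
      moreover have "B * (1 / 2 * e k) + C * e k \<le> B * e k" using e[of k] by (simp add: B_def algebra_simps)
      ultimately have "t (Suc k) \<le> t k + D * q ^ k * (e k + m k + 1)"
        using m_step[of k] unfolding t_def D_def by (simp add: algebra_simps)
      also have "\<dots> \<le> t k + D * q ^ k * t k"
        using D q S[of k] by (intro add_left_mono mult_left_mono) auto
      also have "\<dots> = t k * (1 + D * q ^ k)" by (simp add: algebra_simps)
      also have "\<dots> \<le> t k * exp (D * q ^ k)"
        using t0 exp_ge_add_one_self by (intro mult_left_mono)
      finally show ?thesis .
    qed
    have "t k \<le> t 0 * exp (D * (\<Sum>j<k. q ^ j))" for k
    proof (induction k)
      case (Suc k)
      have "t (Suc k) \<le> (t 0 * exp (D * (\<Sum>j<k. q ^ j))) * exp (D * q ^ k)"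
        by (rule order.trans[OF t_step mult_right_mono[OF Suc]]) simp
      then show ?case by (simp add: distrib_left exp_add)
    qed simp
    moreover have "t 0 * exp (D * (\<Sum>j<k. q ^ j)) \<le> T" for k
      unfolding T_def
    proof (intro mult_mono)
      have "B * e 0 \<le> B * E0" using B that(3) by (intro mult_left_mono) auto
      then show "t 0 \<le> E0 + 1 + B * E0" using that(4) by (simp add: t_def)
      show "exp (D * (\<Sum>j<k. q ^ j)) \<le> exp (D * (1 / (1 - q)))"
        using mult_left_mono[OF sum D] by simp
    qed (use pos B in auto)
    ultimately have tT: "t k \<le> T" for k using order.trans by blast
    have eX: "e k \<le> X * q ^ k" for k
    proof (induction k)
      case (Suc k)
      have "e (Suc k) \<le> q / 2 * e k + A * (\<rho> * q ^ k * (e k + m k + 1))" by (rule e_step)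
      also have "\<dots> \<le> q / 2 * (X * q ^ k) + A * (\<rho> * q ^ k * T)"
        using Suc q pos order.trans[OF S tT] by (intro add_mono mult_left_mono) auto
      also have "A * (\<rho> * q ^ k * T) \<le> q / 2 * (X * q ^ k)"
      proof -
        have "2 * A * \<rho> * T / q \<le> X" using pos by (simp add: X_def)
        then have "A * \<rho> * T \<le> q / 2 * X" using q by (simp add: field_simps)
        from mult_right_mono[OF this, of "q ^ k"] q show ?thesis by (simp add: mult_ac)
      qed
      finally show ?case by simp
    qed (use that X in simp)
    have "m k \<le> T" using tT[of k] S[of k] e[of k] by linarith
    moreover have "X * q ^ k \<le> (X + T) * q ^ k" using T q by (intro mult_right_mono) auto
    ultimately show ?thesis using eX[of k] X by linarith
  qed
  show ?thesis
  proof (rule that[of "X + T"])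
    show "0 \<le> X + T" using X T by simp
    fix e m :: "nat \<Rightarrow> real"
    assume *: "\<forall>k. 0 \<le> e k" "\<forall>k. 0 \<le> m k" "e 0 \<le> E0" "m 0 \<le> E0"
      "\<forall>k. e (Suc k) \<le> q / 2 * e k + A * (\<rho> * q ^ k * (e k + m k + 1))"
      "\<forall>k. m (Suc k) \<le> m k + C * (e k + \<rho> * q ^ k * (e k + m k + 1))"
    show "\<forall>k. e k \<le> (X + T) * q ^ k \<and> m k \<le> X + T"
      by (intro allI main) (use * in blast)+
  qed
qed

lemma geometric_Cauchy_limit:
  fixes c :: "nat \<Rightarrow> 'b::banach"
  assumes q: "0 < q" "q < 1" and c: "\<And>k. norm (c (Suc k) - c k) \<le> K * q ^ k"
  obtains l where "c \<longlonglongrightarrow> l" "\<And>k. norm (l - c k) \<le> K / (1 - q) * q ^ k"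
proof -
  have s: "summable (\<lambda>k. K * q ^ k)" using q by (intro summable_mult summable_geometric) auto
  have sn: "summable (\<lambda>k. norm (c (Suc k) - c k))" using c by (intro summable_comparison_test'[OF s]) auto
  then have "summable (\<lambda>k. c (Suc k) - c k)" by (rule summable_norm_cancel)
  then have "convergent (\<lambda>n. (\<Sum>k<n. c (Suc k) - c k) + c 0)"
    by (intro convergent_add convergent_const) (simp add: summable_iff_convergent)
  then have "convergent c" by (simp add: sum_lessThan_telescope)
  then obtain l where l: "c \<longlonglongrightarrow> l" by (auto simp: convergent_def)
  have "norm (l - c k) \<le> K / (1 - q) * q ^ k" for k
  proof -
    have K: "K \<ge> 0" using order.trans[OF norm_ge_zero c[of 0]] by simp
    have "norm (c (k + n) - c k) \<le> K / (1 - q) * q ^ k * (1 - q ^ n)" for n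
    proof (induction n)
      case (Suc n)
      have "norm (c (k + Suc n) - c k) \<le> norm (c (Suc (k + n)) - c (k + n)) + norm (c (k + n) - c k)"
        using norm_triangle_ineq[of "c (Suc (k + n)) - c (k + n)" "c (k + n) - c k"] by simp
      also have "\<dots> \<le> K * q ^ (k + n) + K / (1 - q) * q ^ k * (1 - q ^ n)"
        by (intro add_mono c Suc)
      also have "\<dots> = K / (1 - q) * q ^ k * (1 - q ^ Suc n)"
        using q by (simp add: field_simps power_add)
      finally show ?case .
    qed simp
    moreover have "K / (1 - q) * q ^ k * (1 - q ^ n) \<le> K / (1 - q) * q ^ k * 1" for n
      using q K by (intro mult_left_mono) auto
    ultimately have "norm (c (k + n) - c k) \<le> K / (1 - q) * q ^ k" for n using order.trans by fastforce
    moreover have "(\<lambda>n. c (k + n)) \<longlonglongrightarrow> l" using LIMSEQ_ignore_initial_segment[OF l, of k] by (simp add: add.commute)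
    then have "(\<lambda>n. norm (c (k + n) - c k)) \<longlonglongrightarrow> norm (l - c k)" by (intro tendsto_intros)
    ultimately show ?thesis by (intro LIMSEQ_le_const2) auto
  qed
  then show ?thesis using that l by blast
qed

lemma corner_cbox_subset_cube:
  assumes "h > 0"
  shows "cbox x (x + h *\<^sub>R One) \<subseteq> cube x h"
proof
  fix y assume y: "y \<in> cbox x (x + h *\<^sub>R One)"
  have "\<bar>(y - x) \<bullet> b\<bar> \<le> h" if "b \<in> Basis" for b
  proof -
    have "x \<bullet> b \<le> y \<bullet> b \<and> y \<bullet> b \<le> x \<bullet> b + h"
      using y that by (auto simp: mem_box inner_add_left)
    then show ?thesis by (simp add: inner_diff_left abs_le_iff)
  qed
  then show "y \<in> cube x h" by (simp add: mem_cube)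
qed

text \<open>
  The box is one orthant of the cube, so passing from averages over the cube to averages over the box costs
  a factor that depends on the dimension only.
\<close>

lemma corner_average_bound:
  fixes g :: "'a::euclidean_space \<Rightarrow> 'a"
  assumes h: "h > 0" and g: "g \<in> L2_space (borel_on (cube x h))"
  defines "Q \<equiv> cbox x (x + h *\<^sub>R One)"
  shows "norm ((LINT y|borel_on Q. g y) /\<^sub>R h ^ DIM('a) - c) \<le> 2 ^ DIM('a) * cube_norm x h (\<lambda>y. g y - c)"
proof -
  let ?n = "DIM('a)"
  have sub: "Q \<subseteq> cube x h" unfolding Q_def by (rule corner_cbox_subset_cube[OF h])
  have Qb: "bounded Q" "Q \<in> sets borel" by (auto simp: Q_def bounded_cbox)
  interpret Q: finite_measure "borel_on Q" by (rule finite_measure_borel_on[OF Qb])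
  interpret D: finite_measure "borel_on (cube x h)" by (rule finite_measure_cube)
  have "measure (borel_on Q) Q = measure lborel Q" using Qb by (simp add: measure_restrict_space)
  also have "\<dots> = (\<Prod>b\<in>(Basis::'a set). (x + h *\<^sub>R One - x) \<bullet> b)"
    unfolding Q_def using h by (intro measure_lborel_cbox) (simp add: inner_add_left)
  also have "\<dots> = (\<Prod>b\<in>(Basis::'a set). h)" by (intro prod.cong) auto
  finally have mQ: "measure (borel_on Q) Q = h ^ ?n" by simp
  have gc: "(\<lambda>y. g y - c) \<in> L2_space (borel_on (cube x h))"
    by (intro L2_space_diff g D.L2_space_const)
  have gcQ: "(\<lambda>y. g y - c) \<in> L2_space (borel_on Q)"
    "L2_norm (borel_on Q) (\<lambda>y. g y - c) \<le> L2_norm (borel_on (cube x h)) (\<lambda>y. g y - c)"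
    using L2_space_subset[OF gc Qb(2) _ sub] by auto
  have gQ: "integrable (borel_on Q) g"
    using L2_space_subset(1)[OF g Qb(2) _ sub] by (intro Q.L2_space_integrable) auto
  have "(LINT y|borel_on Q. g y) - h ^ ?n *\<^sub>R c = (LINT y|borel_on Q. g y - c)"
    using gQ mQ by (simp add: space_restrict_space)
  then have "(LINT y|borel_on Q. g y) /\<^sub>R h ^ ?n - c = (LINT y|borel_on Q. g y - c) /\<^sub>R h ^ ?n"
    using h by (simp add: scaleR_diff_right flip: \<open>(LINT y|borel_on Q. g y) - h ^ ?n *\<^sub>R c = (LINT y|borel_on Q. g y - c)\<close>)
  then have "norm ((LINT y|borel_on Q. g y) /\<^sub>R h ^ ?n - c) = norm (LINT y|borel_on Q. g y - c) / h ^ ?n"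
    using h by (simp add: divide_inverse mult.commute)
  also have "norm (LINT y|borel_on Q. g y - c) \<le> (LINT y|borel_on Q. norm (g y - c))" by (rule integral_norm_bound)
  also have "\<dots> \<le> sqrt (h ^ ?n) * L2_norm (borel_on Q) (\<lambda>y. g y - c)"
    using Q.L2_space_integrable(2)[OF gcQ(1)] mQ by (simp add: space_restrict_space)
  also have "\<dots> \<le> sqrt (h ^ ?n) * L2_norm (borel_on (cube x h)) (\<lambda>y. g y - c)"
    using h by (intro mult_left_mono gcQ) auto
  also have "\<dots> = sqrt (h ^ ?n) * (sqrt (2 ^ ?n) * sqrt (h ^ ?n) * cube_norm x h (\<lambda>y. g y - c))"
    using L2_norm_cube[OF h, of x "\<lambda>y. g y - c"] by (simp add: power_mult_distrib real_sqrt_mult)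
  also have "\<dots> = h ^ ?n * sqrt (2 ^ ?n) * cube_norm x h (\<lambda>y. g y - c)"
    using h by (simp add: mult_ac flip: mult.assoc[of "sqrt (h ^ ?n)" "sqrt (h ^ ?n)"])
  also have "\<dots> \<le> h ^ ?n * 2 ^ ?n * cube_norm x h (\<lambda>y. g y - c)"
  proof (intro mult_right_mono mult_left_mono)
    have "(1::real) \<le> 2 ^ ?n" by simp
    then have "(2::real) ^ ?n * 1 \<le> 2 ^ ?n * 2 ^ ?n" by (intro mult_left_mono) auto
    then show "sqrt (2 ^ ?n) \<le> 2 ^ ?n" by (intro real_le_lsqrt) (auto simp: power2_eq_square)
  qed (use h in auto)
  finally show ?thesis using h by (simp add: divide_right_mono field_simps)
qed

context divergence_form_equation
begin

text \<open>
  The gain of order \<open>t\<close> in one step beats the desired rate of order \<open>t powr \<alpha>\<close> for small \<open>t\<close>, because \<open>\<alpha> < 1\<close>.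
\<close>

lemma decay_ratio:
  assumes "C > 0"
  obtains t where "0 < t" "t \<le> 1/2" "C * t \<le> t powr \<alpha> / 2"
proof -
  define t where "t = min (1/2) ((1 / (2 * C)) powr (1 / (1 - \<alpha>)))"
  have t: "0 < t" "t \<le> 1/2" using assms by (auto simp: t_def)
  have "t powr (1 - \<alpha>) \<le> ((1 / (2 * C)) powr (1 / (1 - \<alpha>))) powr (1 - \<alpha>)"
    using t \<alpha> by (intro powr_mono2) (auto simp: t_def)
  also have "\<dots> = 1 / (2 * C)" using \<alpha> assms by (simp add: powr_powr)
  finally have "C * t powr (1 - \<alpha>) \<le> 1 / 2" using assms by (simp add: field_simps)
  then have "C * t powr (1 - \<alpha>) * t powr \<alpha> \<le> 1 / 2 * t powr \<alpha>" by (intro mult_right_mono) auto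
  moreover have "t powr (1 - \<alpha>) * t powr \<alpha> = t" using t by (simp flip: powr_add)
  ultimately show ?thesis using that[OF t] by (simp add: mult.assoc)
qed

text \<open>
  Iterate \<open>decay_one_step\<close> on cubes of half-width \<open>t ^ k * r0\<close>, beginning with the constant 0. The initial error is
  bounded by the norm of \<open>g\<close> on \<open>\<Omega>\<close>, so \<open>K\<close> does not depend on the centre \<open>x\<close>.
\<close>

lemma Campanato_decay:
  assumes r0: "r0 > 0"
  obtains t K c where "0 < t" "t \<le> 1/2" "K \<ge> 0"
    "\<And>x k. cube x r0 \<subseteq> \<Omega> \<Longrightarrow> cube_norm x (t ^ k * r0) (\<lambda>y. g y - c x k) \<le> K * (t powr \<alpha>) ^ k"
    "\<And>x k. cube x r0 \<subseteq> \<Omega> \<Longrightarrow> norm (c x (Suc k) - c x k) \<le> K * (t powr \<alpha>) ^ k"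
    "\<And>x k. cube x r0 \<subseteq> \<Omega> \<Longrightarrow> norm (c x k) \<le> K"
proof -
  let ?n = "DIM('a)"
  obtain C where C: "C > 0" and step: "\<And>x r c. r > 0 \<Longrightarrow> cube x r \<subseteq> \<Omega> \<Longrightarrow> \<exists>c'. decay_step C x r c c'"
    by (rule decay_one_step) (rule that)
  obtain t where t: "0 < t" "t \<le> 1/2" "C * t \<le> t powr \<alpha> / 2" using decay_ratio[OF C] by blast
  define q where "q = t powr \<alpha>"
  have q: "0 < q" "q < 1" using t \<alpha> powr_less_mono2[of \<alpha> t 1] by (auto simp: q_def)
  define \<rho> where "\<rho> = r0 powr \<alpha>"
  define A where "A = C / t ^ ?n"
  define E0 where "E0 = L2_norm (borel_on \<Omega>) g / sqrt ((2 * r0) ^ ?n)"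
  have pos: "C \<ge> 0" "A \<ge> 0" "\<rho> \<ge> 0" "E0 \<ge> 0" using C t r0 by (auto simp: A_def \<rho>_def E0_def)
  obtain K where K: "K \<ge> 0" and iter: "\<And>(e::nat \<Rightarrow> real) m. \<forall>k. 0 \<le> e k \<Longrightarrow> \<forall>k. 0 \<le> m k \<Longrightarrow> e 0 \<le> E0 \<Longrightarrow> m 0 \<le> E0 \<Longrightarrow>
    \<forall>k. e (Suc k) \<le> q / 2 * e k + A * (\<rho> * q ^ k * (e k + m k + 1)) \<Longrightarrow>
    \<forall>k. m (Suc k) \<le> m k + C * (e k + \<rho> * q ^ k * (e k + m k + 1)) \<Longrightarrow>
    \<forall>k. e k \<le> K * q ^ k \<and> m k \<le> K"
    by (rule decay_iteration[OF q pos]) (rule that)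
  define nxt where "nxt x r c = (SOME c'. decay_step C x r c c')" for x r c
  have nxt: "decay_step C x r c (nxt x r c)" if "r > 0" "cube x r \<subseteq> \<Omega>" for x r c
    unfolding nxt_def using step[OF that] by (rule someI_ex)
  define c where "c x = rec_nat 0 (\<lambda>k d. nxt x (t ^ k * r0) d)" for x
  have c0: "c x 0 = 0" and cS: "c x (Suc k) = nxt x (t ^ k * r0) (c x k)" for x k by (simp_all add: c_def)
  define K' where "K' = K + C * (K + \<rho> * (2 * K + 1))"
  have K': "K' \<ge> K" "K' \<ge> 0" using K C pos by (auto simp: K'_def)
  have main: "cube_norm x (t ^ k * r0) (\<lambda>y. g y - c x k) \<le> K * q ^ k \<and> norm (c x k) \<le> K \<and> norm (c x (Suc k) - c x k) \<le> K' * q ^ k"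
    if x: "cube x r0 \<subseteq> \<Omega>" for x k
  proof -
    define e where "e k = cube_norm x (t ^ k * r0) (\<lambda>y. g y - c x k)" for k
    define m where "m k = norm (c x k)" for k
    have rk: "t ^ k * r0 > 0" for k using t r0 by simp
    have sub: "cube x (t ^ k * r0) \<subseteq> \<Omega>" for k
    proof -
      have "t ^ k * r0 \<le> 1 * r0" using t r0 by (intro mult_right_mono power_le_one) auto
      then show ?thesis using cube_mono[of "t ^ k * r0" r0 x] x by auto
    qed
    have e0: "e k \<ge> 0" and m0: "m k \<ge> 0" for k using rk[of k] by (auto simp: e_def m_def)
    have rp: "(t ^ k * r0) powr \<alpha> = \<rho> * q ^ k" for k
    proof -
      have "(t ^ k * r0) powr \<alpha> = (t ^ k) powr \<alpha> * \<rho>" using t r0 by (simp add: powr_mult \<rho>_def)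
      also have "(t ^ k) powr \<alpha> = q ^ k"
        using t by (simp add: q_def powr_power powr_powr mult.commute flip: powr_realpow)
      finally show ?thesis by (simp add: mult.commute)
    qed
    have G: "decay_step C x (t ^ k * r0) (c x k) (c x (Suc k))" for k
      unfolding cS by (rule nxt[OF rk sub])
    have diff: "norm (c x (Suc k) - c x k) \<le> C * (e k + \<rho> * q ^ k * (e k + m k + 1))" for k
      using G[of k] unfolding decay_step_def Let_def rp e_def[symmetric] m_def[symmetric] by blast
    have e_step: "e (Suc k) \<le> q / 2 * e k + A * (\<rho> * q ^ k * (e k + m k + 1))" for k
    proof -
      have "e (Suc k) \<le> C * t * e k + A * (\<rho> * q ^ k * (e k + m k + 1))"
        using G[of k] t unfolding decay_step_def Let_def rp e_def[symmetric] m_def[symmetric] A_def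
        by (simp add: e_def mult.assoc)
      moreover have "C * t * e k \<le> q / 2 * e k" using t(3) e0[of k] unfolding q_def by (intro mult_right_mono)
      ultimately show ?thesis by linarith
    qed
    have m_step: "m (Suc k) \<le> m k + C * (e k + \<rho> * q ^ k * (e k + m k + 1))" for k
      using diff[of k] norm_triangle_ineq[of "c x (Suc k) - c x k" "c x k"] by (simp add: m_def)
    have "e 0 \<le> E0"
      using L2_space_subset(2)[OF g _ _ x] \<Omega> r0 unfolding e_def E0_def cube_norm_def c0
      by (simp add: divide_right_mono)
    then have bound: "e k \<le> K * q ^ k \<and> m k \<le> K" for k
      using iter[of e m] e0 m0 e_step m_step pos by (simp add: m_def c0)
    have qk: "0 < q ^ k" "q ^ k \<le> 1" using q by (auto simp: power_le_one)
    have "C * (e k + \<rho> * q ^ k * (e k + m k + 1)) \<le> C * (K * q ^ k + \<rho> * q ^ k * (2 * K + 1))"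
    proof -
      have "e k \<le> K" using bound[of k] qk K mult_left_mono[OF qk(2) K] by linarith
      then have "e k + m k + 1 \<le> 2 * K + 1" using bound[of k] by linarith
      then show ?thesis using bound[of k] qk C pos by (intro mult_left_mono add_mono) auto
    qed
    also have "\<dots> \<le> K' * q ^ k"
    proof -
      have "C * (K + \<rho> * (2 * K + 1)) * q ^ k \<le> K' * q ^ k" using K qk by (intro mult_right_mono) (auto simp: K'_def)
      then show ?thesis by (simp add: algebra_simps)
    qed
    finally have "norm (c x (Suc k) - c x k) \<le> K' * q ^ k" using diff[of k] by linarith
    then show ?thesis using bound[of k] unfolding e_def m_def by blast
  qed
  show ?thesis
  proof (rule that[OF t(1,2) K'(2), of c])
    fix x k assume x: "cube x r0 \<subseteq> \<Omega>"
    have "K * q ^ k \<le> K' * q ^ k" using K' q by (intro mult_right_mono) auto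
    then show "cube_norm x (t ^ k * r0) (\<lambda>y. g y - c x k) \<le> K' * (t powr \<alpha>) ^ k"
      using main[OF x, of k] unfolding q_def by linarith
    show "norm (c x (Suc k) - c x k) \<le> K' * (t powr \<alpha>) ^ k" using main[OF x, of k] unfolding q_def by blast
    show "norm (c x k) \<le> K'" using main[OF x, of k] K' by linarith
  qed
qed

text \<open>
  The approximating constants \<open>c x k\<close> converge to \<open>G x\<close> at the rate \<open>t powr (\<alpha> * k)\<close>, uniformly in \<open>x\<close>. For two
  points at distance comparable to \<open>r k\<close>, the cubes of half-width \<open>r k\<close> around them share a cube of half that
  size, on which \<open>g\<close> is close to both constants; this compares \<open>c x k\<close> with \<open>c y k\<close>. Averages of \<open>g\<close> over boxes
  at \<open>x\<close> stay close to \<open>c x k\<close>, so Lebesgue's differentiation theorem identifies \<open>G\<close> with \<open>g\<close>.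
\<close>

theorem interior_Hoelder_gradient:
  assumes r0: "r0 > 0"
  defines "S \<equiv> {x. cube x r0 \<subseteq> \<Omega>}"
  obtains G where "hoelder_on \<alpha> S G" "AE x in lborel. x \<in> S \<longrightarrow> g x = G x"
proof -
  let ?n = "DIM('a)"
  obtain t K c where t: "0 < t" "t \<le> 1/2" and K: "K \<ge> 0"
    and decay: "\<And>x k. cube x r0 \<subseteq> \<Omega> \<Longrightarrow> cube_norm x (t ^ k * r0) (\<lambda>y. g y - c x k) \<le> K * (t powr \<alpha>) ^ k"
    and cauchy: "\<And>x k. cube x r0 \<subseteq> \<Omega> \<Longrightarrow> norm (c x (Suc k) - c x k) \<le> K * (t powr \<alpha>) ^ k"
    and bound: "\<And>x k. cube x r0 \<subseteq> \<Omega> \<Longrightarrow> norm (c x k) \<le> K"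
    by (rule Campanato_decay[OF r0]) (rule that)
  define q where "q = t powr \<alpha>"
  have q: "0 < q" "q < 1" using t \<alpha> powr_less_mono2[of \<alpha> t 1] by (auto simp: q_def)
  define K1 where "K1 = K / (1 - q)"
  have K1: "K1 \<ge> 0" using K q by (simp add: K1_def)
  have "\<exists>l. c x \<longlonglongrightarrow> l \<and> (\<forall>k. norm (l - c x k) \<le> K1 * q ^ k)" if "x \<in> S" for x
  proof -
    have "norm (c x (Suc k) - c x k) \<le> K * q ^ k" for k using cauchy[of x k] that by (simp add: S_def q_def)
    from geometric_Cauchy_limit[OF q this] show ?thesis unfolding K1_def by metis
  qed
  then obtain G where lim: "\<And>x. x \<in> S \<Longrightarrow> c x \<longlonglongrightarrow> G x" and rate: "\<And>x k. x \<in> S \<Longrightarrow> norm (G x - c x k) \<le> K1 * q ^ k"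
    by metis
  have Gb: "norm (G x) \<le> K" if "x \<in> S" for x
    using bound[of x] that lim[OF that] by (intro LIMSEQ_le_const2[OF tendsto_norm]) (auto simp: S_def)
  define r where "r k = t ^ k * r0" for k
  have r: "r k > 0" for k using t r0 by (simp add: r_def)
  have r_le: "r k \<le> r0" for k
  proof -
    have "t ^ k * r0 \<le> 1 * r0" using t r0 by (intro mult_right_mono power_le_one) auto
    then show ?thesis by (simp add: r_def)
  qed
  have sub: "cube x (r k) \<subseteq> \<Omega>" if "x \<in> S" for x k
    using that cube_mono[OF r_le[of k], of x] by (auto simp: S_def)
  have gs: "g \<in> L2_space (borel_on (cube x (r k)))" if "x \<in> S" for x k
    using L2_space_subset(1)[OF g _ _ sub[OF that]] \<Omega> by simp
  have r0_lim: "r \<longlonglongrightarrow> 0"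
    unfolding r_def using t tendsto_mult[OF LIMSEQ_realpow_zero[of t] tendsto_const[of r0]] by simp
  have qk: "q ^ k = (r k / r0) powr \<alpha>" for k
    using t r0 by (simp add: r_def q_def powr_power powr_powr mult.commute flip: powr_realpow)
  define M where "M = 2 ^ ?n * 2 * K + 2 * K1"
  have M: "M \<ge> 0" using K K1 by (simp add: M_def)
  define C where "C = max (M * (2 / (t * r0)) powr \<alpha>) (2 * K * (2 / r0) powr \<alpha>)"
  have near: "norm (G x - G y) \<le> C * dist x y powr \<alpha>" if xy: "x \<in> S" "y \<in> S" "0 < dist x y" "2 * dist x y < r0" for x y
  proof -
    have "\<exists>j. r j \<le> 2 * dist x y"
      using order_tendstoD(2)[OF r0_lim, of "2 * dist x y"] xy(3) by (auto simp: eventually_sequentially intro: less_imp_le)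
    \<comment> \<open>The scale just before \<open>r\<close> drops below twice the distance: \<open>r (Suc k) \<le> 2 * dist x y < r k\<close>.\<close>
    define j where "j = (LEAST j. r j \<le> 2 * dist x y)"
    have j: "r j \<le> 2 * dist x y" unfolding j_def using \<open>\<exists>j. _\<close> by (rule LeastI_ex)
    have "j \<noteq> 0" using j xy(4) by (auto simp: r_def intro: ccontr)
    then obtain k where k: "j = Suc k" using not0_implies_Suc by blast
    have "\<not> r k \<le> 2 * dist x y" using not_less_Least[of k "\<lambda>j. r j \<le> 2 * dist x y"] k unfolding j_def by simp
    then have rk: "2 * dist x y < r k" by simp
    have rS: "r (Suc k) = t * r k" by (simp add: r_def)
    let ?Q = "cube x (1/2 * r k)"
    have Qx: "?Q \<subseteq> cube x (r k)" using r[of k] by (intro cube_mono) simp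
    have Qy: "?Q \<subseteq> cube y (r k)"
    proof
      fix z assume z: "z \<in> ?Q"
      show "z \<in> cube y (r k)" unfolding mem_cube
      proof
        fix b :: 'a assume b: "b \<in> Basis"
        have "\<bar>(x - y) \<bullet> b\<bar> \<le> dist x y" using Basis_le_norm[OF b] by (simp add: dist_norm)
        moreover have "\<bar>(z - x) \<bullet> b\<bar> \<le> 1/2 * r k" using z b by (auto simp: mem_cube)
        moreover have "(z - y) \<bullet> b = (z - x) \<bullet> b + (x - y) \<bullet> b" by (simp add: inner_diff_left)
        ultimately show "\<bar>(z - y) \<bullet> b\<bar> \<le> r k" using rk by linarith
      qed
    qed
    interpret Q: finite_measure "borel_on ?Q" by (rule finite_measure_cube)
    interpret X: finite_measure "borel_on (cube x (r k))" by (rule finite_measure_cube)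
    interpret Y: finite_measure "borel_on (cube y (r k))" by (rule finite_measure_cube)
    have gQ: "g \<in> L2_space (borel_on ?Q)" using L2_space_subset(1)[OF gs[OF xy(1), of k] _ _ Qx] by simp
    have "norm (c y k - c x k) = cube_norm x (1/2 * r k) (\<lambda>z. c y k - c x k)"
      using cube_norm_const[of "1/2 * r k" x "c y k - c x k"] r[of k] by simp
    also have "\<dots> = cube_norm x (1/2 * r k) (\<lambda>z. (g z - c x k) - (g z - c y k))" by simp
    also have "\<dots> \<le> cube_norm x (1/2 * r k) (\<lambda>z. g z - c x k) + cube_norm x (1/2 * r k) (\<lambda>z. g z - c y k)"
      using r[of k] by (intro cube_norm_diff L2_space_diff gQ Q.L2_space_const) auto
    also have "\<dots> \<le> cube_norm x (r k) (\<lambda>z. g z - c x k) / (1/2) ^ ?n + cube_norm y (r k) (\<lambda>z. g z - c y k) / (1/2) ^ ?n"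
      using r[of k] by (intro add_mono cube_norm_subset L2_space_diff gs xy X.L2_space_const Y.L2_space_const Qx Qy) auto
    also have "\<dots> \<le> K * q ^ k / (1/2) ^ ?n + K * q ^ k / (1/2) ^ ?n"
      using decay[of x k] decay[of y k] xy unfolding S_def r_def q_def by (intro add_mono divide_right_mono) auto
    also have "\<dots> = 2 ^ ?n * 2 * K * q ^ k" by (simp add: power_divide)
    finally have c: "norm (c y k - c x k) \<le> 2 ^ ?n * 2 * K * q ^ k" .
    have "G x - G y = (G x - c x k) - (G y - c y k) - (c y k - c x k)" by simp
    also have "norm \<dots> \<le> norm (G x - c x k) + norm (G y - c y k) + norm (c y k - c x k)"
      by (intro order.trans[OF norm_triangle_ineq4] add_mono norm_triangle_ineq4 order.refl)
    also have "\<dots> \<le> M * q ^ k" using c rate[OF xy(1), of k] rate[OF xy(2), of k] by (simp add: M_def algebra_simps)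
    finally have Gq: "norm (G x - G y) \<le> M * q ^ k" .
    have "q ^ k \<le> (2 / (t * r0) * dist x y) powr \<alpha>"
      unfolding qk
    proof (rule powr_mono2)
      have "t * r k \<le> 2 * dist x y" using j k rS by simp
      then show "r k / r0 \<le> 2 / (t * r0) * dist x y" using t r0 by (simp add: field_simps)
    qed (use \<alpha> r[of k] r0 in \<open>auto simp: less_imp_le\<close>)
    then have "M * q ^ k \<le> M * (2 / (t * r0) * dist x y) powr \<alpha>" using M by (rule mult_left_mono)
    with Gq have "norm (G x - G y) \<le> M * (2 / (t * r0) * dist x y) powr \<alpha>" by linarith
    also have "\<dots> = (M * (2 / (t * r0)) powr \<alpha>) * dist x y powr \<alpha>"
      unfolding powr_mult by simp
    also have "\<dots> \<le> C * dist x y powr \<alpha>" unfolding C_def by (intro mult_right_mono) auto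
    finally show ?thesis .
  qed
  have far: "norm (G x - G y) \<le> C * dist x y powr \<alpha>" if xy: "x \<in> S" "y \<in> S" "r0 \<le> 2 * dist x y" for x y
  proof -
    have "norm (G x - G y) \<le> 2 * K * 1" using norm_triangle_ineq4[of "G x" "G y"] Gb[OF xy(1)] Gb[OF xy(2)] by linarith
    also have "\<dots> \<le> 2 * K * (2 / r0 * dist x y) powr \<alpha>"
      using K xy(3) r0 \<alpha> by (intro mult_left_mono ge_one_powr_ge_zero) (auto simp: field_simps)
    also have "\<dots> = 2 * K * (2 / r0) powr \<alpha> * dist x y powr \<alpha>" unfolding powr_mult by simp
    also have "\<dots> \<le> C * dist x y powr \<alpha>" unfolding C_def by (intro mult_right_mono) auto
    finally show ?thesis .
  qed
  have "hoelder_on \<alpha> S G"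
    unfolding hoelder_on_def
  proof (intro conjI exI[of _ C] ballI)
    show "bounded (G ` S)" using Gb by (auto simp: bounded_iff)
    fix x y assume xy: "x \<in> S" "y \<in> S"
    show "norm (G x - G y) \<le> C * dist x y powr \<alpha>"
    proof (cases "x = y")
      case False
      then show ?thesis using near[OF xy] far[OF xy] by (cases "2 * dist x y < r0") auto
    qed simp
  qed
  moreover have "AE x in lborel. x \<in> S \<longrightarrow> g x = G x"
  proof -
    have \<Omega>b: "\<Omega> \<in> sets borel" using \<Omega> by auto
    interpret O: finite_measure "borel_on \<Omega>" by (rule finite_measure_borel_on[OF \<Omega>(2) \<Omega>b])
    have r_right: "filterlim r (at_right 0) sequentially"
      unfolding filterlim_at using r0_lim r by (auto intro!: always_eventually simp: less_imp_neq[THEN not_sym])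
    show ?thesis using Lebesgue_differentiation_corner[OF \<Omega>(1) O.L2_space_integrable(1)[OF g]]
    proof eventually_elim
      case (elim x)
      show ?case
      proof
        assume x: "x \<in> S"
        define A where "A k = (LINT y|borel_on (cbox x (x + r k *\<^sub>R One)). g y) /\<^sub>R r k ^ ?n" for k
        have "x \<in> \<Omega>" using sub[OF x, of 0] r[of 0] by (auto simp: mem_cube subset_iff)
        with elim have "((\<lambda>h. (LINT y|borel_on (cbox x (x + h *\<^sub>R One)). g y) /\<^sub>R h ^ ?n) \<longlongrightarrow> g x) (at_right 0)" by blast
        then have "A \<longlonglongrightarrow> g x" unfolding A_def using r_right by (rule filterlim_compose)
        moreover have "A \<longlonglongrightarrow> G x"
        proof -
          have "norm (A k - c x k) \<le> 2 ^ ?n * K * q ^ k" for k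
          proof -
            have "norm (A k - c x k) \<le> 2 ^ ?n * cube_norm x (r k) (\<lambda>y. g y - c x k)"
              unfolding A_def by (rule corner_average_bound[OF r gs[OF x]])
            also have "\<dots> \<le> 2 ^ ?n * (K * q ^ k)"
              using decay[of x k] x unfolding r_def q_def S_def by (intro mult_left_mono) auto
            finally show ?thesis by simp
          qed
          moreover have "(\<lambda>k. 2 ^ ?n * K * q ^ k) \<longlonglongrightarrow> 0"
            using q by (intro tendsto_mult_right_zero LIMSEQ_realpow_zero) auto
          ultimately have "(\<lambda>k. A k - c x k) \<longlonglongrightarrow> 0"
            by (intro Lim_null_comparison[of "\<lambda>k. A k - c x k" "\<lambda>k. 2 ^ ?n * K * q ^ k"]) auto
          from tendsto_add[OF this lim[OF x]] show ?thesis by simp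
        qed
        ultimately show "g x = G x" by (rule LIMSEQ_unique)
      qed
    qed
  qed
  ultimately show ?thesis by (rule that)
qed

end

section \<open>Weak solutions\<close>

lemma lebesgue_on_of_borel_on:
  fixes f :: "'a::euclidean_space \<Rightarrow> 'b::euclidean_space"
  assumes \<Omega>: "\<Omega> \<in> sets borel" and f: "f \<in> borel_measurable (borel_on \<Omega>)"
  shows "f \<in> borel_measurable (lebesgue_on \<Omega>)"
    "integrable (lebesgue_on \<Omega>) f \<longleftrightarrow> integrable (borel_on \<Omega>) f"
    "(LINT x|lebesgue_on \<Omega>. f x) = (LINT x|borel_on \<Omega>. f x)"
proof -
  have m: "(\<lambda>x. indicator \<Omega> x *\<^sub>R f x) \<in> borel_measurable lborel"
    using f \<Omega> by (subst (asm) borel_measurable_restrict_space_iff) auto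
  have \<Omega>l: "\<Omega> \<inter> space lebesgue \<in> sets lebesgue" "\<Omega> \<inter> space lborel \<in> sets lborel" using \<Omega> by auto
  show "f \<in> borel_measurable (lebesgue_on \<Omega>)"
    unfolding borel_measurable_restrict_space_iff[OF \<Omega>l(1)] using m by (rule measurable_completion)
  show "integrable (lebesgue_on \<Omega>) f \<longleftrightarrow> integrable (borel_on \<Omega>) f"
    unfolding integrable_restrict_space[OF \<Omega>l(1)] integrable_restrict_space[OF \<Omega>l(2)] using m by (rule integrable_completion)
  show "(LINT x|lebesgue_on \<Omega>. f x) = (LINT x|borel_on \<Omega>. f x)"
    unfolding integral_restrict_space[OF \<Omega>l(1)] integral_restrict_space[OF \<Omega>l(2)] using m by (rule integral_completion)
qed

lemma lebesgue_on_Borel_representative: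
  fixes f :: "'a::euclidean_space \<Rightarrow> 'b::euclidean_space"
  assumes \<Omega>: "\<Omega> \<in> sets borel" and f: "f \<in> borel_measurable (lebesgue_on \<Omega>)"
  obtains g where "g \<in> borel_measurable borel" "AE x in lebesgue_on \<Omega>. f x = g x"
proof -
  have \<Omega>l: "\<Omega> \<inter> space lebesgue \<in> sets lebesgue" using \<Omega> by auto
  have m: "(\<lambda>x. indicator \<Omega> x *\<^sub>R f x) \<in> borel_measurable lebesgue"
    using f unfolding borel_measurable_restrict_space_iff[OF \<Omega>l] .
  have "\<exists>g\<in>borel_measurable lborel. AE x in lborel. (indicator \<Omega> x *\<^sub>R f x) \<bullet> b = g x" for b
    using borel_measurable_inner[OF m borel_measurable_const[of b]] by (rule completion_ex_borel_measurable_real)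
  then obtain g where g: "\<And>b. g b \<in> borel_measurable lborel" "\<And>b. AE x in lborel. (indicator \<Omega> x *\<^sub>R f x) \<bullet> b = g b x"
    by metis
  have "AE x in lborel. \<forall>b\<in>Basis. (indicator \<Omega> x *\<^sub>R f x) \<bullet> b = g b x"
    using g(2) by (intro AE_finite_allI) auto
  then have "AE x in lebesgue. \<forall>b\<in>Basis. (indicator \<Omega> x *\<^sub>R f x) \<bullet> b = g b x" by (rule AE_completion)
  then have "AE x in lebesgue. x \<in> \<Omega> \<longrightarrow> f x = (\<Sum>b\<in>Basis. g b x *\<^sub>R b)"
  proof eventually_elim
    case (elim x)
    show ?case
    proof
      assume "x \<in> \<Omega>"
      then have "f x \<bullet> b = g b x" if "b \<in> Basis" for b using elim that by auto
      then show "f x = (\<Sum>b\<in>Basis. g b x *\<^sub>R b)"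
        by (subst euclidean_representation[symmetric]) (auto intro!: sum.cong)
    qed
  qed
  then have "AE x in lebesgue_on \<Omega>. f x = (\<Sum>b\<in>Basis. g b x *\<^sub>R b)"
    using AE_restrict_space_iff[OF \<Omega>l] by blast
  moreover have "(\<lambda>x. \<Sum>b\<in>Basis. g b x *\<^sub>R b) \<in> borel_measurable borel"
    using g(1) by (intro borel_measurable_sum borel_measurable_scaleR) auto
  ultimately show ?thesis using that by blast
qed

text \<open>
  Up to sign, both sides are the integral of \<open>u\<close> against the same mixed second derivative of \<open>\<phi>\<close>.
\<close>

lemma weak_gradient_curl_free:
  assumes "has_L2_gradient \<Omega> u G" "\<phi> \<in> test_functions \<Omega>" "b \<in> Basis" "c \<in> Basis"
  shows "(LINT x|lebesgue_on \<Omega>. (G x \<bullet> b) * pd c \<phi> x) = (LINT x|lebesgue_on \<Omega>. (G x \<bullet> c) * pd b \<phi> x)"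
proof -
  have *: "(LINT x|lebesgue_on \<Omega>. u x * pd e \<psi> x) = - (LINT x|lebesgue_on \<Omega>. (G x \<bullet> e) * \<psi> x)"
    if "\<psi> \<in> test_functions \<Omega>" "e \<in> Basis" for \<psi> e
    using assms(1) that unfolding has_L2_gradient_def by blast
  have "- (LINT x|lebesgue_on \<Omega>. (G x \<bullet> b) * pd c \<phi> x) = (LINT x|lebesgue_on \<Omega>. u x * pd b (pd c \<phi>) x)"
    using *[OF test_functions_pd[OF assms(2,4)] assms(3)] by simp
  also have "\<dots> = (LINT x|lebesgue_on \<Omega>. u x * pd c (pd b \<phi>) x)"
    by (simp only: test_functions_pd_symmetric[OF assms(2-4), THEN fun_cong])
  also have "\<dots> = - (LINT x|lebesgue_on \<Omega>. (G x \<bullet> c) * pd b \<phi> x)"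
    using *[OF test_functions_pd[OF assms(2,3)] assms(4)] by simp
  finally show ?thesis by simp
qed

text \<open>
  A ball around \<open>x\<close> meets \<open>\<Omega>\<close>; if it also met the complement, it would meet the frontier, by connectedness.
\<close>

lemma compactly_contained_ball:
  assumes "compactly_contained \<Omega>' \<Omega>" "x \<in> closure \<Omega>'"
  shows "ball x (setdist \<Omega>' (frontier \<Omega>)) \<subseteq> \<Omega>"
proof (rule ccontr)
  let ?d = "setdist \<Omega>' (frontier \<Omega>)"
  assume "\<not> ball x ?d \<subseteq> \<Omega>"
  have d: "?d > 0" and sub: "\<Omega>' \<subseteq> \<Omega>" using assms by (auto simp: compactly_contained_def)
  have "\<Omega>' \<inter> ball x ?d \<noteq> {}"
  proof -
    obtain y where "y \<in> \<Omega>'" "dist y x < ?d" using assms(2) d unfolding closure_approachable by blast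
    then have "y \<in> \<Omega>' \<inter> ball x ?d" by (simp add: dist_commute)
    then show ?thesis by blast
  qed
  then have "ball x ?d \<inter> \<Omega> \<noteq> {}" using sub by blast
  moreover have "ball x ?d - \<Omega> \<noteq> {}" using \<open>\<not> ball x ?d \<subseteq> \<Omega>\<close> by blast
  ultimately obtain z where z: "z \<in> ball x ?d" "z \<in> frontier \<Omega>"
    using connected_Int_frontier[OF connected_ball, of x ?d \<Omega>] by blast
  have "?d = setdist (closure \<Omega>') (frontier \<Omega>)" by simp
  also have "\<dots> \<le> dist x z" using assms(2) z by (intro setdist_le_dist)
  finally show False using z(1) by simp
qed

lemma cube_subset_ball:
  assumes "0 < d" "r = d / (2 * real DIM('a))"
  shows "cube (x::'a::euclidean_space) r \<subseteq> ball x d"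
proof
  fix y assume "y \<in> cube x r"
  then have "norm (y - x) \<le> real DIM('a) * r" by (rule norm_le_cube)
  also have "\<dots> < d" using assms by simp
  finally show "y \<in> ball x d" by (simp add: dist_norm norm_minus_commute)
qed

lemma hoelder_on_subset: "hoelder_on \<alpha> S f \<Longrightarrow> T \<subseteq> S \<Longrightarrow> hoelder_on \<alpha> T f"
  unfolding hoelder_on_def by (meson bounded_subset image_mono subsetD)

text \<open>
  Integrals over \<open>\<Omega>\<close> do not see the change of representatives, and Borel representatives make Fubini's
  theorem applicable.
\<close>

lemma weak_solution_Borel_problem:
  fixes \<Omega> :: "'a::euclidean_space set"
  assumes \<Omega>: "open \<Omega>" "bounded \<Omega>" and aL: "a \<in> Linfty \<Omega>" and a_low: "a_low > 0" "AE x in lebesgue_on \<Omega>. a x \<ge> a_low"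
    and u: "u \<in> H1 \<Omega>" and sol: "weak_solution \<Omega> a F u"
    and \<alpha>: "0 < \<alpha>" "\<alpha> < 1" and a: "a \<in> hoelder_closure \<alpha> \<Omega>" and F: "F \<in> hoelder_closure \<alpha> \<Omega>"
  obtains g a' F' L where "divergence_form_equation \<Omega> g a' F' a_low L \<alpha>" "AE x in lebesgue_on \<Omega>. weak_grad \<Omega> u x = g x"
proof -
  have \<Omega>b: "\<Omega> \<in> sets borel" using \<Omega> by auto
  define G0 where "G0 = weak_grad \<Omega> u"
  have G0: "has_L2_gradient \<Omega> u G0"
    using u someI_ex[of "has_L2_gradient \<Omega> u"] unfolding G0_def weak_grad_def H1_def by blast
  then have G0s: "G0 \<in> borel_measurable (lebesgue_on \<Omega>)" "integrable (lebesgue_on \<Omega>) (\<lambda>x. (norm (G0 x))\<^sup>2)"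
    by (auto simp: has_L2_gradient_def L2_def)
  obtain a1 where a1: "hoelder_on \<alpha> (closure \<Omega>) a1" "AE x in lebesgue_on \<Omega>. a x = a1 x"
    using a by (auto simp: hoelder_closure_def)
  obtain F1 where F1: "hoelder_on \<alpha> (closure \<Omega>) F1" "AE x in lebesgue_on \<Omega>. F x = F1 x"
    using F by (auto simp: hoelder_closure_def)
  obtain Ca where Ca: "\<And>x y. x \<in> \<Omega> \<Longrightarrow> y \<in> \<Omega> \<Longrightarrow> norm (a1 x - a1 y) \<le> Ca * dist x y powr \<alpha>"
    using hoelder_on_subset[OF a1(1) closure_subset] unfolding hoelder_on_def by blast
  obtain CF where CF: "\<And>x y. x \<in> \<Omega> \<Longrightarrow> y \<in> \<Omega> \<Longrightarrow> norm (F1 x - F1 y) \<le> CF * dist x y powr \<alpha>"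
    using hoelder_on_subset[OF F1(1) closure_subset] unfolding hoelder_on_def by blast
  obtain Ba where Ba: "\<And>x. x \<in> \<Omega> \<Longrightarrow> norm (a1 x) \<le> Ba"
    using hoelder_on_subset[OF a1(1) closure_subset] unfolding hoelder_on_def bounded_iff by blast
  obtain BF where BF: "\<And>x. x \<in> \<Omega> \<Longrightarrow> norm (F1 x) \<le> BF"
    using hoelder_on_subset[OF F1(1) closure_subset] unfolding hoelder_on_def bounded_iff by blast
  define L where "L = max 0 (max Ca CF)"
  \<comment> \<open>Truncation from below turns the lower bound for \<open>a\<close> into one that holds everywhere and keeps the Hoelder constant.\<close>
  define a2 where "a2 x = max (a1 x) a_low" for x
  have a2H: "\<bar>a2 x - a2 y\<bar> \<le> L * dist x y powr \<alpha>" if "x \<in> \<Omega>" "y \<in> \<Omega>" for x y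
  proof -
    have "\<bar>a2 x - a2 y\<bar> \<le> \<bar>a1 x - a1 y\<bar>" by (auto simp: a2_def max_def)
    also have "\<dots> \<le> Ca * dist x y powr \<alpha>" using Ca[OF that] by simp
    also have "\<dots> \<le> L * dist x y powr \<alpha>" by (intro mult_right_mono) (auto simp: L_def)
    finally show ?thesis .
  qed
  have F1H: "norm (F1 x - F1 y) \<le> L * dist x y powr \<alpha>" if "x \<in> \<Omega>" "y \<in> \<Omega>" for x y
  proof -
    have "CF * dist x y powr \<alpha> \<le> L * dist x y powr \<alpha>" by (intro mult_right_mono) (auto simp: L_def)
    with CF[OF that] show ?thesis by linarith
  qed
  have a2m: "a2 \<in> borel_measurable (borel_on \<Omega>)" and F1m: "F1 \<in> borel_measurable (borel_on \<Omega>)"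
    using a2H F1H \<alpha>(1) by (auto intro!: borel_on_measurable_continuous_on continuous_on_if_Hoelder[of \<alpha> _ _ L])
  have aa: "AE x in lebesgue_on \<Omega>. a x = a2 x"
    using a1(2) a_low(2) by eventually_elim (simp add: a2_def)
  obtain g where gm: "g \<in> borel_measurable borel" and gG: "AE x in lebesgue_on \<Omega>. G0 x = g x"
    by (rule lebesgue_on_Borel_representative[OF \<Omega>b G0s(1)])
  have gm': "g \<in> borel_measurable (borel_on \<Omega>)" using gm by (rule borel_on_measurable)
  have gs: "g \<in> L2_space (borel_on \<Omega>)"
  proof -
    have m: "(\<lambda>x. (norm (g x))\<^sup>2) \<in> borel_measurable (borel_on \<Omega>)" using gm' by measurable
    have "integrable (lebesgue_on \<Omega>) (\<lambda>x. (norm (g x))\<^sup>2)"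
    proof (rule integrable_cong_AE_imp[OF G0s(2)])
      show "(\<lambda>x. (norm (g x))\<^sup>2) \<in> borel_measurable (lebesgue_on \<Omega>)"
        by (rule lebesgue_on_of_borel_on(1)[OF \<Omega>b m])
      show "AE x in lebesgue_on \<Omega>. (norm (G0 x))\<^sup>2 = (norm (g x))\<^sup>2" using gG by eventually_elim simp
    qed
    then show ?thesis using lebesgue_on_of_borel_on(2)[OF \<Omega>b m] gm' by (simp add: L2_space_def)
  qed
  interpret finite_measure "borel_on \<Omega>" by (rule finite_measure_borel_on[OF \<Omega>(2) \<Omega>b])
  have transfer: "(LINT x|lebesgue_on \<Omega>. f x) = (LINT x|borel_on \<Omega>. f' x)"
    if f: "f \<in> borel_measurable (lebesgue_on \<Omega>)" "f' \<in> borel_measurable (borel_on \<Omega>)" "AE x in lebesgue_on \<Omega>. f x = f' x" for f f' :: "'a \<Rightarrow> real"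
    using integral_cong_AE[OF f(1) lebesgue_on_of_borel_on(1)[OF \<Omega>b f(2)] f(3)] lebesgue_on_of_borel_on(3)[OF \<Omega>b f(2)]
    by simp
  have "divergence_form_equation \<Omega> g a2 F1 a_low L \<alpha>"
  proof
    fix \<phi> and b c :: 'a assume \<phi>: "\<phi> \<in> test_functions \<Omega>" and bc: "b \<in> Basis" "c \<in> Basis"
    have "(LINT x|lebesgue_on \<Omega>. (G0 x \<bullet> d) * pd e \<phi> x) = (LINT x|borel_on \<Omega>. (g x \<bullet> d) * pd e \<phi> x)" if "e \<in> Basis" for d e
    proof (rule transfer)
      have pm: "pd e \<phi> \<in> borel_measurable (borel_on \<Omega>)"
        by (rule borel_on_measurable[OF test_functions_measurable[OF test_functions_pd[OF \<phi> that]]])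
      show "(\<lambda>x. (G0 x \<bullet> d) * pd e \<phi> x) \<in> borel_measurable (lebesgue_on \<Omega>)"
        by (intro borel_measurable_times borel_measurable_inner G0s(1) borel_measurable_const lebesgue_on_of_borel_on(1)[OF \<Omega>b pm])
      show "(\<lambda>x. (g x \<bullet> d) * pd e \<phi> x) \<in> borel_measurable (borel_on \<Omega>)"
        by (intro borel_measurable_times borel_measurable_inner gm' borel_measurable_const pm)
      show "AE x in lebesgue_on \<Omega>. (G0 x \<bullet> d) * pd e \<phi> x = (g x \<bullet> d) * pd e \<phi> x"
        using gG by eventually_elim simp
    qed
    with weak_gradient_curl_free[OF G0 \<phi> bc] bc
    show "(LINT x|borel_on \<Omega>. (g x \<bullet> b) * pd c \<phi> x) = (LINT x|borel_on \<Omega>. (g x \<bullet> c) * pd b \<phi> x)" by simp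
  next
    fix \<phi> assume \<phi>: "\<phi> \<in> test_functions \<Omega>"
    have grm: "grad \<phi> \<in> borel_measurable (borel_on \<Omega>)"
      by (intro borel_on_measurable grad_measurable[OF \<phi>])
    obtain B where B: "\<And>x. norm (grad \<phi> x) \<le> B" using grad_bounded[OF \<phi>] by metis
    have grs: "grad \<phi> \<in> L2_space (borel_on \<Omega>)"
      by (rule L2_space_bounded[OF grm B])
    have a2b: "\<bar>a2 x\<bar> \<le> \<bar>Ba\<bar> + a_low" if "x \<in> \<Omega>" for x using Ba[OF that] a_low(1) by (auto simp: a2_def max_def)
    have ags: "(\<lambda>x. a2 x *\<^sub>R g x) \<in> L2_space (borel_on \<Omega>)"
    proof (rule L2_space_bound[OF gs])
      show "(\<lambda>x. a2 x *\<^sub>R g x) \<in> borel_measurable (borel_on \<Omega>)" using a2m gm' by measurable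
      show "AE x in borel_on \<Omega>. norm (a2 x *\<^sub>R g x) \<le> (\<bar>Ba\<bar> + a_low) * norm (g x)"
        using a2b by (intro AE_I2) (auto simp: space_restrict_space intro: mult_right_mono)
    qed
    have F1s: "F1 \<in> L2_space (borel_on \<Omega>)"
      using BF by (intro L2_space_bounded[OF F1m]) (auto simp: space_restrict_space)
    have am: "a \<in> borel_measurable (lebesgue_on \<Omega>)" and Fm: "F \<in> borel_measurable (lebesgue_on \<Omega>)"
      using aL sol by (auto simp: Linfty_def weak_solution_def L2_def)
    note grl = lebesgue_on_of_borel_on(1)[OF \<Omega>b grm]
    have "(LINT x|lebesgue_on \<Omega>. a x * (G0 x \<bullet> grad \<phi> x)) = (LINT x|borel_on \<Omega>. a2 x * (g x \<bullet> grad \<phi> x))"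
    proof (rule transfer)
      show "AE x in lebesgue_on \<Omega>. a x * (G0 x \<bullet> grad \<phi> x) = a2 x * (g x \<bullet> grad \<phi> x)"
        using aa gG by eventually_elim simp
    qed (intro borel_measurable_times borel_measurable_inner am a2m G0s(1) gm' grl grm)+
    moreover have "(LINT x|lebesgue_on \<Omega>. F x \<bullet> grad \<phi> x) = (LINT x|borel_on \<Omega>. F1 x \<bullet> grad \<phi> x)"
    proof (rule transfer)
      show "AE x in lebesgue_on \<Omega>. F x \<bullet> grad \<phi> x = F1 x \<bullet> grad \<phi> x"
        using F1(2) by eventually_elim simp
    qed (intro borel_measurable_inner Fm F1m grl grm)+
    moreover have "(LINT x|lebesgue_on \<Omega>. a x * (G0 x \<bullet> grad \<phi> x)) = - (LINT x|lebesgue_on \<Omega>. F x \<bullet> grad \<phi> x)"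
      using sol \<phi> unfolding weak_solution_def G0_def by blast
    moreover have "(LINT x|borel_on \<Omega>. (a2 x *\<^sub>R g x + F1 x) \<bullet> grad \<phi> x)
        = (LINT x|borel_on \<Omega>. a2 x * (g x \<bullet> grad \<phi> x)) + (LINT x|borel_on \<Omega>. F1 x \<bullet> grad \<phi> x)"
      using integrable_inner_L2[OF ags grs] integrable_inner_L2[OF F1s grs]
      by (simp add: inner_add_left)
    ultimately show "(LINT x|borel_on \<Omega>. (a2 x *\<^sub>R g x + F1 x) \<bullet> grad \<phi> x) = 0" by simp
  qed (use \<Omega> gs a_low \<alpha> a2H F1H in \<open>auto simp: L_def a2_def\<close>)
  then show ?thesis using that gG unfolding G0_def by blast
qed

theorem corollary5p1:
  fixes \<Omega> \<Omega>' :: "'a::euclidean_space set"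
    and a u :: "'a \<Rightarrow> real" and F :: "'a \<Rightarrow> 'a"
    and a_low \<alpha> \<theta> :: real
  assumes "open \<Omega>" and "bounded \<Omega>"
    and "a \<in> Linfty \<Omega>" and "a_low > 0" and "AE x in lebesgue_on \<Omega>. a x \<ge> a_low"
    and "u \<in> H1 \<Omega>" and "weak_solution \<Omega> a F u"
    and "0 < \<alpha>" and "\<alpha> < 1"
    and "compactly_contained \<Omega>' \<Omega>" and "\<theta> > 0" and "theta_smooth \<theta> \<Omega>'"
  shows "a \<in> hoelder_closure \<alpha> \<Omega> \<and> F \<in> hoelder_closure \<alpha> \<Omega>
           \<longrightarrow> weak_grad \<Omega> u \<in> hoelder_closure \<alpha> \<Omega>'"
proof (intro impI, elim conjE)
  assume aF: "a \<in> hoelder_closure \<alpha> \<Omega>" "F \<in> hoelder_closure \<alpha> \<Omega>"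
  obtain g a' F' L where eqn: "divergence_form_equation \<Omega> g a' F' a_low L \<alpha>"
    and gG: "AE x in lebesgue_on \<Omega>. weak_grad \<Omega> u x = g x"
    by (rule weak_solution_Borel_problem[OF assms(1-9) aF])
  define d where "d = setdist \<Omega>' (frontier \<Omega>)"
  have \<Omega>': "open \<Omega>'" "\<Omega>' \<subseteq> \<Omega>" and d: "d > 0" using assms(10) by (auto simp: compactly_contained_def d_def)
  define r0 where "r0 = d / (2 * real DIM('a))"
  have r0: "r0 > 0" using d by (simp add: r0_def)
  define S where "S = {x. cube x r0 \<subseteq> \<Omega>}"
  have S: "closure \<Omega>' \<subseteq> S"
    using compactly_contained_ball[OF assms(10)] cube_subset_ball[OF d r0_def] unfolding S_def d_def by blast
  obtain G where G: "hoelder_on \<alpha> S G" "AE x in lborel. x \<in> S \<longrightarrow> g x = G x"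
    by (rule divergence_form_equation.interior_Hoelder_gradient[OF eqn r0, folded S_def])
  have "AE x in lebesgue. x \<in> \<Omega> \<longrightarrow> weak_grad \<Omega> u x = g x"
    using gG assms(1) by (subst (asm) AE_restrict_space_iff) auto
  moreover have "AE x in lebesgue. x \<in> S \<longrightarrow> g x = G x" using G(2) by (rule AE_completion)
  ultimately have "AE x in lebesgue. x \<in> \<Omega>' \<longrightarrow> weak_grad \<Omega> u x = G x"
  proof eventually_elim
    case (elim x)
    have "x \<in> \<Omega> \<and> x \<in> S" if "x \<in> \<Omega>'" using that \<Omega>'(2) S closure_subset[of \<Omega>'] by blast
    then show ?case using elim by auto
  qed
  then have "AE x in lebesgue_on \<Omega>'. weak_grad \<Omega> u x = G x"
    using \<Omega>' by (subst AE_restrict_space_iff) auto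
  then show "weak_grad \<Omega> u \<in> hoelder_closure \<alpha> \<Omega>'"
    unfolding hoelder_closure_def using hoelder_on_subset[OF G(1) S] by blast
qed

end
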